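(* Let $G$ be a finite group of complex $n\times n$ unitary matrices generated by reflections acting on $V=\mathbb{C}^n$, let $\chi$ be a multiplicative character of $G$, and let $R$ be the ring of $G$-invariant polynomials. There exist $n$ $\chi$-invariant differential $1$-forms $\omega_1,\ldots,\omega_n$ such that $\Omega^{\chi}$ is generated, as an $R$-module, by the forms $\omega_{I_1}\curlywedge\cdots\curlywedge\omega_{I_p}$, for $I=\{I_1<\cdots<I_p\}\in\mathcal{I}^p$ and $p\ge 0$. Thus $\Omega^{\chi}$, with the multiplication $\curlywedge$, has the structure of an exterior algebra over $R$ (that is, it is isomorphic as a graded $R$-algebra to the exterior algebra over $R$ of the free $R$-module with basis $\omega_1,\ldots,\omega_n$, the unit element being $Q_\chi$).
   Context: A reflection is a non-identity unitary matrix of finite order fixing a hyperplane of $V=\mathbb{C}^n$ pointwise. $S=\mathbb{C}[x_1,\ldots,x_n]$ is the ring of polynomials on $V$. $G$ acts contragrediently: $(gf)(v)=f(g^{-1}v)$ for $f\in S$. $R=S^G=\mathbb{C}[f_1,\ldots,f_n]$ is the ring of invariant polynomials, where $f_1,\ldots,f_n$ are basic invariants. A multiplicative character is a homomorphism $\chi:G\to\mathbb{C}^*$; $\det$ denotes the determinant character of $G$ on $V$. Differential $p$-forms: $\Omega^p=\bigoplus_{1\le i_1<\cdots<i_p\le n}S\,dx_{i_1}\wedge\cdots\wedge dx_{i_p}\simeq S\otimes\bigwedge^pV^*$, with the induced $G$-action ($g\,dx_i=d(gx_i)$). $(\Omega^p)^\chi=\{\omega\in\Omega^p: g\omega=\chi(g)\omega\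 \text{for all } g\in G\}$, and $\Omega^\chi=\bigoplus_{p\ge0}(\Omega^p)^\chi$; these are $R$-modules, whose elements are called $\chi$-invariant forms. $\mathcal{I}^p$ is the set of $I=\{I_1,\ldots,I_p\}$ with $1\le I_1<\cdots<I_p\le n$. Let $\mathcal{A}$ be the set of reflecting hyperplanes of $G$; for $H\in\mathcal{A}$ let $\alpha_H\in S$ be a linear form with kernel $H$, $G_H$ the cyclic subgroup of elements of $G$ fixing $H$ pointwise, $s_H$ a generator of $G_H$, of order $o(s_H)$, and $a_H(\chi)$ the least integer with $0\le a_H(\chi)<o(s_H)$ and $\chi(s_H)=\det(s_H)^{-a_H(\chi)}$. Put $Q_\chi=\prod_{H\in\mathcal{A}}\alpha_H^{a_H(\chi)}$ (well defined up to a nonzero scalar; fix a choice). The $\chi$-wedge is $\mu\curlywedge\omega:=(\mu\wedge\omega)/Q_\chi$. It is associative with unit $Q_\chi$, and $\omega_{I_1}\curlywedge\cdots\curlywedge\omega_{I_p}=Q_\chi^{1-p}\,\omega_{I_1}\wedge\cdots\wedge\omega_{I_p}$; for $p=0$ the empty $\chi$-wedge is $Q_\chi$. *)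

theory Defs
  imports
    "HOL-Analysis.Analysis"
    "HOL-Algebra.Generated_Groups"
    "HOL-Algebra.QuotRing"
    "HOL-Algebra.Multiplicative_Group"
    "HOL-Library.Function_Algebras"
begin

text \<open>
  The space \<open>V\<close> is \<open>complex ^ 'n\<close>, with the finite linearly ordered type \<open>'n\<close> in the role of
  \<open>{1, \<dots>, n}\<close>. Since \<open>\<complex>\<close> is infinite, polynomials on \<open>V\<close> are identified with the polynomial
  functions they induce; functions are added and multiplied pointwise (\<open>Function_Algebras\<close>).
\<close>

type_synonym 'n cvec = "complex ^ 'n"
type_synonym 'n cmat = "complex ^ 'n ^ 'n"


section \<open>Unitary reflection groups\<close>

definition adjoint_matrix :: "'n::finite cmat \<Rightarrow> 'n cmat" where
  "adjoint_matrix A = (\<chi> i j. cnj (A $ j $ i))"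

definition unitary :: "'n::finite cmat \<Rightarrow> bool" where
  "unitary A \<longleftrightarrow> A ** adjoint_matrix A = mat 1 \<and> adjoint_matrix A ** A = mat 1"

definition unitary_group :: "('n::finite cmat) monoid" where
  "unitary_group = \<lparr>carrier = Collect unitary, mult = (**), one = mat 1\<rparr>"

definition hyperplane :: "('n::finite cvec) set \<Rightarrow> bool" where
  "hyperplane H \<longleftrightarrow> vec.subspace H \<and> vec.dim H + 1 = CARD('n)"

definition reflection :: "'n::finite cmat \<Rightarrow> bool" where
  "reflection g \<longleftrightarrow> unitary g \<and> g \<noteq> mat 1
     \<and> (\<exists>k::nat. k > 0 \<and> g [^]\<^bsub>unitary_group\<^esub> k = mat 1)
     \<and> (\<exists>H. hyperplane H \<and> (\<forall>v\<in>H. g *v v = v))"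

definition reflection_group :: "('n::finite cmat) set \<Rightarrow> bool" where
  "reflection_group G \<longleftrightarrow> finite G \<and> subgroup G unitary_group
     \<and> (\<exists>T. (\<forall>t\<in>T. reflection t) \<and> G = generate unitary_group T)"

definition reflecting_hyperplanes ::
    "('n::finite cmat) set \<Rightarrow> ('n cvec) set set" where
  "reflecting_hyperplanes G =
     {H. hyperplane H \<and> (\<exists>g\<in>G. reflection g \<and> (\<forall>v\<in>H. g *v v = v))}"

definition pointwise_stabilizer ::
    "('n::finite cmat) set \<Rightarrow> ('n cvec) set \<Rightarrow> ('n cmat) set" where
  "pointwise_stabilizer G H = {g\<in>G. \<forall>v\<in>H. g *v v = v}"

definition nonzero_complex :: "complex monoid" where
  "nonzero_complex = \<lparr>carrier = - {0}, mult = (*), one = 1\<rparr>"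

definition multiplicative_character ::
    "('n::finite cmat) set \<Rightarrow> ('n cmat \<Rightarrow> complex) \<Rightarrow> bool" where
  "multiplicative_character G \<theta> \<longleftrightarrow> \<theta> \<in> hom (unitary_group\<lparr>carrier := G\<rparr>) nonzero_complex"


section \<open>Polynomials and invariants\<close>

inductive_set polynomials :: "('n::finite cvec \<Rightarrow> complex) set" where
  const: "(\<lambda>v. c) \<in> polynomials"
| coord: "(\<lambda>v. v $ i) \<in> polynomials"
| add: "f \<in> polynomials \<Longrightarrow> g \<in> polynomials \<Longrightarrow> f + g \<in> polynomials"
| mult: "f \<in> polynomials \<Longrightarrow> g \<in> polynomials \<Longrightarrow> f * g \<in> polynomials"

definition act :: "'n::finite cmat \<Rightarrow> ('n cvec \<Rightarrow> complex) \<Rightarrow> 'n cvec \<Rightarrow> complex" where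
  "act g f = (\<lambda>v. f (matrix_inv g *v v))"

definition invariants :: "('n::finite cmat) set \<Rightarrow> ('n cvec \<Rightarrow> complex) set" where
  "invariants G = {f \<in> polynomials. \<forall>g\<in>G. act g f = f}"


section \<open>Exterior algebras of free modules with a finite ordered basis\<close>

text \<open>
  Let \<open>A\<close> be a subring of a commutative ring. An element of the exterior algebra over \<open>A\<close> of the
  free module with basis \<open>(e\<^sub>i)\<close> is encoded by its coefficients: \<open>c\<close> stands for the sum of the
  terms \<open>c I \<cdot> e\<^bsub>I\<^sub>1\<^esub> \<and> \<dots> \<and> e\<^bsub>I\<^sub>p\<^esub>\<close> over all \<open>I = {I\<^sub>1 < \<dots> < I\<^sub>p}\<close>. The exponent of \<open>-1\<close> in the
  product counts the inversions that occur in concatenating \<open>I\<close> and \<open>K - I\<close>.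
\<close>

definition wedge ::
    "('n::{finite,linorder} set \<Rightarrow> 'r::comm_ring_1) \<Rightarrow> ('n set \<Rightarrow> 'r) \<Rightarrow> 'n set \<Rightarrow> 'r" where
  "wedge \<mu> \<omega> = (\<lambda>K. \<Sum>I\<in>Pow K.
     (- 1) ^ card {(i, j). i \<in> I \<and> j \<in> K - I \<and> j < i} * (\<mu> I * \<omega> (K - I)))"

definition scale :: "'r::comm_ring_1 \<Rightarrow> ('n set \<Rightarrow> 'r) \<Rightarrow> 'n set \<Rightarrow> 'r" where
  "scale f \<omega> = (\<lambda>I. f * \<omega> I)"

definition degree0 :: "'r::comm_ring_1 \<Rightarrow> 'n set \<Rightarrow> 'r" where
  "degree0 f = (\<lambda>I. if I = {} then f else 0)"

definition ext_gen :: "'n \<Rightarrow> 'n set \<Rightarrow> 'r::comm_ring_1" where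
  "ext_gen i = (\<lambda>I. if I = {i} then 1 else 0)"

definition ext_power :: "'r::comm_ring_1 set \<Rightarrow> nat \<Rightarrow> ('n set \<Rightarrow> 'r) set" where
  "ext_power A p = {c. (\<forall>I. c I \<in> A) \<and> (\<forall>I. card I \<noteq> p \<longrightarrow> c I = 0)}"

definition ext_algebra ::
    "'r::comm_ring_1 set \<Rightarrow> ('r, 'n::{finite,linorder} set \<Rightarrow> 'r) module" where
  "ext_algebra A = \<lparr>carrier = {c. \<forall>I. c I \<in> A}, mult = wedge, one = degree0 1,
     zero = 0, add = (+), smult = scale\<rparr>"

definition module_span :: "'r::comm_ring_1 set \<Rightarrow> ('n set \<Rightarrow> 'r) set \<Rightarrow> ('n set \<Rightarrow> 'r) set" where
  "module_span A B = {\<Sum>x\<in>F. scale (r x) x | F r. finite F \<and> F \<subseteq> B \<and> (\<forall>x\<in>F. r x \<in> A)}"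

definition graded_algebra_iso ::
    "'r set \<Rightarrow> ('r, 'a) module \<Rightarrow> (nat \<Rightarrow> 'a set) \<Rightarrow> ('r, 'b) module \<Rightarrow> (nat \<Rightarrow> 'b set)
      \<Rightarrow> ('a \<Rightarrow> 'b) \<Rightarrow> bool" where
  "graded_algebra_iso A M Mdeg N Ndeg \<Phi> \<longleftrightarrow> \<Phi> \<in> ring_iso M N
     \<and> (\<forall>r\<in>A. \<forall>x\<in>carrier M. \<Phi> (r \<odot>\<^bsub>M\<^esub> x) = r \<odot>\<^bsub>N\<^esub> \<Phi> x)
     \<and> (\<forall>p. \<Phi> ` Mdeg p = Ndeg p)"


section \<open>Differential forms\<close>

type_synonym 'n form = "'n set \<Rightarrow> 'n cvec \<Rightarrow> complex"

definition forms :: "nat \<Rightarrow> 'n::finite form set" where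
  "forms p = ext_power polynomials p"

definition partial_deriv ::
    "'n::finite \<Rightarrow> ('n cvec \<Rightarrow> complex) \<Rightarrow> 'n cvec \<Rightarrow> complex" where
  "partial_deriv j f = (\<lambda>v. deriv (\<lambda>t. f (v + axis j t)) 0)"

definition differential :: "('n::finite cvec \<Rightarrow> complex) \<Rightarrow> 'n form" where
  "differential f = (\<Sum>j\<in>UNIV. scale (partial_deriv j f) (ext_gen j))"

text \<open>
  The action is \<open>g (f dx\<^bsub>I\<^sub>1\<^esub> \<and> \<dots> \<and> dx\<^bsub>I\<^sub>p\<^esub>) = (g f) d(g x\<^bsub>I\<^sub>1\<^esub>) \<and> \<dots> \<and> d(g x\<^bsub>I\<^sub>p\<^esub>)\<close>.
\<close>

definition act_form :: "'n::{finite,linorder} cmat \<Rightarrow> 'n form \<Rightarrow> 'n form" where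
  "act_form g \<omega> = (\<Sum>I\<in>UNIV. scale (act g (\<omega> I))
     (foldr wedge (map (\<lambda>i. differential (act g (\<lambda>v. v $ i))) (sorted_list_of_set I)) (degree0 1)))"

definition chi_forms ::
    "('n::{finite,linorder} cmat) set \<Rightarrow> ('n cmat \<Rightarrow> complex) \<Rightarrow> nat
      \<Rightarrow> 'n form set" where
  "chi_forms G \<theta> p = {\<omega> \<in> forms p. \<forall>g\<in>G. act_form g \<omega> = scale (\<lambda>v. \<theta> g) \<omega>}"

definition all_chi_forms ::
    "('n::{finite,linorder} cmat) set \<Rightarrow> ('n cmat \<Rightarrow> complex) \<Rightarrow> 'n form set" where
  "all_chi_forms G \<theta> = {\<Sum>p\<le>CARD('n). \<eta> p | \<eta>. \<forall>p. \<eta> p \<in> chi_forms G \<theta> p}"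


section \<open>The semi-invariant \<open>Q\<close> and the twisted wedge product\<close>

text \<open>
  Below, \<open>\<alpha> H\<close> is the chosen linear form with kernel \<open>H\<close>, and \<open>s H\<close> the chosen generator of the
  pointwise stabilizer of \<open>H\<close>.
\<close>

definition linear_form_with_kernel ::
    "('n::finite cvec \<Rightarrow> complex) \<Rightarrow> ('n cvec) set \<Rightarrow> bool" where
  "linear_form_with_kernel f H \<longleftrightarrow> Vector_Spaces.linear (*s) (*) f \<and> {v. f v = 0} = H"

definition char_exponent ::
    "('n::finite cmat \<Rightarrow> complex) \<Rightarrow> 'n cmat \<Rightarrow> nat" where
  "char_exponent \<theta> t =
     (LEAST a. a < group.ord unitary_group t \<and> \<theta> t = det t powi (- int a))"

definition Q_poly ::
    "('n::finite cmat) set \<Rightarrow> ('n cmat \<Rightarrow> complex)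
      \<Rightarrow> (('n cvec) set \<Rightarrow> 'n cmat)
      \<Rightarrow> (('n cvec) set \<Rightarrow> 'n cvec \<Rightarrow> complex) \<Rightarrow> 'n cvec \<Rightarrow> complex" where
  "Q_poly G \<theta> s \<alpha> = (\<Prod>H\<in>reflecting_hyperplanes G. \<alpha> H ^ char_exponent \<theta> (s H))"

text \<open>
  The quotient by \<open>q\<close> is taken in the module of polynomial forms, not pointwise (where \<open>x / 0 = 0\<close>
  would spoil it on the zero set of \<open>q\<close>). For a polynomial \<open>q \<noteq> 0\<close> it is unique; its existence
  amounts to divisibility of \<open>\<mu> \<and> \<omega>\<close> by \<open>q\<close>.
\<close>

definition chi_wedge ::
    "('n::{finite,linorder} cvec \<Rightarrow> complex) \<Rightarrow> 'n form \<Rightarrow> 'n form \<Rightarrow> 'n form" where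
  "chi_wedge q \<mu> \<omega> = (THE \<eta>. (\<forall>I. \<eta> I \<in> polynomials) \<and> scale q \<eta> = wedge \<mu> \<omega>)"

definition chi_wedge_set ::
    "('n::{finite,linorder} cvec \<Rightarrow> complex) \<Rightarrow> ('n \<Rightarrow> 'n form) \<Rightarrow> 'n set \<Rightarrow> 'n form" where
  "chi_wedge_set q \<omega> I = foldr (chi_wedge q) (map \<omega> (sorted_list_of_set I)) (degree0 q)"

definition chi_algebra ::
    "('n::{finite,linorder} cmat) set \<Rightarrow> ('n cmat \<Rightarrow> complex)
      \<Rightarrow> ('n cvec \<Rightarrow> complex) \<Rightarrow> ('n cvec \<Rightarrow> complex, 'n form) module" where
  "chi_algebra G \<theta> q = \<lparr>carrier = all_chi_forms G \<theta>, mult = chi_wedge q, one = degree0 q,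
     zero = 0, add = (+), smult = scale\<rparr>"

end

theory Submission
  imports Defs "HOL-Computational_Algebra.Fundamental_Theorem_Algebra"
begin

text \<open>
  The averaging argument of Chevalley, run with semi-invariant 1-forms in place of polynomials, shows
  that homogeneous forms independent modulo the positive-degree invariants are independent over the
  invariant ring, so that \<open>n\<close> semi-invariant 1-forms \<open>\<omega> i\<close> generate all the others. Written in an
  eigenframe of the generator \<open>s H\<close>, the coefficients of a semi-invariant form are divisible by
  powers of \<open>\<alpha> H\<close>; hence \<open>Q\<close> divides products, and a fixed product of powers of the \<open>\<alpha> H\<close> divides
  every semi-invariant top form. For the twisted product of all \<open>\<omega> i\<close> the quotient is a constant:
  semi-invariant forms with prescribed leading terms at a point show that it does not vanish off a set
  of codimension two. Cramer's rule for the twisted product then yields all coefficients in the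
  invariant ring.
\<close>

section \<open>Exterior algebra\<close>

text \<open>The generators come from a maximality argument, so neither their degrees nor their exact
  number is known in advance; a family of fewer than n forms is filled up with zeros, and only the
  nonvanishing of the top product rules this out. Constancy of the quotient r of the top coefficient
  by \<open>Q_dual\<close> is therefore decided point by point. If r were not constant, it would
  have a zero v whose stabilizer is trivial or fixes one hyperplane H pointwise. In the second case
  let a be the exponent of H and o the order of \<open>s H\<close>: the n - 1 covectors along H need
  the factor \<open>\<alpha> H ^ a\<close>, and the transversal covector needs the power a - 1, or o
  - 1 if a = 0. The sum of these powers is the order of \<open>Q ^ (n - 1) * Q_dual\<close> on a
  line through v transversal to H, and averages of local forms realise a determinant of exactly this
  order; a zero of r at v would make it larger. This count explains \<open>coexponent\<close> and
  \<open>Q_dual\<close>.\<close>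

definition ext_basis :: "'n set \<Rightarrow> 'n set \<Rightarrow> 'r::comm_ring_1" where
  "ext_basis I = (\<lambda>K. if K = I then 1 else 0)"

text \<open>The sign exponent of \<open>wedge\<close> for an arbitrary second set, not only a
  complement; in this form it is additive under disjoint unions in either argument.\<close>

definition inversions :: "'n::linorder set \<Rightarrow> 'n set \<Rightarrow> nat" where
  "inversions I J = card {(i, j). i \<in> I \<and> j \<in> J \<and> j < i}"

lemma scale_apply [simp]: "scale f \<omega> I = f * \<omega> I"
  by (simp add: scale_def)

lemma scale_scale: "scale f (scale g \<omega>) = scale (f * g) \<omega>"
  by (simp add: fun_eq_iff mult.assoc)

lemma scale_add_right: "scale f (\<mu> + \<omega>) = scale f \<mu> + scale f \<omega>"
  by (simp add: fun_eq_iff distrib_left)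

lemma scale_add_left: "scale (f + g) \<omega> = scale f \<omega> + scale g \<omega>"
  by (simp add: fun_eq_iff distrib_right)

lemma scale_zero [simp]: "scale f 0 = 0" "scale 0 \<omega> = 0"
  by (simp_all add: fun_eq_iff)

lemma scale_one [simp]: "scale 1 \<omega> = \<omega>"
  by (simp add: fun_eq_iff)

lemma sum_fun_apply: "(\<Sum>x\<in>A. f x) y = (\<Sum>x\<in>A. f x y)"
  by (induction A rule: infinite_finite_induct) auto

lemma scale_sum_right: "scale f (\<Sum>x\<in>A. w x) = (\<Sum>x\<in>A. scale f (w x))"
  by (simp add: fun_eq_iff sum_fun_apply sum_distrib_left)

lemma scale_sum_left: "scale (\<Sum>x\<in>A. w x) \<omega> = (\<Sum>x\<in>A. scale (w x) \<omega>)"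
  by (simp add: fun_eq_iff sum_fun_apply sum_distrib_right)

lemma ext_basis_expand:
  fixes \<omega> :: "'n::finite set \<Rightarrow> 'r::comm_ring_1"
  shows "\<omega> = (\<Sum>I\<in>UNIV. scale (\<omega> I) (ext_basis I))"
  by (simp add: fun_eq_iff sum_fun_apply ext_basis_def mult_delta_right)

lemma degree0_one: "degree0 1 = ext_basis {}"
  by (simp add: degree0_def ext_basis_def fun_eq_iff)

lemma degree0_scale: "degree0 f = scale f (ext_basis {})"
  by (simp add: degree0_def ext_basis_def fun_eq_iff)

lemma ext_gen_basis: "ext_gen i = ext_basis {i}"
  by (simp add: ext_gen_def ext_basis_def fun_eq_iff)

lemma inversions_Un_left:
  fixes I J K :: "'n::{finite,linorder} set"
  assumes "I \<inter> J = {}"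
  shows "inversions (I \<union> J) K = inversions I K + inversions J K"
proof -
  have "{(i, j). i \<in> I \<union> J \<and> j \<in> K \<and> j < i} =
     {(i, j). i \<in> I \<and> j \<in> K \<and> j < i} \<union> {(i, j). i \<in> J \<and> j \<in> K \<and> j < i}" by auto
  then show ?thesis unfolding inversions_def
    using assms by (simp only:) (rule card_Un_disjoint, auto)
qed

lemma inversions_Un_right:
  fixes I J K :: "'n::{finite,linorder} set"
  assumes "J \<inter> K = {}"
  shows "inversions I (J \<union> K) = inversions I J + inversions I K"
proof -
  have "{(i, j). i \<in> I \<and> j \<in> J \<union> K \<and> j < i} =
     {(i, j). i \<in> I \<and> j \<in> J \<and> j < i} \<union> {(i, j). i \<in> I \<and> j \<in> K \<and> j < i}" by auto
  then show ?thesis unfolding inversions_def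
    using assms by (simp only:) (rule card_Un_disjoint, auto)
qed

lemma inversions_empty [simp]: "inversions {} J = 0" "inversions I {} = 0"
  by (simp_all add: inversions_def)

lemma wedge_inversions:
  "wedge \<mu> \<omega> K = (\<Sum>I\<in>Pow K. (- 1) ^ inversions I (K - I) * (\<mu> I * \<omega> (K - I)))"
  by (simp add: wedge_def inversions_def)

lemma wedge_add_left: "wedge (\<mu> + \<mu>') \<omega> = wedge \<mu> \<omega> + wedge \<mu>' \<omega>"
  by (simp add: fun_eq_iff wedge_def sum.distrib distrib_left distrib_right)

lemma wedge_add_right: "wedge \<omega> (\<mu> + \<mu>') = wedge \<omega> \<mu> + wedge \<omega> \<mu>'"
  by (simp add: fun_eq_iff wedge_def sum.distrib distrib_left)

lemma wedge_scale_left: "wedge (scale f \<mu>) \<omega> = scale f (wedge \<mu> \<omega>)"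
  by (simp add: fun_eq_iff wedge_def sum_distrib_left algebra_simps)

lemma wedge_scale_right: "wedge \<mu> (scale f \<omega>) = scale f (wedge \<mu> \<omega>)"
  by (simp add: fun_eq_iff wedge_def sum_distrib_left algebra_simps)

lemma wedge_zero [simp]: "wedge 0 \<omega> = 0" "wedge \<omega> 0 = 0"
  by (simp_all add: fun_eq_iff wedge_def)

lemma wedge_sum_left:
  fixes \<omega> :: "'n::{finite,linorder} set \<Rightarrow> 'r::comm_ring_1"
  shows "wedge (\<Sum>x\<in>A. w x) \<omega> = (\<Sum>x\<in>A. wedge (w x) \<omega>)"
  using sum_comp_morphism[of "\<lambda>\<mu>. wedge \<mu> \<omega>" w A] by (simp add: wedge_add_left o_def)

lemma wedge_sum_right:
  fixes \<omega> :: "'n::{finite,linorder} set \<Rightarrow> 'r::comm_ring_1"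
  shows "wedge \<omega> (\<Sum>x\<in>A. w x) = (\<Sum>x\<in>A. wedge \<omega> (w x))"
  using sum_comp_morphism[of "wedge \<omega>" w A] by (simp add: wedge_add_right o_def)

lemma wedge_basis:
  fixes I J :: "'n::{finite,linorder} set"
  shows "wedge (ext_basis I) (ext_basis J) =
    (if I \<inter> J = {} then scale ((- 1) ^ inversions I J) (ext_basis (I \<union> J)) else (0 :: _ \<Rightarrow> 'r::comm_ring_1))"
proof
  fix K
  have "wedge (ext_basis I) (ext_basis J) K =
      (\<Sum>I'\<in>Pow K. if I' = I then (if K - I = J then (- 1) ^ inversions I J else 0) else (0::'r))"
    unfolding wedge_inversions by (rule sum.cong) (auto simp: ext_basis_def)
  also have "\<dots> = (if I \<subseteq> K \<and> K - I = J then (- 1) ^ inversions I J else 0)"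
    by (simp add: sum.delta)
  also have "\<dots> = (if I \<inter> J = {} then scale ((- 1) ^ inversions I J) (ext_basis (I \<union> J)) else 0) K"
    by (auto simp: ext_basis_def)
  finally show "wedge (ext_basis I) (ext_basis J) K = (if I \<inter> J = {} then scale ((- 1) ^ inversions I J) (ext_basis (I \<union> J)) else (0 :: _ \<Rightarrow> 'r)) K" .
qed

lemma wedge_sum_sum:
  fixes x :: "'a \<Rightarrow> 'n::{finite,linorder} set \<Rightarrow> 'r::comm_ring_1"
  shows "wedge (\<Sum>k\<in>X. scale (a k) (x k)) (\<Sum>l\<in>Y. scale (b l) (y l)) =
    (\<Sum>k\<in>X. \<Sum>l\<in>Y. scale (a k * b l) (wedge (x k) (y l)))"
proof -
  have "wedge (\<Sum>k\<in>X. scale (a k) (x k)) (\<Sum>l\<in>Y. scale (b l) (y l)) =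
     (\<Sum>k\<in>X. scale (a k) (wedge (x k) (\<Sum>l\<in>Y. scale (b l) (y l))))"
    by (simp only: wedge_sum_left wedge_scale_left)
  also have "\<dots> = (\<Sum>k\<in>X. \<Sum>l\<in>Y. scale (a k * b l) (wedge (x k) (y l)))"
    by (simp only: wedge_sum_right wedge_scale_right scale_sum_right scale_scale)
  finally show ?thesis .
qed

lemma wedge_expand:
  fixes \<mu> \<omega> :: "'n::{finite,linorder} set \<Rightarrow> 'r::comm_ring_1"
  shows "wedge \<mu> \<omega> = (\<Sum>I\<in>UNIV. \<Sum>J\<in>UNIV. scale (\<mu> I * \<omega> J) (wedge (ext_basis I) (ext_basis J)))"
  using wedge_sum_sum[of \<mu> ext_basis UNIV \<omega> ext_basis UNIV]
  by (simp only: ext_basis_expand[symmetric])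

text \<open>Both bracketings have the sign exponent
  \<open>inversions I J + inversions I K + inversions J K\<close>, and both vanish as soon as two of
  the sets meet.\<close>

lemma wedge_assoc_basis:
  fixes I J K :: "'n::{finite,linorder} set"
  shows "wedge (wedge (ext_basis I) (ext_basis J)) (ext_basis K) =
     wedge (ext_basis I) (wedge (ext_basis J) (ext_basis K) :: _ \<Rightarrow> 'r::comm_ring_1)"
  by (auto simp: wedge_basis wedge_scale_left wedge_scale_right scale_scale
      inversions_Un_left inversions_Un_right power_add Int_Un_distrib Int_Un_distrib2 Un_assoc mult_ac)

lemma wedge_assoc:
  fixes \<mu> \<nu> \<omega> :: "'n::{finite,linorder} set \<Rightarrow> 'r::comm_ring_1"
  shows "wedge (wedge \<mu> \<nu>) \<omega> = wedge \<mu> (wedge \<nu> \<omega>)"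
proof -
  have 1: "wedge (wedge (ext_basis I) (ext_basis J)) \<omega> = wedge (ext_basis I) (wedge (ext_basis J) \<omega>)"
    for I J
    by (subst (1 2) ext_basis_expand[of \<omega>])
      (simp add: wedge_sum_right wedge_scale_right wedge_assoc_basis)
  have 2: "wedge (wedge (ext_basis I) \<nu>) \<omega> = wedge (ext_basis I) (wedge \<nu> \<omega>)" for I
    by (subst (1 2) ext_basis_expand[of \<nu>])
      (simp add: wedge_sum_right wedge_scale_right wedge_sum_left wedge_scale_left 1)
  show ?thesis
    by (subst (1 2) ext_basis_expand[of \<mu>])
      (simp add: wedge_sum_left wedge_scale_left 2)
qed

lemma wedge_one_left [simp]: "wedge (ext_basis {}) \<omega> = (\<omega> :: 'n::{finite,linorder} set \<Rightarrow> 'r::comm_ring_1)"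
  by (subst (1) ext_basis_expand[of \<omega>], subst (2) ext_basis_expand[of \<omega>])
    (simp add: wedge_sum_right wedge_scale_right wedge_basis)

lemma wedge_one_right [simp]: "wedge \<omega> (ext_basis {}) = (\<omega> :: 'n::{finite,linorder} set \<Rightarrow> 'r::comm_ring_1)"
  by (subst (1) ext_basis_expand[of \<omega>], subst (2) ext_basis_expand[of \<omega>])
    (simp add: wedge_sum_left wedge_scale_left wedge_basis)

section \<open>Matrices acting on the exterior algebra\<close>

definition row_form :: "('n \<Rightarrow> 'n \<Rightarrow> 'r) \<Rightarrow> 'n \<Rightarrow> 'n::finite set \<Rightarrow> 'r::comm_ring_1" where
  "row_form A i = (\<Sum>j\<in>UNIV. scale (A i j) (ext_basis {j}))"

definition row_wedge :: "('n \<Rightarrow> 'n \<Rightarrow> 'r) \<Rightarrow> 'n set \<Rightarrow> 'n::{finite,linorder} set \<Rightarrow> 'r::comm_ring_1" where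
  "row_wedge A I = foldr wedge (map (row_form A) (sorted_list_of_set I)) (ext_basis {})"

text \<open>The algebra map that sends the basis covector i to row i of A. Its matrix consists of
  the minors: \<open>row_wedge A I K\<close> is the minor of A with rows I and columns K, and it is
  zero unless I and K have equal size.\<close>

definition lam :: "('n \<Rightarrow> 'n \<Rightarrow> 'r) \<Rightarrow> ('n set \<Rightarrow> 'r) \<Rightarrow> 'n::{finite,linorder} set \<Rightarrow> 'r::comm_ring_1" where
  "lam A \<omega> = (\<Sum>I\<in>UNIV. scale (\<omega> I) (row_wedge A I))"

lemma row_form_apply: "row_form A i I = (\<Sum>j\<in>UNIV. if I = {j} then A i j else 0)"
  by (simp add: row_form_def sum_fun_apply ext_basis_def mult_delta_right if_distrib cong: if_cong)

lemma row_form_singleton [simp]: "row_form A i {j} = A i j"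
  by (simp add: row_form_apply)

lemma row_form_card: "card I \<noteq> 1 \<Longrightarrow> row_form A i I = 0"
  by (auto simp: row_form_apply intro!: sum.neutral)

lemma inversions_singletons: "inversions {i} {j} = (if j < i then 1 else 0)"
proof -
  have "{(a, b). a \<in> {i} \<and> b \<in> {j} \<and> b < a} = (if j < i then {(i, j)} else {})" by auto
  then show ?thesis by (simp add: inversions_def)
qed

lemma wedge_gen_anti:
  fixes i j :: "'n::{finite,linorder}"
  shows "wedge (ext_basis {i}) (ext_basis {j}) = - (wedge (ext_basis {j}) (ext_basis {i}) :: _ \<Rightarrow> 'r::comm_ring_1)"
  by (cases i j rule: linorder_cases) (auto simp: wedge_basis inversions_singletons insert_commute fun_eq_iff)

lemma row_form_anti: "wedge (row_form A i) (row_form B j) = - wedge (row_form B j) (row_form A i)"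
proof -
  have *: "wedge (row_form A i) (row_form B j) =
     (\<Sum>k\<in>UNIV. \<Sum>l\<in>UNIV. scale (A i k * B j l) (wedge (ext_basis {k}) (ext_basis {l})))" for A B i j
    unfolding row_form_def by (rule wedge_sum_sum)
  have "wedge (row_form A i) (row_form B j) = (\<Sum>k\<in>UNIV. \<Sum>l\<in>UNIV. scale (A i k * B j l) (wedge (ext_basis {k}) (ext_basis {l})))"
    by (rule *)
  also have "\<dots> = (\<Sum>k\<in>UNIV. \<Sum>l\<in>UNIV. - scale (A i k * B j l) (wedge (ext_basis {l}) (ext_basis {k})))"
    by (intro sum.cong refl, subst wedge_gen_anti) (simp add: fun_eq_iff)
  also have "\<dots> = (\<Sum>l\<in>UNIV. \<Sum>k\<in>UNIV. - scale (B j l * A i k) (wedge (ext_basis {l}) (ext_basis {k})))"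
    by (subst sum.swap) (simp add: mult.commute)
  also have "\<dots> = - wedge (row_form B j) (row_form A i)"
    by (simp add: *[of B j A i] sum_negf)
  finally show ?thesis .
qed

text \<open>Skew-symmetry only gives \<open>2 (x \<and> x) = 0\<close>; over a general ring the square has to be computed.\<close>

lemma row_form_square: "wedge (row_form A i) (row_form A i) = 0"
proof
  fix K
  show "wedge (row_form A i) (row_form A i) K = 0 K"
  proof (cases "\<exists>k l. k < l \<and> K = {k, l}")
    case True
    then obtain k l where kl: "k < l" "K = {k, l}" by auto
    have "wedge (row_form A i) (row_form A i) K =
      (\<Sum>I\<in>{{k}, {l}}. (- 1) ^ inversions I (K - I) * (row_form A i I * row_form A i (K - I)))"
      unfolding wedge_inversions
    proof (rule sum.mono_neutral_right)
      show "\<forall>I\<in>Pow K - {{k}, {l}}. (- 1) ^ inversions I (K - I) * (row_form A i I * row_form A i (K - I)) = 0"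
      proof
        fix I assume I: "I \<in> Pow K - {{k}, {l}}"
        then have "I = {} \<or> I = {k, l}" using kl by auto
        then have "card I \<noteq> 1" using kl by auto
        then show "(- 1) ^ inversions I (K - I) * (row_form A i I * row_form A i (K - I)) = 0"
          by (simp add: row_form_card)
      qed
    qed (use kl in auto)
    also have "\<dots> = 0"
      using kl by (simp add: insert_Diff_if inversions_singletons less_not_sym mult.commute)
    finally show ?thesis by simp
  next
    case False
    have "row_form A i I * row_form A i (K - I) = 0" if "I \<subseteq> K" for I
    proof (rule ccontr)
      assume "\<not> ?thesis"
      then have "card I = 1" "card (K - I) = 1"
        using row_form_card[of I A i] row_form_card[of "K - I" A i] by force+
      then obtain k l where *: "I = {k}" "K - I = {l}"
        by (auto simp: card_1_singleton_iff)
      then have "K = {k, l}" "k \<noteq> l" using that by auto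
      with False show False by (metis insert_commute linorder_neqE)
    qed
    then show ?thesis by (simp add: wedge_inversions)
  qed
qed

lemma sorted_list_of_set_min:
  fixes J :: "'n::{finite,linorder} set"
  assumes "\<forall>j\<in>J. m < j"
  shows "sorted_list_of_set (insert m J) = m # sorted_list_of_set J"
proof -
  have "m \<notin> J" using assms by auto
  have "Min (insert m J) = m" by (rule Min_eqI) (use assms in auto)
  then show ?thesis
    using sorted_list_of_set_nonempty[of "insert m J"] \<open>m \<notin> J\<close> by simp
qed

lemma row_wedge_empty [simp]: "row_wedge A {} = ext_basis {}"
  by (simp add: row_wedge_def)

lemma row_wedge_min:
  assumes "\<forall>j\<in>J. m < j"
  shows "row_wedge A (insert m J) = wedge (row_form A m) (row_wedge A J)"
  by (simp add: row_wedge_def sorted_list_of_set_min[OF assms])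

lemma inversions_singleton_less:
  assumes "\<forall>j\<in>J. m < j" shows "inversions {m} J = 0"
proof -
  have "{(i, j). i \<in> {m} \<and> j \<in> J \<and> j < i} = {}" using assms by auto
  then show ?thesis unfolding inversions_def by (simp only: card.empty)
qed

text \<open>Row i is moved to its place in the increasing product. Passing each smaller factor costs
  one sign, in total \<open>inversions {i} J\<close>; meeting itself, the row gives zero.\<close>

lemma row_form_wedge_row_wedge:
  fixes J :: "'n::{finite,linorder} set" and A :: "'n \<Rightarrow> 'n \<Rightarrow> 'r::comm_ring_1"
  shows "wedge (row_form A i) (row_wedge A J) =
    (if i \<in> J then 0 else scale ((- 1) ^ inversions {i} J) (row_wedge A (insert i J)))"
proof (induction J rule: finite_linorder_min_induct[OF finite, case_names empty insert])
  case empty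
  show ?case by (simp add: row_wedge_def)
next
  case (insert m J)
  then have m: "\<forall>j\<in>J. m < j" "m \<notin> J" by auto
  note IH = insert.IH
  consider "i < m" | "i = m" | "m < i" by force
  then show ?case
  proof cases
    case 1
    then have "\<forall>j\<in>insert m J. i < j" using m by auto
    then show ?thesis
      using 1 m by (auto simp: row_wedge_min inversions_singleton_less)
  next
    case 2
    then show ?thesis
      by (simp add: row_wedge_min[OF m(1)] wedge_assoc[symmetric] row_form_square)
  next
    case 3
    have inv: "inversions {i} (insert m J) = Suc (inversions {i} J)"
      using inversions_Un_right[of "{m}" J "{i}"] m 3 by (simp add: inversions_singletons)
    have min: "\<forall>j\<in>insert i J. m < j" using m 3 by auto
    have "wedge (row_form A i) (row_wedge A (insert m J)) =
        - wedge (row_form A m) (wedge (row_form A i) (row_wedge A J))"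
      by (simp add: row_wedge_min[OF m(1)] wedge_assoc[symmetric])
        (subst row_form_anti, simp add: fun_eq_iff wedge_def sum_negf)
    also have "\<dots> = (if i \<in> J then 0 else
        - scale ((- 1) ^ inversions {i} J) (row_wedge A (insert m (insert i J))))"
      unfolding IH by (cases "i \<in> J") (simp_all add: wedge_scale_right row_wedge_min[OF min])
    finally show ?thesis using 3
      by (cases "i \<in> J") (auto simp: inv insert_commute fun_eq_iff)
  qed
qed

text \<open>The rows obey the multiplication table of the basis covectors in
  \<open>wedge_basis\<close>. This is the reason why \<open>lam A\<close> is multiplicative.\<close>

lemma row_wedge_wedge:
  fixes I J :: "'n::{finite,linorder} set" and A :: "'n \<Rightarrow> 'n \<Rightarrow> 'r::comm_ring_1"
  shows "wedge (row_wedge A I) (row_wedge A J) =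
    (if I \<inter> J = {} then scale ((- 1) ^ inversions I J) (row_wedge A (I \<union> J)) else 0)"
proof (induction I rule: finite_linorder_min_induct[OF finite, case_names empty insert])
  case empty
  show ?case by simp
next
  case (insert m I)
  then have m: "\<forall>j\<in>I. m < j" "m \<notin> I" by auto
  have 1: "inversions (insert m I) J = inversions {m} J + inversions I J"
    using inversions_Un_left[of "{m}" I J] m by simp
  have 2: "inversions {m} (I \<union> J) = inversions {m} J" if "I \<inter> J = {}"
    using inversions_Un_right[of I J "{m}"] that m by (simp add: inversions_singleton_less)
  have "wedge (row_wedge A (insert m I)) (row_wedge A J) =
     wedge (row_form A m) (wedge (row_wedge A I) (row_wedge A J))"
    by (simp add: row_wedge_min[OF m(1)] wedge_assoc)
  also have "\<dots> = wedge (row_form A m)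
      (if I \<inter> J = {} then scale ((- 1) ^ inversions I J) (row_wedge A (I \<union> J)) else 0)"
    by (subst insert.IH) (rule refl)
  also have "\<dots> = (if insert m I \<inter> J = {}
      then scale ((- 1) ^ inversions (insert m I) J) (row_wedge A (insert m I \<union> J)) else 0)"
    using m by (auto simp: wedge_scale_right row_form_wedge_row_wedge scale_scale power_add 1 2 mult.commute)
  finally show ?case .
qed

lemma lam_basis [simp]: "lam A (ext_basis I) = row_wedge A I"
  by (simp add: lam_def ext_basis_def fun_eq_iff sum_fun_apply mult_delta_left)

lemma lam_add: "lam A (\<mu> + \<omega>) = lam A \<mu> + lam A \<omega>"
  by (simp add: lam_def scale_add_left sum.distrib)

lemma lam_scale: "lam A (scale f \<omega>) = scale f (lam A \<omega>)"
  by (simp add: lam_def scale_sum_right scale_scale)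

lemma lam_zero [simp]: "lam A 0 = 0"
  by (simp add: lam_def)

lemma lam_sum: "lam A (\<Sum>x\<in>X. w x) = (\<Sum>x\<in>X. lam A (w x))"
  using sum_comp_morphism[of "lam A" w X] by (simp add: lam_add o_def)

lemma lam_wedge: "lam A (wedge \<mu> \<omega>) = wedge (lam A \<mu>) (lam A \<omega>)"
proof -
  have "lam A (wedge (ext_basis I) (ext_basis J)) = wedge (row_wedge A I) (row_wedge A J)" for I J
    by (simp add: wedge_basis row_wedge_wedge lam_scale)
  then have "lam A (wedge \<mu> \<omega>) =
      (\<Sum>I\<in>UNIV. \<Sum>J\<in>UNIV. scale (\<mu> I * \<omega> J) (wedge (row_wedge A I) (row_wedge A J)))"
    by (simp add: wedge_expand[of \<mu> \<omega>] lam_sum lam_scale)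
  also have "\<dots> = wedge (lam A \<mu>) (lam A \<omega>)"
    unfolding lam_def by (rule wedge_sum_sum[symmetric])
  finally show ?thesis .
qed

definition mat_prod :: "('n \<Rightarrow> 'n \<Rightarrow> 'r) \<Rightarrow> ('n \<Rightarrow> 'n \<Rightarrow> 'r) \<Rightarrow> 'n \<Rightarrow> 'n::finite \<Rightarrow> 'r::comm_ring_1" where
  "mat_prod B A = (\<lambda>i j. \<Sum>k\<in>UNIV. B i k * A k j)"

definition diag :: "('n \<Rightarrow> 'r) \<Rightarrow> 'n \<Rightarrow> 'n \<Rightarrow> 'r::comm_ring_1" where
  "diag d = (\<lambda>i j. if i = j then d i else 0)"

lemma row_wedge_singleton [simp]: "row_wedge A {i} = row_form A i"
  by (simp add: row_wedge_def)

lemma lam_row_form: "lam A (row_form B i) = row_form (mat_prod B A) i"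
proof -
  have "lam A (row_form B i) = (\<Sum>k\<in>UNIV. scale (B i k) (row_form A k))"
    by (simp add: row_form_def[of B] lam_sum lam_scale)
  also have "\<dots> = row_form (mat_prod B A) i"
    unfolding row_form_def mat_prod_def scale_sum_right scale_scale scale_sum_left by (rule sum.swap)
  finally show ?thesis .
qed

lemma lam_row_wedge: "lam A (row_wedge B I) = row_wedge (mat_prod B A) I"
proof (induction I rule: finite_linorder_min_induct[OF finite, case_names empty insert])
  case (insert m I)
  then show ?case by (simp add: row_wedge_min lam_wedge lam_row_form)
qed simp

text \<open>The Cauchy-Binet formula in all degrees at once. The factors come in reverse order,
  because the rows of B are expanded in the rows of A.\<close>

lemma lam_lam: "lam A (lam B \<omega>) = lam (mat_prod B A) \<omega>"
  unfolding lam_def[of B] lam_def[of "mat_prod B A"] lam_sum lam_scale lam_row_wedge ..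

lemma row_wedge_diag: "row_wedge (diag d) I = scale (\<Prod>i\<in>I. d i) (ext_basis I)"
proof (induction I rule: finite_linorder_min_induct[OF finite, case_names empty insert])
  case (insert m I)
  then have m: "m \<notin> I" by auto
  have *: "row_form (diag d) m = scale (d m) (ext_basis {m})"
    by (simp add: row_form_def diag_def fun_eq_iff sum_fun_apply if_distrib[of "\<lambda>x. x * _"] cong: if_cong)
  have "row_wedge (diag d) (insert m I) = wedge (row_form (diag d) m) (row_wedge (diag d) I)"
    using insert by (simp add: row_wedge_min)
  also have "\<dots> = wedge (scale (d m) (ext_basis {m})) (scale (\<Prod>i\<in>I. d i) (ext_basis I))"
    unfolding * by (subst insert.IH) (rule refl)
  also have "\<dots> = scale (\<Prod>i\<in>insert m I. d i) (ext_basis (insert m I))"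
    using insert.hyps m
    by (simp add: wedge_scale_left wedge_scale_right wedge_basis scale_scale inversions_singleton_less mult.commute)
  finally show ?case .
qed simp

lemma lam_diag: "lam (diag d) \<omega> I = (\<Prod>i\<in>I. d i) * \<omega> I"
  by (simp add: lam_def row_wedge_diag sum_fun_apply ext_basis_def mult_delta_right if_distrib mult.commute cong: if_cong)

lemma lam_one [simp]: "lam (diag (\<lambda>_. 1)) \<omega> = \<omega>"
  by (simp add: fun_eq_iff lam_diag)

lemma wedge_card:
  fixes \<mu> \<omega> :: "'n::{finite,linorder} set \<Rightarrow> 'r::comm_ring_1"
  assumes "\<And>I. card I \<noteq> p \<Longrightarrow> \<mu> I = 0" "\<And>I. card I \<noteq> q \<Longrightarrow> \<omega> I = 0" "card K \<noteq> p + q"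
  shows "wedge \<mu> \<omega> K = 0"
  unfolding wedge_inversions
proof (rule sum.neutral, rule ballI)
  fix I assume "I \<in> Pow K"
  then have "card K = card I + card (K - I)"
    by (metis Pow_iff finite card_Diff_subset card_mono le_add_diff_inverse)
  with assms(3) have "card I \<noteq> p \<or> card (K - I) \<noteq> q" by auto
  with assms show "(- 1) ^ inversions I (K - I) * (\<mu> I * \<omega> (K - I)) = 0" by auto
qed

lemma row_wedge_card: "card K \<noteq> card I \<Longrightarrow> row_wedge A I K = 0"
proof (induction I arbitrary: K rule: finite_linorder_min_induct[OF finite, case_names empty insert])
  case empty
  then show ?case by (auto simp: ext_basis_def)
next
  case (insert m I)
  then have "m \<notin> I" by auto
  then have "card K \<noteq> 1 + card I" using insert by simp
  then have "wedge (row_form A m) (row_wedge A I) K = 0"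
    by (rule wedge_card[rotated 2]) (use insert.IH row_form_card in auto)
  with insert show ?case by (simp add: row_wedge_min)
qed

lemma lam_card:
  assumes "\<And>I. card I \<noteq> p \<Longrightarrow> \<omega> I = 0" "card K \<noteq> p"
  shows "lam A \<omega> K = 0"
  unfolding lam_def sum_fun_apply
proof (intro sum.neutral ballI)
  fix I show "scale (\<omega> I) (row_wedge A I) K = 0"
    using assms row_wedge_card[of K I A] by (cases "card I = p") auto
qed

text \<open>The determinant, as the scalar by which \<open>lam A\<close> acts in top degree;
  multiplicativity is then the top case of \<open>lam_lam\<close>. The entries will be complex
  numbers, polynomial functions or univariate polynomials.\<close>

definition ext_det :: "('n::{finite,linorder} \<Rightarrow> 'n \<Rightarrow> 'r) \<Rightarrow> 'r::comm_ring_1" where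
  "ext_det A = row_wedge A UNIV UNIV"

lemma card_ne_top: "I \<noteq> UNIV \<Longrightarrow> card I \<noteq> CARD('n)"
  for I :: "'n::finite set"
  by (metis card_subset_eq finite subset_UNIV)

lemma row_wedge_top: "row_wedge A UNIV = scale (ext_det A) (ext_basis UNIV)"
proof
  fix K show "row_wedge A UNIV K = scale (ext_det A) (ext_basis UNIV) K"
    using row_wedge_card[OF card_ne_top, of K A] by (cases "K = UNIV") (auto simp: ext_det_def ext_basis_def)
qed

lemma lam_top: "lam A (scale f (ext_basis UNIV)) = scale (f * ext_det A) (ext_basis UNIV)"
  by (simp add: lam_scale row_wedge_top scale_scale)

lemma ext_det_mult:
  fixes A B :: "'n::{finite,linorder} \<Rightarrow> 'n \<Rightarrow> 'r::comm_ring_1"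
  shows "ext_det (mat_prod B A) = ext_det B * ext_det A"
proof -
  have "scale (ext_det (mat_prod B A)) (ext_basis UNIV) = scale (ext_det B * ext_det A) (ext_basis UNIV :: 'n set \<Rightarrow> 'r)"
    by (simp flip: row_wedge_top add: lam_row_wedge[symmetric] lam_scale) (simp add: row_wedge_top lam_scale scale_scale)
  from fun_cong[OF this, of UNIV] show ?thesis by (simp add: ext_basis_def)
qed

lemma ext_det_diag: "ext_det (diag d) = (\<Prod>i\<in>UNIV. d i)"
  by (simp add: ext_det_def row_wedge_diag ext_basis_def)

text \<open>Meant for evaluation at a point and for the action of a group element on coefficients,
  both of which preserve sums, products and signs.\<close>

lemma wedge_hom:
  fixes h :: "'r::comm_ring_1 \<Rightarrow> 'k::comm_ring_1"
  assumes "\<And>x y. h (x + y) = h x + h y" "\<And>x y. h (x * y) = h x * h y" "h 0 = 0" "h 1 = 1"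
  shows "h (wedge \<mu> \<omega> K) = wedge (\<lambda>I. h (\<mu> I)) (\<lambda>I. h (\<omega> I)) K"
proof -
  have neg: "h (- x) = - h x" for x
    using assms(1)[of x "- x"] assms(3) by (simp add: eq_neg_iff_add_eq_0 add.commute)
  have pow: "h ((- 1) ^ n * x) = (- 1) ^ n * h x" for n x
    by (induction n) (auto simp: assms neg)
  have sum: "h (\<Sum>x\<in>X. f x) = (\<Sum>x\<in>X. h (f x))" for f :: "'a set \<Rightarrow> 'r" and X
    by (induction X rule: infinite_finite_induct) (auto simp: assms)
  show ?thesis by (simp only: wedge_inversions sum pow) (simp only: assms(2))
qed

lemma row_wedge_hom:
  fixes h :: "'r::comm_ring_1 \<Rightarrow> 'k::comm_ring_1" and A :: "'n::{finite,linorder} \<Rightarrow> 'n \<Rightarrow> 'r"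
  assumes h: "\<And>x y. h (x + y) = h x + h y" "\<And>x y. h (x * y) = h x * h y" "h 0 = 0" "h 1 = 1"
  shows "h (row_wedge A I K) = row_wedge (\<lambda>i j. h (A i j)) I K"
proof (induction I arbitrary: K rule: finite_linorder_min_induct[OF finite, case_names empty insert])
  case (insert m I)
  have sum: "h (\<Sum>x\<in>X. f x) = (\<Sum>x\<in>X. h (f x))" for f :: "'n \<Rightarrow> 'r" and X
    by (induction X rule: infinite_finite_induct) (auto simp: h)
  have "h (row_form A m J) = row_form (\<lambda>i j. h (A i j)) m J" for J
    by (simp add: row_form_apply sum if_distrib h cong: if_cong)
  with insert show ?case by (simp add: row_wedge_min wedge_hom[OF h])
qed (auto simp: ext_basis_def h)

lemma lam_hom:
  fixes h :: "'r::comm_ring_1 \<Rightarrow> 'k::comm_ring_1" and A :: "'n::{finite,linorder} \<Rightarrow> 'n \<Rightarrow> 'r"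
  assumes h: "\<And>x y. h (x + y) = h x + h y" "\<And>x y. h (x * y) = h x * h y" "h 0 = 0" "h 1 = 1"
  shows "h (lam A \<omega> K) = lam (\<lambda>i j. h (A i j)) (\<lambda>I. h (\<omega> I)) K"
proof -
  have sum: "h (\<Sum>x\<in>X. f x) = (\<Sum>x\<in>X. h (f x))" for f :: "'n set \<Rightarrow> 'r" and X
    by (induction X rule: infinite_finite_induct) (auto simp: h)
  show ?thesis by (simp add: lam_def sum_fun_apply sum h row_wedge_hom[OF h])
qed

lemma wedge_eval: "wedge \<mu> \<omega> K v = wedge (\<lambda>I. \<mu> I v) (\<lambda>I. \<omega> I v) K"
  by (rule wedge_hom[where h = "\<lambda>f. f v"]) auto

lemma ext_det_eval: "ext_det A v = ext_det (\<lambda>i j. A i j v)"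
  unfolding ext_det_def by (rule row_wedge_hom[where h = "\<lambda>f. f v"]) auto

lemma ext_det_poly: "poly (ext_det A) t = ext_det (\<lambda>i j. poly (A i j) t)"
  unfolding ext_det_def by (rule row_wedge_hom[where h = "\<lambda>p. poly p t"]) auto

lemma mat_prod_inverse_commute:
  fixes A B :: "'n::finite \<Rightarrow> 'n \<Rightarrow> 'k::field"
  assumes "mat_prod A B = diag (\<lambda>_. 1)"
  shows "mat_prod B A = diag (\<lambda>_. 1)"
proof -
  have *: "((\<chi> i j. X i j) ** (\<chi> i j. Y i j) = (mat 1 :: 'k^'n^'n)) \<longleftrightarrow> mat_prod X Y = diag (\<lambda>_. 1)"
    for X Y :: "'n \<Rightarrow> 'n \<Rightarrow> 'k"
    by (auto simp: vec_eq_iff fun_eq_iff matrix_matrix_mult_def mat_prod_def mat_def diag_def)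
  show ?thesis using assms matrix_left_right_inverse unfolding *[symmetric] by blast
qed

section \<open>Polynomial functions\<close>

lemmas fun_fold = zero_fun_def[symmetric] one_fun_def[symmetric] plus_fun_def[symmetric]
  times_fun_def[symmetric]

lemma polynomials_zero [simp]: "0 \<in> polynomials"
  using polynomials.const[of 0] by (simp add: zero_fun_def)

lemma polynomials_one [simp]: "1 \<in> polynomials"
  using polynomials.const[of 1] by (simp add: one_fun_def)

lemmas polynomials_add = polynomials.add
lemmas polynomials_mult = polynomials.mult

lemma polynomials_uminus: "f \<in> polynomials \<Longrightarrow> - f \<in> polynomials"
  using polynomials.mult[OF polynomials.const[of "-1"]] by (fastforce simp: times_fun_def fun_Compl_def)

lemma polynomials_diff: "f \<in> polynomials \<Longrightarrow> g \<in> polynomials \<Longrightarrow> f - g \<in> polynomials"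
  using polynomials.add[OF _ polynomials_uminus, of f g] by simp

lemma polynomials_sum: "(\<And>x. x \<in> A \<Longrightarrow> f x \<in> polynomials) \<Longrightarrow> (\<Sum>x\<in>A. f x) \<in> polynomials"
  by (induction A rule: infinite_finite_induct) (auto intro: polynomials_add)

lemma polynomials_prod: "(\<And>x. x \<in> A \<Longrightarrow> f x \<in> polynomials) \<Longrightarrow> (\<Prod>x\<in>A. f x) \<in> polynomials"
  by (induction A rule: infinite_finite_induct) (auto intro: polynomials_mult)

lemma polynomials_power: "f \<in> polynomials \<Longrightarrow> f ^ k \<in> polynomials"
  by (induction k) (auto intro: polynomials_mult)

lemmas polynomials_intros = polynomials.const polynomials.coord polynomials_add polynomials_mult polynomials_uminus polynomials_diff
  polynomials_sum polynomials_prod polynomials_power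

lemma prod_fun_apply: "(\<Prod>x\<in>A. f x) y = (\<Prod>x\<in>A. f x y)"
  by (induction A rule: infinite_finite_induct) auto

lemma power_fun_apply: "(f ^ k) y = f y ^ k"
  by (induction k) auto

lemma polynomials_compose:
  assumes "f \<in> polynomials" "\<And>i. (\<lambda>v. p v $ i) \<in> polynomials"
  shows "(\<lambda>v. f (p v)) \<in> polynomials"
  using assms(1)
proof induction
  case (add f g)
  from polynomials_add[OF add.IH] show ?case by (simp add: plus_fun_def)
next
  case (mult f g)
  from polynomials_mult[OF mult.IH] show ?case by (simp add: times_fun_def)
qed (auto intro: polynomials.const assms)

lemma poly_line_exists:
  assumes "f \<in> polynomials"
  shows "\<exists>q. \<forall>t. poly q t = f (v + t *s w)"
  using assms
proof induction
  case (const c)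
  show ?case by (intro exI[of _ "[:c:]"]) simp
next
  case (coord i)
  show ?case by (intro exI[of _ "[:v $ i, w $ i:]"]) simp
next
  case (add f g)
  then obtain p q where "\<forall>t. poly p t = f (v + t *s w)" "\<forall>t. poly q t = g (v + t *s w)" by auto
  then show ?case by (intro exI[of _ "p + q"]) simp
next
  case (mult f g)
  then obtain p q where "\<forall>t. poly p t = f (v + t *s w)" "\<forall>t. poly q t = g (v + t *s w)" by auto
  then show ?case by (intro exI[of _ "p * q"]) simp
qed

text \<open>The restriction to the line through v with direction w as a polynomial in one variable,
  not only as a function, so that factors and orders of vanishing can be read off. For w = 0 it is a
  constant polynomial.\<close>

definition pline :: "('n::finite cvec \<Rightarrow> complex) \<Rightarrow> 'n cvec \<Rightarrow> 'n cvec \<Rightarrow> complex poly" where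
  "pline f v w = (THE q. \<forall>t. poly q t = f (v + t *s w))"

lemma complex_poly_eqI: "(\<And>t. poly p t = poly q t) \<Longrightarrow> p = (q :: complex poly)"
  using poly_eq_poly_eq_iff[of p q] by (simp add: fun_eq_iff)

lemma pline_unique:
  assumes "\<And>t. poly q t = f (v + t *s w)"
  shows "pline f v w = q"
  unfolding pline_def by (rule the_equality) (use assms in \<open>auto intro: complex_poly_eqI\<close>)

lemma poly_pline [simp]:
  assumes "f \<in> polynomials"
  shows "poly (pline f v w) t = f (v + t *s w)"
proof -
  obtain q where "\<forall>t. poly q t = f (v + t *s w)" using poly_line_exists[OF assms] by blast
  then show ?thesis using pline_unique[of q f v w] by simp
qed

lemma pline_mult:
  "f \<in> polynomials \<Longrightarrow> g \<in> polynomials \<Longrightarrow> pline (f * g) v w = pline f v w * pline g v w"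
  by (rule pline_unique) simp

lemma pline_add:
  "f \<in> polynomials \<Longrightarrow> g \<in> polynomials \<Longrightarrow> pline (f + g) v w = pline f v w + pline g v w"
  by (rule pline_unique) simp

lemma pline_const: "pline (\<lambda>v. c) v w = [:c:]"
  by (rule pline_unique) simp

text \<open>On the line joining a point with f \<noteq> 0 to a point with g \<noteq> 0 both
  restrictions are nonzero, and univariate polynomials form a domain.\<close>

lemma poly_domain:
  assumes f: "f \<in> polynomials" and g: "g \<in> polynomials" and "f * g = 0"
  shows "f = 0 \<or> g = 0"
proof (rule ccontr)
  assume "\<not> ?thesis"
  then obtain v w where vw: "f v \<noteq> 0" "g w \<noteq> 0" by (auto simp: fun_eq_iff)
  have "pline f v (w - v) * pline g v (w - v) = 0"
    using assms pline_mult[OF f g, of v "w - v"] pline_const[of 0 v "w - v"] by (simp add: zero_fun_def)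
  then have "pline f v (w - v) = 0 \<or> pline g v (w - v) = 0" by simp
  moreover have "poly (pline f v (w - v)) 0 = f v" "poly (pline g v (w - v)) 1 = g w"
    using f g by simp_all
  ultimately show False using vw by auto
qed

lemma poly_cancel_left:
  assumes "a \<in> polynomials" "f \<in> polynomials" "g \<in> polynomials" "a \<noteq> 0" "a * f = a * g"
  shows "f = g"
  using poly_domain[OF assms(1) polynomials_diff[OF assms(2,3)]] assms(4,5) by (simp add: right_diff_distrib)

lemma poly_prod_nonzero:
  assumes "finite A" "\<And>x. x \<in> A \<Longrightarrow> f x \<in> polynomials \<and> f x \<noteq> 0"
  shows "(\<Prod>x\<in>A. f x) \<noteq> 0"
  using assms
proof (induction A rule: finite_induct)
  case (insert x A)
  have "(\<Prod>x\<in>A. f x) \<noteq> 0" by (rule insert.IH) (use insert.prems in auto)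
  moreover have "f x \<noteq> 0" "f x \<in> polynomials" "(\<Prod>x\<in>A. f x) \<in> polynomials"
    using insert.prems by (auto intro: polynomials_prod simp: fun_fold)
  ultimately have "f x * (\<Prod>x\<in>A. f x) \<noteq> 0" using poly_domain by blast
  then have "(\<Prod>x\<in>insert x A. f x) \<noteq> 0" using insert.hyps by simp
  then show ?case .
qed simp

lemma common_nonzero:
  assumes "finite A" "\<And>f. f \<in> A \<Longrightarrow> f \<in> polynomials \<and> f \<noteq> 0"
  obtains v where "\<And>f. f \<in> A \<Longrightarrow> f v \<noteq> 0"
proof -
  have "(\<Prod>f\<in>A. f) \<noteq> 0" using poly_prod_nonzero[of A "\<lambda>f. f"] assms by simp
  then obtain v where "(\<Prod>f\<in>A. f) v \<noteq> 0" by (auto simp: fun_eq_iff)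
  then have "(\<Prod>f\<in>A. f v) \<noteq> 0" by (simp add: prod_fun_apply)
  then show ?thesis using assms(1) by (intro that) auto
qed

lemma poly_power_nonzero:
  assumes "f \<in> polynomials" "f \<noteq> 0"
  shows "f ^ k \<noteq> 0"
proof -
  obtain v where "f v \<noteq> 0" using assms by (auto simp: fun_eq_iff)
  then have "(f ^ k) v \<noteq> 0 v" by (simp add: power_fun_apply)
  then show ?thesis by metis
qed

text \<open>A polynomial taking two values is nonconstant on some line, and hence on most lines.\<close>

lemma poly_avoiding_zero:
  assumes r: "r \<in> polynomials" and nc: "\<And>c. r \<noteq> (\<lambda>v. c)"
    and L: "finite L" "\<And>f g. (f, g) \<in> L \<Longrightarrow> f \<in> polynomials \<and> f \<noteq> 0 \<and>
       (\<forall>w. f w \<noteq> 0 \<longrightarrow> (\<lambda>v. f v * g w - g v * f w) \<in> polynomials \<and> (\<lambda>v. f v * g w - g v * f w) \<noteq> 0)"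
  obtains v0 w where "\<And>c. \<not> (\<forall>t. r (v0 + t *s w) = c)"
    "\<And>f g. (f, g) \<in> L \<Longrightarrow> f v0 * g w - g v0 * f w \<noteq> 0"
proof -
  obtain v2 where v2: "r v2 \<noteq> r 0" using nc[of "r 0"] by (auto simp: fun_eq_iff)
  \<comment> \<open>The direction is chosen before the base point. Besides being separated from 0 by
    r, it must not be a zero of any first member f of a pair: only then is
    \<open>f v * g w - g v * f w\<close> a nonzero polynomial in v.\<close>
  define A where "A = insert (\<lambda>w. r w - r 0) (fst ` L)"
  have r0: "(\<lambda>w. r w - r 0) \<in> polynomials"
    using polynomials_diff[OF r polynomials.const[of "r 0"]] by (simp add: fun_diff_def)
  have "(\<lambda>w. r w - r 0) v2 \<noteq> 0 v2" using v2 by simp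
  then have "(\<lambda>w. r w - r 0) \<noteq> 0" by metis
  with r0 have Ap: "f \<in> polynomials \<and> f \<noteq> 0" if "f \<in> A" for f
    using that L(2) by (auto simp: A_def)
  have "finite A" using L(1) by (simp add: A_def)
  then obtain w where w: "\<And>f. f \<in> A \<Longrightarrow> f w \<noteq> 0"
    by (rule common_nonzero[OF _ Ap]) blast+
  \<comment> \<open>For linear f and g, a common zero on the line through v with direction w would
    make \<open>f v * g w - g v * f w\<close> vanish. The first member of B makes r take two values
    on the line.\<close>
  define B where "B = insert (\<lambda>v. r (v + w) - r v) ((\<lambda>(f, g) v. f v * g w - g v * f w) ` L)"
  have "(\<lambda>v. r (v + w)) \<in> polynomials"
    using polynomials_add[OF polynomials.coord polynomials.const] by (intro polynomials_compose[OF r]) (simp add: plus_fun_def)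
  then have 1: "(\<lambda>v. r (v + w) - r v) \<in> polynomials"
    using polynomials_diff[OF _ r] by (fastforce simp: fun_diff_def)
  have "(\<lambda>v. r (v + w) - r v) 0 \<noteq> 0 0" using w[of "\<lambda>w. r w - r 0"] by (simp add: A_def)
  then have 2: "(\<lambda>v. r (v + w) - r v) \<noteq> 0" by metis
  have 3: "f w \<noteq> 0" if "(f, g) \<in> L" for f g
    using w[of f] that by (force simp: A_def)
  have Bp: "f \<in> polynomials \<and> f \<noteq> 0" if "f \<in> B" for f
    using that 1 2 L(2) 3 by (auto simp: B_def)
  have "finite B" using L(1) by (simp add: B_def)
  then obtain v where v: "\<And>f. f \<in> B \<Longrightarrow> f v \<noteq> 0"
    by (rule common_nonzero[OF _ Bp]) blast+
  show ?thesis
  proof (rule that[of v w])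
    fix c
    have "r (v + w) \<noteq> r v" using v[of "\<lambda>v. r (v + w) - r v"] by (simp add: B_def)
    then have "r (v + 1 *s w) \<noteq> r (v + 0 *s w)" by simp
    then show "\<not> (\<forall>t. r (v + t *s w) = c)" by metis
  next
    fix f g assume "(f, g) \<in> L"
    then have "(\<lambda>v. f v * g w - g v * f w) \<in> B" by (force simp: B_def)
    from v[OF this] show "f v * g w - g v * f w \<noteq> 0" .
  qed
qed

section \<open>Homogeneous components\<close>

definition homogeneous :: "nat \<Rightarrow> ('n::finite cvec \<Rightarrow> complex) \<Rightarrow> bool" where
  "homogeneous d f \<longleftrightarrow> f \<in> polynomials \<and> (\<forall>t v. f (t *s v) = t ^ d * f v)"

text \<open>The coefficient of t^k in f(t v). Components are thus defined without monomials, and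
  their rules for sums and products are those of coefficients.\<close>

definition hcomp :: "nat \<Rightarrow> ('n::finite cvec \<Rightarrow> complex) \<Rightarrow> 'n cvec \<Rightarrow> complex" where
  "hcomp k f = (\<lambda>v. poly.coeff (pline f 0 v) k)"

lemma hcomp_add:
  "f \<in> polynomials \<Longrightarrow> g \<in> polynomials \<Longrightarrow> hcomp k (f + g) = hcomp k f + hcomp k g"
  by (simp add: hcomp_def pline_add fun_eq_iff)

lemma hcomp_mult:
  "f \<in> polynomials \<Longrightarrow> g \<in> polynomials \<Longrightarrow>
    hcomp k (f * g) = (\<Sum>i\<le>k. hcomp i f * hcomp (k - i) g)"
  by (simp add: hcomp_def pline_mult coeff_mult fun_eq_iff sum_fun_apply)

lemma hcomp_of_homogeneous:
  assumes "homogeneous d f"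
  shows "hcomp k f = (if k = d then f else 0)"
proof
  fix v
  have "pline f 0 v = Polynomial.monom (f v) d"
    by (rule pline_unique) (use assms in \<open>simp add: homogeneous_def poly_monom\<close>)
  then show "hcomp k f v = (if k = d then f else 0) v" by (simp add: hcomp_def)
qed

lemma homogeneous_const: "homogeneous 0 (\<lambda>v. c)"
  by (simp add: homogeneous_def polynomials.const)

lemma homogeneous_zero [simp]: "homogeneous d 0"
  by (simp add: homogeneous_def)

lemma hcomp_zero [simp]: "hcomp k 0 = 0"
  using hcomp_of_homogeneous[OF homogeneous_zero[of k], of k] by simp

lemma homogeneous_coord: "homogeneous 1 (\<lambda>v. v $ i)"
  by (simp add: homogeneous_def polynomials.coord)

lemma homogeneous_add: "homogeneous d f \<Longrightarrow> homogeneous d g \<Longrightarrow> homogeneous d (f + g)"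
  by (simp add: homogeneous_def polynomials_add distrib_left)

lemma homogeneous_sum: "(\<And>x. x \<in> A \<Longrightarrow> homogeneous d (f x)) \<Longrightarrow> homogeneous d (\<Sum>x\<in>A. f x)"
  by (induction A rule: infinite_finite_induct) (auto intro: homogeneous_add)

lemma homogeneous_mult: "homogeneous d f \<Longrightarrow> homogeneous e g \<Longrightarrow> homogeneous (d + e) (f * g)"
  by (simp add: homogeneous_def polynomials_mult power_add)

lemma homogeneous_poly: "homogeneous d f \<Longrightarrow> f \<in> polynomials"
  by (simp add: homogeneous_def)

lemma homogeneous_hcomp: "f \<in> polynomials \<Longrightarrow> homogeneous k (hcomp k f)"
proof (induction arbitrary: k rule: polynomials.induct)
  case (const c)
  show ?case using homogeneous_const[of c] by (auto simp: hcomp_of_homogeneous[OF homogeneous_const])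
next
  case (coord i)
  show ?case using homogeneous_coord[of i] by (auto simp add: hcomp_of_homogeneous[OF homogeneous_coord])
next
  case (add f g)
  then have "homogeneous k (hcomp k (f + g))" by (simp add: hcomp_add homogeneous_add)
  then show ?case .
next
  case (mult f g)
  have "homogeneous k (hcomp i f * hcomp (k - i) g)" if "i \<le> k" for i
    using homogeneous_mult[OF mult.IH(1)[of i] mult.IH(2)[of "k - i"]] that by simp
  then have "homogeneous k (\<Sum>i\<le>k. hcomp i f * hcomp (k - i) g)" by (intro homogeneous_sum) simp
  then have "homogeneous k (hcomp k (f * g))" by (simp add: hcomp_mult mult.hyps)
  then show ?case .
qed

lemma poly_hcomp: "f \<in> polynomials \<Longrightarrow> hcomp k f \<in> polynomials"
  using homogeneous_hcomp homogeneous_poly by blast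

lemma hcomp_bound:
  assumes "f \<in> polynomials"
  shows "\<exists>N. \<forall>k>N. hcomp k f = 0"
  using assms
proof induction
  case (const c)
  show ?case by (intro exI[of _ 0]) (simp add: hcomp_of_homogeneous[OF homogeneous_const])
next
  case (coord i)
  show ?case by (intro exI[of _ 1]) (simp add: hcomp_of_homogeneous[OF homogeneous_coord])
next
  case (add f g)
  then obtain M N where "\<forall>k>M. hcomp k f = 0" "\<forall>k>N. hcomp k g = 0" by blast
  then have "\<forall>k>max M N. hcomp k (f + g) = 0" using add.hyps by (simp add: hcomp_add)
  then show ?case by blast
next
  case (mult f g)
  then obtain M N where MN: "\<forall>k>M. hcomp k f = 0" "\<forall>k>N. hcomp k g = 0" by blast
  have "hcomp i f * hcomp (k - i) g = 0" if "k > M + N" for k i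
    using MN that by (cases "i > M") auto
  then have "\<forall>k>M + N. hcomp k (f * g) = 0" using mult.hyps by (simp add: hcomp_mult)
  then show ?case by blast
qed

lemma hcomp_sum_bound:
  assumes "f \<in> polynomials" "\<forall>k>N. hcomp k f = 0"
  shows "f = (\<Sum>k\<le>N. hcomp k f)"
proof
  fix v
  have "degree (pline f 0 v) \<le> N"
    using assms(2) by (intro degree_le) (auto simp: hcomp_def fun_eq_iff)
  then have "poly (\<Sum>k\<le>N. Polynomial.monom (poly.coeff (pline f 0 v) k) k) 1 = poly (pline f 0 v) 1"
    by (simp only: poly_as_sum_of_monoms')
  then have "poly (pline f 0 v) 1 = (\<Sum>k\<le>N. poly.coeff (pline f 0 v) k)"
    by (simp add: poly_sum poly_monom)
  then show "f v = (\<Sum>k\<le>N. hcomp k f) v"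
    using assms(1) by (simp add: sum_fun_apply hcomp_def)
qed

lemma hcomp_sum:
  assumes "\<And>x. x \<in> A \<Longrightarrow> f x \<in> polynomials"
  shows "hcomp k (\<Sum>x\<in>A. f x) = (\<Sum>x\<in>A. hcomp k (f x))"
  using assms by (induction A rule: infinite_finite_induct) (auto simp: hcomp_add polynomials_sum)

lemma hcomp_eqI:
  assumes "f \<in> polynomials" "g \<in> polynomials" "\<And>k. hcomp k f = hcomp k g"
  shows "f = g"
proof
  fix v
  have "pline f 0 v = pline g 0 v"
    using assms(3) by (intro poly_eqI) (simp add: hcomp_def fun_eq_iff)
  then have "poly (pline f 0 v) 1 = poly (pline g 0 v) 1" by simp
  then show "f v = g v" using assms by simp
qed

lemma hcomp_mult_homogeneous:
  assumes "homogeneous d a" "f \<in> polynomials"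
  shows "hcomp k (a * f) = (if k < d then 0 else a * hcomp (k - d) f)"
proof -
  have "hcomp k (a * f) = (\<Sum>i\<le>k. if i = d then a * hcomp (k - d) f else 0)"
    unfolding hcomp_mult[OF homogeneous_poly[OF assms(1)] assms(2)] hcomp_of_homogeneous[OF assms(1)]
    by (rule sum.cong) auto
  then show ?thesis by (simp add: sum.delta)
qed

lemma hcomp_0: "f \<in> polynomials \<Longrightarrow> hcomp 0 f = (\<lambda>v. f 0)"
  using poly_0_coeff_0[of "pline f 0 v" for v] by (simp add: hcomp_def fun_eq_iff flip: poly_0_coeff_0)

section \<open>Linear dependence over an integral domain of functions\<close>

text \<open>Gaussian elimination without division. A pivot vector m with
  \<open>u m j \<noteq> 0\<close> clears coordinate j of the others by cross multiplication; a
  dependence among the cleared vectors, multiplied back by the pivot entry, stays nontrivial in a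
  domain.\<close>

lemma poly_vectors_dependent:
  fixes u :: "'i \<Rightarrow> 'j \<Rightarrow> 'n::finite cvec \<Rightarrow> complex"
  assumes "finite J" "finite I" "card I > card J" "\<And>i j. u i j \<in> polynomials"
  shows "\<exists>c. (\<forall>i. c i \<in> polynomials) \<and> (\<exists>i\<in>I. c i \<noteq> 0) \<and> (\<forall>j\<in>J. (\<Sum>i\<in>I. c i * u i j) = 0)"
  using assms
proof (induction J arbitrary: I u rule: finite_induct)
  case empty
  then have "I \<noteq> {}" by auto
  then obtain i where "i \<in> I" by auto
  moreover have "(1 :: 'n cvec \<Rightarrow> complex) \<noteq> 0" by simp
  ultimately show ?case by (intro exI[of _ "\<lambda>_. 1"] conjI allI polynomials_one bexI[of _ i]) blast+
next
  case (insert j J)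
  show ?case
  proof (cases "\<forall>i\<in>I. u i j = 0")
    case True
    have "card J < card I" using insert.prems(2) insert.hyps by simp
    from insert.IH[where u = u, OF insert.prems(1) this insert.prems(3)]
    obtain c where "\<forall>i. c i \<in> polynomials" "\<exists>i\<in>I. c i \<noteq> 0" "\<forall>j\<in>J. (\<Sum>i\<in>I. c i * u i j) = 0"
      by blast
    moreover from this(3) True have "\<forall>k\<in>insert j J. (\<Sum>i\<in>I. c i * u i k) = 0" by simp
    ultimately show ?thesis by blast
  next
    case False
    then obtain m where m: "m \<in> I" "u m j \<noteq> 0" by auto
    define u' where "u' i k = u m j * u i k - u i j * u m k" for i k
    have "finite (I - {m})" "card J < card (I - {m})" using insert.prems(1,2) insert.hyps m by auto
    moreover have "u' i k \<in> polynomials" for i k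
      unfolding u'_def by (intro polynomials_intros insert.prems(3))
    ultimately have "\<exists>c. (\<forall>i. c i \<in> polynomials) \<and> (\<exists>i\<in>I - {m}. c i \<noteq> 0) \<and>
        (\<forall>k\<in>J. (\<Sum>i\<in>I - {m}. c i * u' i k) = 0)"
      by (rule insert.IH)
    then obtain c where c: "\<And>i. c i \<in> polynomials" "\<exists>i\<in>I - {m}. c i \<noteq> 0"
       "\<And>k. k \<in> J \<Longrightarrow> (\<Sum>i\<in>I - {m}. c i * u' i k) = 0" by blast
    define c' where "c' i = (if i = m then - (\<Sum>i\<in>I - {m}. c i * u i j) else c i * u m j)" for i
    have sum: "(\<Sum>i\<in>I. c' i * u i k) = (\<Sum>i\<in>I - {m}. c i * u' i k)" for k
    proof -
      have "(\<Sum>i\<in>I. c' i * u i k) = c' m * u m k + (\<Sum>i\<in>I - {m}. c' i * u i k)"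
        using insert.prems m by (intro sum.remove) auto
      also have "(\<Sum>i\<in>I - {m}. c' i * u i k) = (\<Sum>i\<in>I - {m}. c i * u m j * u i k)"
        by (rule sum.cong) (auto simp: c'_def)
      finally have 1: "(\<Sum>i\<in>I. c' i * u i k) = c' m * u m k + (\<Sum>i\<in>I - {m}. c i * u m j * u i k)" .
      have 2: "(\<Sum>i\<in>I - {m}. c i * u' i k) =
          (\<Sum>i\<in>I - {m}. c i * u m j * u i k) - (\<Sum>i\<in>I - {m}. c i * u i j) * u m k"
        by (simp only: u'_def right_diff_distrib sum_subtractf sum_distrib_right mult.assoc)
      have 3: "c' m = - (\<Sum>i\<in>I - {m}. c i * u i j)" by (simp add: c'_def)
      show ?thesis unfolding 1 2 3 by simp
    qed
    have "\<forall>k\<in>insert j J. (\<Sum>i\<in>I. c' i * u i k) = 0"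
      unfolding sum using c(3) by (auto simp: u'_def mult.commute)
    moreover have "\<forall>i. c' i \<in> polynomials"
      using c(1) insert.prems by (auto simp: c'_def intro!: polynomials_intros)
    moreover from c(2) obtain i where i: "i \<in> I" "i \<noteq> m" "c i \<noteq> 0" by auto
    then have "c' i \<noteq> 0" using poly_domain[OF c(1) insert.prems(3), of i m j] m by (auto simp: c'_def)
    ultimately show ?thesis using i by blast
  qed
qed

text \<open>With S the rest of the orbit of v, it lets an average over the group see only the
  elements that fix v.\<close>

lemma separating_polynomial:
  assumes "finite S" "v \<notin> S"
  obtains h where "h \<in> polynomials" "h v = 1" "\<And>w. w \<in> S \<Longrightarrow> h w = 0"
proof -
  have "\<exists>h\<in>polynomials. h v = 1 \<and> h w = 0" if "w \<in> S" for w
  proof -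
    from that assms have "w \<noteq> v" by auto
    then obtain i where i: "w $ i \<noteq> v $ i" by (auto simp: vec_eq_iff)
    let ?h = "(\<lambda>x. 1 / (v $ i - w $ i)) * ((\<lambda>x. x $ i) - (\<lambda>x. w $ i))"
    have "?h \<in> polynomials" by (intro polynomials_intros)
    moreover have "?h v = 1 \<and> ?h w = 0" using i by simp
    ultimately show ?thesis by blast
  qed
  then obtain h where h: "\<And>w. w \<in> S \<Longrightarrow> h w \<in> polynomials \<and> h w v = 1 \<and> h w w = 0" by metis
  show ?thesis
  proof (rule that[of "\<Prod>w\<in>S. h w"])
    show "(\<Prod>w\<in>S. h w) \<in> polynomials" using h by (intro polynomials_prod) auto
    show "(\<Prod>w\<in>S. h w) v = 1" using h by (simp add: prod_fun_apply)
    show "(\<Prod>w\<in>S. h w) w = 0" if "w \<in> S" for w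
      using h[OF that] that assms(1) by (auto simp: prod_fun_apply intro!: prod_zero)
  qed
qed

section \<open>Linear forms\<close>

abbreviation linear_form :: "('n::finite cvec \<Rightarrow> complex) \<Rightarrow> bool" where
  "linear_form \<equiv> Vector_Spaces.linear (*s) (*)"

lemma linear_form_add: "linear_form f \<Longrightarrow> f (v + w) = f v + f w"
  and linear_form_scale: "linear_form f \<Longrightarrow> f (c *s v) = c * f v"
  by (simp_all add: Vector_Spaces.linear_iff)

lemma linear_form_zero: "linear_form f \<Longrightarrow> f 0 = 0"
  using linear_form_scale[of f 0 0] by simp

lemma linear_form_diff: "linear_form f \<Longrightarrow> f (v - w) = f v - f w"
  using linear_form_add[of f "v - w" w] by simp

lemma linear_form_sum: "linear_form f \<Longrightarrow> f (\<Sum>x\<in>A. g x) = (\<Sum>x\<in>A. f (g x))"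
  by (induction A rule: infinite_finite_induct) (auto simp: linear_form_add linear_form_zero)

lemma linear_formI:
  assumes "\<And>v w. f (v + w) = f v + f w" "\<And>c v. f (c *s v) = c * f v"
  shows "linear_form f"
  unfolding Vector_Spaces.linear_iff
  using assms vec.vector_space_axioms vector_space_over_itself.vector_space_axioms by auto

lemma linear_form_expand:
  assumes "linear_form f"
  shows "f v = (\<Sum>j\<in>UNIV. f (axis j 1) * v $ j)"
proof -
  have "v = (\<Sum>j\<in>UNIV. v $ j *s axis j 1)" by (simp add: basis_expansion)
  then have "f v = f (\<Sum>j\<in>UNIV. v $ j *s axis j 1)" by simp
  then show ?thesis
    unfolding linear_form_sum[OF assms] by (simp add: linear_form_scale[OF assms] mult.commute)
qed

lemma polynomials_linear_form:
  assumes "linear_form f" shows "f \<in> polynomials"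
proof -
  have "f = (\<Sum>j\<in>UNIV. (\<lambda>v. f (axis j 1)) * (\<lambda>v. v $ j))"
    by (rule ext) (simp only: sum_fun_apply times_fun_apply, rule linear_form_expand[OF assms])
  moreover have "\<dots> \<in> polynomials" by (intro polynomials_intros)
  ultimately show ?thesis by metis
qed

lemma homogeneous_linear_form: "linear_form f \<Longrightarrow> homogeneous 1 f"
  by (simp add: homogeneous_def polynomials_linear_form linear_form_scale)

lemma linear_form_matrix: "linear_form f \<Longrightarrow> linear_form (\<lambda>v. f (A *v v))"
  by (rule linear_formI)
    (simp_all add: matrix_vector_right_distrib linear_form_add linear_form_scale vector_scalar_commute)

lemma linear_form_row: "linear_form (\<lambda>v. (A *v v) $ i)"
  by (rule linear_formI) (simp_all add: matrix_vector_right_distrib vector_scalar_commute)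

lemma polynomials_matrix: "f \<in> polynomials \<Longrightarrow> (\<lambda>v. f (A *v v)) \<in> polynomials"
  by (rule polynomials_compose) (auto intro: polynomials_linear_form linear_form_row)

lemma linear_form_proportional:
  assumes "linear_form f" "linear_form g" "f \<noteq> 0" "\<And>v. f v = 0 \<Longrightarrow> g v = 0"
  shows "\<exists>c. \<forall>v. g v = c * f v"
proof -
  obtain e where e: "f e \<noteq> 0" using assms(3) by (auto simp: fun_eq_iff)
  have "g v = g e / f e * f v" for v
  proof -
    have "f (v - (f v / f e) *s e) = 0"
      using e by (simp add: linear_form_diff linear_form_scale assms)
    from assms(4)[OF this] show ?thesis
      by (simp add: linear_form_diff linear_form_scale assms)
  qed
  then show ?thesis by blast
qed

lemma hyperplane_kernel:
  fixes f :: "'n::finite cvec \<Rightarrow> complex"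
  assumes f: "linear_form f" "f \<noteq> 0"
  shows "hyperplane {v. f v = 0}"
proof -
  let ?H = "{v. f v = 0}"
  have sub: "vec.subspace ?H"
    by (rule vec.subspaceI) (simp_all add: linear_form_add linear_form_scale linear_form_zero f)
  obtain e where e: "f e \<noteq> 0" using f(2) by (auto simp: fun_eq_iff)
  have "v \<in> vec.span (insert e ?H)" for v
  proof -
    have "f (v - (f v / f e) *s e) = 0"
      using e by (simp add: linear_form_diff linear_form_scale f)
    then have "v - (f v / f e) *s e \<in> vec.span ?H" by (intro vec.span_base) simp
    then show ?thesis unfolding vec.span_insert by blast
  qed
  then have "vec.span (insert e ?H) = UNIV" by blast
  then have "vec.dim (insert e ?H) = CARD('n)"
    by (metis vec.dim_span vec.dim_UNIV vec_dim_card)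
  moreover have span: "vec.span ?H = ?H" using sub by (simp only: vec.span_eq_iff)
  have "e \<notin> vec.span ?H" unfolding span using e by simp
  ultimately show ?thesis unfolding hyperplane_def using sub vec.dim_insert[of e ?H] by simp
qed

text \<open>Let \<pi> be the projection to the kernel of \<alpha> along e. By induction over the
  construction of f, \<open>f v - f (\<pi> v)\<close> is divisible by \<alpha>, the case of products
  being a Leibniz rule; and f vanishes at every \<open>\<pi> v\<close>.\<close>

lemma vanishing_divisible:
  fixes f \<alpha> :: "'n::finite cvec \<Rightarrow> complex"
  assumes \<alpha>: "linear_form \<alpha>" "\<alpha> \<noteq> 0" and f: "f \<in> polynomials" and van: "\<And>v. \<alpha> v = 0 \<Longrightarrow> f v = 0"
  obtains h where "h \<in> polynomials" "f = \<alpha> * h"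
proof -
  obtain e where e: "\<alpha> e \<noteq> 0" using \<alpha>(2) by (auto simp: fun_eq_iff)
  define \<pi> where "\<pi> v = v - (\<alpha> v / \<alpha> e) *s e" for v
  have \<pi>: "\<alpha> (\<pi> v) = 0" for v
    using e by (simp add: \<pi>_def linear_form_diff linear_form_scale \<alpha>)
  have pol: "\<alpha> \<in> polynomials" by (rule polynomials_linear_form[OF \<alpha>(1)])
  have \<pi>pol: "(\<lambda>v. g (\<pi> v)) \<in> polynomials" if "g \<in> polynomials" for g
  proof (rule polynomials_compose[OF that])
    fix i
    have "(\<lambda>v. v $ i) - (\<lambda>v. e $ i / \<alpha> e) * \<alpha> \<in> polynomials"
      using pol by (intro polynomials_intros)
    then show "(\<lambda>v. \<pi> v $ i) \<in> polynomials"
      by (simp add: \<pi>_def fun_diff_def times_fun_def mult.commute)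
  qed
  have "\<exists>h\<in>polynomials. \<forall>v. f v - f (\<pi> v) = \<alpha> v * h v"
    using f
  proof induction
    case (const c)
    show ?case by (intro bexI[of _ 0]) auto
  next
    case (coord i)
    show ?case by (intro bexI[of _ "\<lambda>v. e $ i / \<alpha> e"]) (auto simp: \<pi>_def intro: polynomials.const)
  next
    case (add f g)
    then obtain h k where hk: "h \<in> polynomials" "k \<in> polynomials"
      "\<And>v. f v - f (\<pi> v) = \<alpha> v * h v" "\<And>v. g v - g (\<pi> v) = \<alpha> v * k v" by blast
    have "(f + g) v - (f + g) (\<pi> v) = \<alpha> v * (h + k) v" for v
      using hk(3,4)[of v] by (simp add: algebra_simps)
    with hk(1,2) show ?case using polynomials_add by blast
  next
    case (mult f g)
    then obtain h k where hk: "h \<in> polynomials" "k \<in> polynomials"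
      "\<And>v. f v - f (\<pi> v) = \<alpha> v * h v" "\<And>v. g v - g (\<pi> v) = \<alpha> v * k v" by blast
    have "(f * g) v - (f * g) (\<pi> v) = \<alpha> v * (h * g + (\<lambda>v. f (\<pi> v)) * k) v" for v
    proof -
      have "f v * g v - f (\<pi> v) * g (\<pi> v) = (f v - f (\<pi> v)) * g v + f (\<pi> v) * (g v - g (\<pi> v))"
        by (simp add: algebra_simps)
      then show ?thesis using hk(3,4)[of v] by (simp add: algebra_simps)
    qed
    moreover have "h * g + (\<lambda>v. f (\<pi> v)) * k \<in> polynomials"
      using hk(1,2) mult.hyps by (intro polynomials_intros \<pi>pol)
    ultimately show ?case by blast
  qed
  then obtain h where h: "h \<in> polynomials" "\<And>v. f v - f (\<pi> v) = \<alpha> v * h v" by blast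
  have "f v = \<alpha> v * h v" for v using h(2)[of v] van[OF \<pi>, of v] by simp
  with h(1) show ?thesis by (intro that[of h]) (auto simp: fun_eq_iff)
qed

text \<open>The coordinate ring of a hyperplane is a domain.\<close>

lemma nonvanishing_mult:
  fixes f g \<alpha> :: "'n::finite cvec \<Rightarrow> complex"
  assumes \<alpha>: "linear_form \<alpha>" and fg: "f \<in> polynomials" "g \<in> polynomials"
    "\<alpha> v = 0" "f v \<noteq> 0" "\<alpha> w = 0" "g w \<noteq> 0"
  shows "\<exists>x. \<alpha> x = 0 \<and> f x * g x \<noteq> 0"
proof -
  have "poly (pline f v (w - v)) 0 = f v" "poly (pline g v (w - v)) 1 = g w"
    using fg by simp_all
  then have "pline f v (w - v) \<noteq> 0" "pline g v (w - v) \<noteq> 0"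
    using fg(4,6) by (metis poly_0)+
  then have "pline f v (w - v) * pline g v (w - v) \<noteq> 0" by simp
  then obtain t where "poly (pline f v (w - v) * pline g v (w - v)) t \<noteq> 0"
    by (metis poly_all_0_iff_0)
  then have "f (v + t *s (w - v)) * g (v + t *s (w - v)) \<noteq> 0" using fg by simp
  moreover have "\<alpha> (v + t *s (w - v)) = 0"
    using fg by (simp add: linear_form_add linear_form_diff linear_form_scale \<alpha>)
  ultimately show ?thesis by blast
qed

lemma nonvanishing_prod:
  fixes f :: "'a \<Rightarrow> 'n::finite cvec \<Rightarrow> complex" and \<alpha> :: "'n cvec \<Rightarrow> complex"
  assumes "linear_form \<alpha>" "finite A"
    "\<And>x. x \<in> A \<Longrightarrow> f x \<in> polynomials \<and> (\<exists>v. \<alpha> v = 0 \<and> f x v \<noteq> 0)"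
  shows "\<exists>v. \<alpha> v = 0 \<and> (\<Prod>x\<in>A. f x) v \<noteq> 0"
  using assms(2,3)
proof (induction A rule: finite_induct)
  case empty
  show ?case using linear_form_zero[OF assms(1)] by auto
next
  case (insert x A)
  have "\<exists>v. \<alpha> v = 0 \<and> (\<Prod>x\<in>A. f x) v \<noteq> 0" by (rule insert.IH) (use insert.prems in blast)
  then obtain w where w: "\<alpha> w = 0" "(\<Prod>x\<in>A. f x) w \<noteq> 0" by blast
  obtain v where v: "\<alpha> v = 0" "f x v \<noteq> 0" "f x \<in> polynomials" using insert.prems by blast
  have "(\<Prod>x\<in>A. f x) \<in> polynomials" by (rule polynomials_prod) (use insert.prems in blast)
  from nonvanishing_mult[OF assms(1) v(3) this v(1,2) w]
  obtain y where "\<alpha> y = 0" "(f x * (\<Prod>x\<in>A. f x)) y \<noteq> 0" by auto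
  moreover have "(\<Prod>x\<in>insert x A. f x) = f x * (\<Prod>x\<in>A. f x)" using insert.hyps by (rule prod.insert)
  ultimately show ?case by (intro exI[of _ y]) (simp only: simp_thms)
qed

text \<open>\<alpha> is a prime element that does not divide p, since p is not zero on the whole
  kernel. The factors \<alpha> can therefore be taken out of h one at a time.\<close>

lemma power_divides_cofactor:
  fixes p h x \<alpha> :: "'n::finite cvec \<Rightarrow> complex"
  assumes \<alpha>: "linear_form \<alpha>" "\<alpha> \<noteq> 0"
    and p: "p \<in> polynomials" "\<alpha> v = 0" "p v \<noteq> 0"
    and "h \<in> polynomials" "x \<in> polynomials" "p * h = \<alpha> ^ m * x"
  shows "\<exists>y\<in>polynomials. h = \<alpha> ^ m * y"
  using assms(6-8)
proof (induction m arbitrary: h)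
  case 0
  then have "h = \<alpha> ^ 0 * h" by simp
  then show ?case using 0(1) by blast
next
  case (Suc m)
  have "\<alpha> \<in> polynomials" by (rule polynomials_linear_form[OF \<alpha>(1)])
  have "h w = 0" if "\<alpha> w = 0" for w
  proof (rule ccontr)
    assume "h w \<noteq> 0"
    from nonvanishing_mult[OF \<alpha>(1) p(1) Suc.prems(1) p(2,3) that this]
    obtain y where "\<alpha> y = 0" "p y * h y \<noteq> 0" by blast
    moreover have "p y * h y = \<alpha> y ^ Suc m * x y"
      using fun_cong[OF Suc.prems(3), of y] by (simp add: power_fun_apply mult_ac)
    ultimately show False by simp
  qed
  then obtain k where k: "k \<in> polynomials" "h = \<alpha> * k"
    by (rule vanishing_divisible[OF \<alpha> Suc.prems(1)])
  have "\<alpha> * (p * k) = p * h" using k(2) by (simp add: mult_ac)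
  also have "\<dots> = \<alpha> ^ Suc m * x" by (rule Suc.prems(3))
  also have "\<dots> = \<alpha> * (\<alpha> ^ m * x)" by (simp add: mult_ac)
  finally have "p * k = \<alpha> ^ m * x"
    by (intro poly_cancel_left[OF \<open>\<alpha> \<in> polynomials\<close> polynomials_mult[OF p(1) k(1)] _ \<alpha>(2)]
        polynomials_intros Suc.prems(2) \<open>\<alpha> \<in> polynomials\<close>)
  from Suc.IH[OF k(1) Suc.prems(2) this] obtain y where "y \<in> polynomials" "k = \<alpha> ^ m * y" by blast
  with k(2) have "h = \<alpha> ^ Suc m * y" by (simp add: mult_ac)
  with \<open>y \<in> polynomials\<close> show ?case by blast
qed

text \<open>The product collected so far does not vanish identically on the kernel of the next form,
  because none of its factors does; so the next power passes to the cofactor by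
  \<open>power_divides_cofactor\<close>.\<close>

lemma prod_divides:
  fixes f :: "'n::finite cvec \<Rightarrow> complex"
  assumes "finite F" and f: "f \<in> polynomials"
    and lin: "\<And>H. H \<in> F \<Longrightarrow> linear_form (\<alpha> H) \<and> \<alpha> H \<noteq> 0"
    and indep: "\<And>H K. H \<in> F \<Longrightarrow> K \<in> F \<Longrightarrow> H \<noteq> K \<Longrightarrow> \<exists>v. \<alpha> K v = 0 \<and> \<alpha> H v \<noteq> 0"
    and div: "\<And>H. H \<in> F \<Longrightarrow> \<exists>h\<in>polynomials. f = \<alpha> H ^ m H * h"
  shows "\<exists>h\<in>polynomials. f = (\<Prod>H\<in>F. \<alpha> H ^ m H) * h"
  using assms
proof (induction F rule: finite_induct)
  case empty
  have "f = (\<Prod>H\<in>{}. \<alpha> H ^ m H) * f" by simp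
  with f show ?case by blast
next
  case (insert K F)
  have "\<exists>h\<in>polynomials. f = (\<Prod>H\<in>F. \<alpha> H ^ m H) * h"
    by (rule insert.IH) (use insert.prems in blast)+
  then obtain h where h: "h \<in> polynomials" "f = (\<Prod>H\<in>F. \<alpha> H ^ m H) * h" by blast
  obtain x where x: "x \<in> polynomials" "f = \<alpha> K ^ m K * x" using insert.prems by blast
  have K: "linear_form (\<alpha> K)" "\<alpha> K \<noteq> 0" using insert.prems(2) by blast+
  have pol: "\<alpha> H ^ m H \<in> polynomials" if "H \<in> F" for H
    using insert.prems(2) that polynomials_linear_form polynomials_power by blast
  have nv: "\<alpha> H ^ m H \<in> polynomials \<and> (\<exists>v. \<alpha> K v = 0 \<and> (\<alpha> H ^ m H) v \<noteq> 0)" if H: "H \<in> F" for H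
  proof -
    have "H \<noteq> K" using H insert.hyps by blast
    then obtain v where "\<alpha> K v = 0" "\<alpha> H v \<noteq> 0" using insert.prems(3) H by blast
    then show ?thesis using pol[OF H] by (auto simp: power_fun_apply)
  qed
  from nonvanishing_prod[where f = "\<lambda>H. \<alpha> H ^ m H", OF K(1) insert.hyps(1) nv]
  obtain v where v: "\<alpha> K v = 0" "(\<Prod>H\<in>F. \<alpha> H ^ m H) v \<noteq> 0" by blast
  have P: "(\<Prod>H\<in>F. \<alpha> H ^ m H) \<in> polynomials" using pol by (rule polynomials_prod)
  have "(\<Prod>H\<in>F. \<alpha> H ^ m H) * h = \<alpha> K ^ m K * x" by (rule trans[OF h(2)[symmetric] x(2)])
  with power_divides_cofactor[where p = "\<Prod>H\<in>F. \<alpha> H ^ m H" and v = v, OF K P v h(1) x(1)]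
  obtain y where y: "y \<in> polynomials" "h = \<alpha> K ^ m K * y" by blast
  have "(\<Prod>H\<in>insert K F. \<alpha> H ^ m H) = \<alpha> K ^ m K * (\<Prod>H\<in>F. \<alpha> H ^ m H)"
    using insert.hyps by simp
  then have "f = (\<Prod>H\<in>insert K F. \<alpha> H ^ m H) * y" using h(2) y(2) by (simp add: mult_ac)
  with y(1) show ?case by blast
qed

text \<open>While \<open>\<xi> ^ a \<noteq> 1\<close>, an eigenfunction vanishes on the hyperplane and a factor \<open>\<alpha>\<close> splits off.\<close>

lemma eigenfunction_divisible:
  fixes f \<alpha> :: "'n::finite cvec \<Rightarrow> complex"
  assumes \<alpha>: "linear_form \<alpha>" "\<alpha> \<noteq> 0"
    and p: "\<And>v. \<alpha> v = 0 \<Longrightarrow> p v = v" "\<And>v. \<alpha> (p v) = \<xi> * \<alpha> v"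
    and \<xi>: "\<xi> \<noteq> 0" "\<And>k. 0 < k \<Longrightarrow> k \<le> a \<Longrightarrow> \<xi> ^ k \<noteq> 1"
    and f: "f \<in> polynomials" "\<And>v. f (p v) = \<xi> ^ a * f v"
    and pp: "\<And>g. g \<in> polynomials \<Longrightarrow> (\<lambda>v. g (p v)) \<in> polynomials"
  shows "\<exists>h\<in>polynomials. f = \<alpha> ^ a * h"
  using f \<xi>(2)
proof (induction a arbitrary: f)
  case 0
  then have "f = \<alpha> ^ 0 * f" by simp
  with 0 show ?case by blast
next
  case (Suc a)
  have "f v = 0" if "\<alpha> v = 0" for v
    using Suc.prems(2)[of v] p(1)[OF that] Suc.prems(3)[of "Suc a"] by simp
  then obtain k where k: "k \<in> polynomials" "f = \<alpha> * k"
    by (rule vanishing_divisible[OF \<alpha> Suc.prems(1)])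
  have pol: "\<alpha> \<in> polynomials" by (rule polynomials_linear_form[OF \<alpha>(1)])
  \<comment> \<open>\<alpha> is itself an eigenfunction, with eigenvalue \<xi>; hence the cofactor k
    belongs to the eigenvalue \<open>\<xi> ^ a\<close>.\<close>
  have "\<alpha> * (\<lambda>v. k (p v)) = \<alpha> * ((\<lambda>v. \<xi> ^ a) * k)"
  proof
    fix v
    have "\<xi> * (\<alpha> v * k (p v)) = \<xi> * (\<alpha> v * (\<xi> ^ a * k v))"
      using Suc.prems(2)[of v] by (simp add: k(2) p(2) mult_ac)
    then show "(\<alpha> * (\<lambda>v. k (p v))) v = (\<alpha> * ((\<lambda>v. \<xi> ^ a) * k)) v" using \<xi>(1) by simp
  qed
  then have keq: "(\<lambda>v. k (p v)) = (\<lambda>v. \<xi> ^ a) * k"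
    by (intro poly_cancel_left[OF pol pp[OF k(1)] polynomials_mult[OF polynomials.const k(1)] \<alpha>(2)])
  have "k (p v) = \<xi> ^ a * k v" for v using fun_cong[OF keq, of v] by simp
  moreover have "\<xi> ^ j \<noteq> 1" if "0 < j" "j \<le> a" for j using Suc.prems(3) that by simp
  ultimately obtain y where "y \<in> polynomials" "k = \<alpha> ^ a * y" using Suc.IH[OF k(1)] by blast
  with k(2) have "f = \<alpha> ^ Suc a * y" by (simp add: mult_ac)
  with \<open>y \<in> polynomials\<close> show ?case by blast
qed

section \<open>The action on polynomials and forms\<close>

lemma matrix_inv_eqI:
  fixes A B :: "'k::field^'n^'n"
  assumes "A ** B = mat 1" shows "matrix_inv A = B"
proof -
  have BA: "B ** A = mat 1" using assms matrix_left_right_inverse by blast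
  have uniq: "C = B" if C: "A ** C = mat 1 \<and> C ** A = mat 1" for C
  proof -
    have "C = B ** A ** C" by (simp add: BA)
    also have "\<dots> = B ** (A ** C)" by (rule matrix_mul_assoc[symmetric])
    also have "\<dots> = B" using C by simp
    finally show ?thesis .
  qed
  show ?thesis unfolding matrix_inv_def
    by (rule some_equality) (use assms BA in blast, rule uniq)
qed

lemma unitary_mult_inv:
  assumes "unitary A"
  shows "A ** matrix_inv A = mat 1" "matrix_inv A ** A = mat 1" "matrix_inv A = adjoint_matrix A"
  using assms matrix_inv_eqI[of A "adjoint_matrix A"] by (auto simp: unitary_def)

lemma adjoint_matrix_mult: "adjoint_matrix (A ** B) = adjoint_matrix B ** adjoint_matrix A"
  by (simp add: adjoint_matrix_def matrix_matrix_mult_def vec_eq_iff mult.commute)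

lemma adjoint_matrix_adjoint: "adjoint_matrix (adjoint_matrix A) = A"
  by (simp add: adjoint_matrix_def vec_eq_iff)

lemma unitary_mult: assumes "unitary A" "unitary B" shows "unitary (A ** B)"
proof -
  have "A ** B ** (adjoint_matrix B ** adjoint_matrix A) = A ** (B ** adjoint_matrix B) ** adjoint_matrix A"
    "adjoint_matrix B ** adjoint_matrix A ** (A ** B) = adjoint_matrix B ** (adjoint_matrix A ** A) ** B"
    by (simp_all only: matrix_mul_assoc)
  with assms show ?thesis by (simp add: unitary_def adjoint_matrix_mult)
qed

lemma unitary_one: "unitary (mat 1)"
proof -
  have "adjoint_matrix (mat 1) = (mat 1 :: 'n::finite cmat)"
    by (simp add: adjoint_matrix_def mat_def vec_eq_iff)
  then show ?thesis by (simp add: unitary_def)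
qed

lemma unitary_adjoint: "unitary A \<Longrightarrow> unitary (adjoint_matrix A)"
  by (simp add: unitary_def adjoint_matrix_adjoint)

lemma group_unitary: "group (unitary_group :: ('n::finite cmat) monoid)"
proof (rule groupI)
  fix x :: "'n cmat" assume "x \<in> carrier unitary_group"
  then show "\<exists>y\<in>carrier unitary_group. y \<otimes>\<^bsub>unitary_group\<^esub> x = \<one>\<^bsub>unitary_group\<^esub>"
    by (intro bexI[of _ "adjoint_matrix x"]) (auto simp: unitary_group_def unitary_adjoint, simp add: unitary_def)
qed (auto simp: unitary_group_def unitary_mult unitary_one matrix_mul_assoc)

lemma unitary_group_simps:
  "carrier unitary_group = Collect unitary" "A \<otimes>\<^bsub>unitary_group\<^esub> B = A ** B" "\<one>\<^bsub>unitary_group\<^esub> = mat 1"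
  by (simp_all add: unitary_group_def)

lemma unitary_group_inv: "unitary A \<Longrightarrow> inv\<^bsub>unitary_group\<^esub> A = matrix_inv A"
  using unitary_mult_inv[of A] unitary_adjoint[of A]
  by (intro group.inv_equality[OF group_unitary]) (auto simp: unitary_group_simps)

lemma matrix_inv_one [simp]: "matrix_inv (mat 1 :: 'k::field^'n^'n) = mat 1"
  by (rule matrix_inv_eqI) simp

lemma matrix_inv_unitary_mult:
  assumes "unitary g" "unitary h"
  shows "matrix_inv (g ** h) = matrix_inv h ** matrix_inv g"
proof (rule matrix_inv_eqI)
  have "g ** h ** (matrix_inv h ** matrix_inv g) = g ** (h ** matrix_inv h) ** matrix_inv g"
    by (simp only: matrix_mul_assoc)
  then show "g ** h ** (matrix_inv h ** matrix_inv g) = mat 1"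
    by (simp add: unitary_mult_inv(1) assms)
qed

lemma matrix_inv_mult_vec:
  assumes "A ** B = mat 1" shows "A *v (B *v v) = (v :: 'k::field^'n)"
  using assms by (metis matrix_vector_mul_assoc matrix_vector_mul_lid)

definition const_mat :: "'n::finite cmat \<Rightarrow> 'n \<Rightarrow> 'n \<Rightarrow> 'n cvec \<Rightarrow> complex" where
  "const_mat A = (\<lambda>i j v. A $ i $ j)"

lemma const_mat_prod: "mat_prod (const_mat A) (const_mat B) = const_mat (A ** B)"
  by (simp add: mat_prod_def const_mat_def matrix_matrix_mult_def fun_eq_iff sum_fun_apply)

lemma const_mat_one: "const_mat (mat 1) = diag (\<lambda>_. 1)"
  by (auto simp: const_mat_def mat_def diag_def fun_eq_iff)

lemma lam_const_inverse:
  assumes "A ** B = mat 1" shows "lam (const_mat B) (lam (const_mat A) \<omega>) = \<omega>"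
  by (simp add: lam_lam const_mat_prod assms const_mat_one)

section \<open>Forms with polynomial coefficients\<close>

definition poly_form :: "'n::finite form \<Rightarrow> bool" where
  "poly_form \<omega> \<longleftrightarrow> (\<forall>I. \<omega> I \<in> polynomials)"

lemma poly_form_add: "poly_form \<mu> \<Longrightarrow> poly_form \<omega> \<Longrightarrow> poly_form (\<mu> + \<omega>)"
  by (simp add: poly_form_def polynomials_add)

lemma poly_form_zero [simp]: "poly_form 0"
  by (simp add: poly_form_def)

lemma poly_form_diff: "poly_form \<mu> \<Longrightarrow> poly_form \<omega> \<Longrightarrow> poly_form (\<mu> - \<omega>)"
  by (simp add: poly_form_def polynomials_diff)

lemma poly_form_scale: "f \<in> polynomials \<Longrightarrow> poly_form \<omega> \<Longrightarrow> poly_form (scale f \<omega>)"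
  by (simp add: poly_form_def polynomials_mult)

lemma poly_form_sum: "(\<And>x. x \<in> A \<Longrightarrow> poly_form (w x)) \<Longrightarrow> poly_form (\<Sum>x\<in>A. w x)"
  by (simp add: poly_form_def sum_fun_apply polynomials_sum)

lemma polynomials_neg_one_power: "(- 1) ^ k \<in> polynomials"
  by (intro polynomials_power polynomials_uminus polynomials_one)

lemma poly_form_wedge: "poly_form \<mu> \<Longrightarrow> poly_form \<omega> \<Longrightarrow> poly_form (wedge \<mu> \<omega>)"
  unfolding poly_form_def wedge_inversions
  by (intro allI polynomials_sum polynomials_mult polynomials_neg_one_power) auto

lemma poly_form_basis: "poly_form (ext_basis I)"
  by (simp add: poly_form_def ext_basis_def)

lemma poly_form_row: "(\<And>j. A i j \<in> polynomials) \<Longrightarrow> poly_form (row_form A i)"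
  unfolding row_form_def by (intro poly_form_sum poly_form_scale poly_form_basis)

lemma poly_form_row_wedge:
  assumes "\<And>i j. A i j \<in> polynomials" shows "poly_form (row_wedge A I)"
proof (induction I rule: finite_linorder_min_induct[OF finite, case_names empty insert])
  case (insert m I)
  then show ?case by (simp add: row_wedge_min poly_form_wedge poly_form_row assms)
qed (simp add: poly_form_basis)

lemma poly_form_lam:
  "(\<And>i j. A i j \<in> polynomials) \<Longrightarrow> poly_form \<omega> \<Longrightarrow> poly_form (lam A \<omega>)"
  unfolding lam_def by (intro poly_form_sum poly_form_scale poly_form_row_wedge) (auto simp: poly_form_def)

lemma polynomials_const_mat: "const_mat A i j \<in> polynomials"
  by (simp add: const_mat_def polynomials.const)

lemma polynomials_act: "f \<in> polynomials \<Longrightarrow> act g f \<in> polynomials"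
  unfolding act_def by (rule polynomials_matrix)

lemma partial_deriv_linear:
  assumes "linear_form f"
  shows "partial_deriv j f = (\<lambda>v. f (axis j 1))"
proof
  fix v
  have "f (v + axis j t) = f v + f (axis j 1) * t" for t
  proof -
    have "axis j t = t *s axis j 1" by (simp add: vec_eq_iff axis_def)
    then show ?thesis by (simp add: linear_form_add linear_form_scale assms mult.commute)
  qed
  then have "partial_deriv j f v = deriv (\<lambda>t. f v + f (axis j 1) * t) 0"
    by (simp add: partial_deriv_def)
  also have "((\<lambda>t. f v + f (axis j 1) * t) has_field_derivative f (axis j 1)) (at 0)"
    by (auto intro!: derivative_eq_intros)
  then have "deriv (\<lambda>t. f v + f (axis j 1) * t) 0 = f (axis j 1)" by (rule DERIV_imp_deriv)
  finally show "partial_deriv j f v = f (axis j 1)" .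
qed

text \<open>The transformed coordinate functions are the rows of the inverse matrix, and their
  differentials have constant coefficients. The action thus splits into a constant change of frame
  and the action on coefficients, and these two commute.\<close>

lemma act_form_lam:
  "act_form g \<omega> = lam (const_mat (matrix_inv g)) (\<lambda>I. act g (\<omega> I))"
proof -
  have "differential (act g (\<lambda>v. v $ i)) = row_form (const_mat (matrix_inv g)) i" for i
    unfolding differential_def row_form_def act_def partial_deriv_linear[OF linear_form_row] ext_gen_basis
    by (simp add: const_mat_def matrix_vector_mult_def axis_def if_distrib[of "\<lambda>x. _ * x"] cong: if_cong)
  then show ?thesis
    by (simp add: act_form_def lam_def row_wedge_def degree0_one)
qed

lemma act_add: "act g (f + h) = act g f + act g h"
  and act_mult: "act g (f * h) = act g f * act g h"
  and act_diff: "act g (f - h) = act g f - act g h"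
  and act_const: "act g (\<lambda>v. c) = (\<lambda>v. c)"
  by (simp_all add: act_def fun_eq_iff)

lemma act_power: "act g (f ^ k) = act g f ^ k"
  by (simp add: act_def fun_eq_iff power_fun_apply)

lemma act_sum: "act g (\<Sum>x\<in>A. f x) = (\<Sum>x\<in>A. act g (f x))"
  and act_prod: "act g (\<Prod>x\<in>A. f x) = (\<Prod>x\<in>A. act g (f x))"
  by (simp_all add: act_def fun_eq_iff sum_fun_apply prod_fun_apply)

lemma act_zero [simp]: "act g 0 = 0" and act_one [simp]: "act g 1 = 1"
  by (simp_all add: act_def fun_eq_iff)

lemma hcomp_act: "hcomp k (act g f) = act g (hcomp k f)"
proof
  fix v
  have "pline (act g f) 0 v = pline f 0 (matrix_inv g *v v)"
    by (simp add: pline_def act_def vector_scalar_commute)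
  then show "hcomp k (act g f) v = act g (hcomp k f) v" by (simp add: hcomp_def act_def)
qed

lemma act_lam: "(\<lambda>I. act g (lam A \<omega> I)) = lam (\<lambda>i j. act g (A i j)) (\<lambda>I. act g (\<omega> I))"
  by (rule ext) (rule lam_hom[where h = "act g"]; simp add: act_add act_mult)

lemma act_const_mat: "(\<lambda>i j. act g (const_mat A i j)) = const_mat A"
  by (simp add: const_mat_def act_const)

lemma act_form_add: "act_form g (\<mu> + \<omega>) = act_form g \<mu> + act_form g \<omega>"
  using lam_add[of "const_mat (matrix_inv g)" "\<lambda>I. act g (\<mu> I)" "\<lambda>I. act g (\<omega> I)"]
  by (simp add: act_form_lam act_add plus_fun_def[where 'a = "'a set"])

lemma act_form_zero [simp]: "act_form g 0 = 0"
  using act_form_add[of g 0 0] by simp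

lemma act_form_scale: "act_form g (scale f \<omega>) = scale (act g f) (act_form g \<omega>)"
  using lam_scale[of "const_mat (matrix_inv g)" "act g f" "\<lambda>I. act g (\<omega> I)"]
  by (simp add: act_form_lam act_mult scale_def)

lemma act_form_sum: "act_form g (\<Sum>x\<in>A. w x) = (\<Sum>x\<in>A. act_form g (w x))"
  using sum_comp_morphism[of "act_form g" w A] by (simp add: act_form_add o_def)

lemma act_form_wedge: "act_form g (wedge \<mu> \<omega>) = wedge (act_form g \<mu>) (act_form g \<omega>)"
proof -
  have "(\<lambda>I. act g (wedge \<mu> \<omega> I)) = wedge (\<lambda>I. act g (\<mu> I)) (\<lambda>I. act g (\<omega> I))"
    by (rule ext) (rule wedge_hom[where h = "act g"]; simp add: act_add act_mult)
  then show ?thesis by (simp add: act_form_lam lam_wedge)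
qed

lemma poly_form_act: "poly_form \<omega> \<Longrightarrow> poly_form (act_form g \<omega>)"
  unfolding act_form_lam by (rule poly_form_lam)
    (auto simp: polynomials_const_mat poly_form_def polynomials_act)

lemma act_form_card: "(\<And>I. card I \<noteq> p \<Longrightarrow> \<omega> I = 0) \<Longrightarrow> card I \<noteq> p \<Longrightarrow> act_form g \<omega> I = 0"
  unfolding act_form_lam by (rule lam_card) auto

lemma act_form_degree0: "act_form g (degree0 f) = degree0 (act g f)"
proof -
  have "act_form g (ext_basis {}) = ext_basis {}"
  proof -
    have "(\<lambda>I. act g (ext_basis {} I)) = (ext_basis {} :: 'a form)" by (auto simp: ext_basis_def)
    then show ?thesis by (simp add: act_form_lam)
  qed
  then show ?thesis by (simp add: degree0_scale act_form_scale)
qed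

lemma act_compose:
  assumes "unitary g" "unitary h" shows "act g (act h f) = act (g ** h) f"
proof -
  show ?thesis by (simp add: act_def matrix_vector_mul_assoc matrix_inv_unitary_mult assms)
qed

text \<open>Two reversals of order cancel, that of \<open>lam_lam\<close> and that of inverting a
  product.\<close>

lemma act_form_compose:
  assumes "unitary g" "unitary h" shows "act_form g (act_form h \<omega>) = act_form (g ** h) \<omega>"
proof -
  have "act_form g (act_form h \<omega>) = lam (const_mat (matrix_inv g))
      (lam (const_mat (matrix_inv h)) (\<lambda>I. act g (act h (\<omega> I))))"
    unfolding act_form_lam act_lam act_const_mat ..
  then show ?thesis
    by (simp add: act_form_lam[of "g ** h"] lam_lam const_mat_prod act_compose assms matrix_inv_unitary_mult)
qed

lemma act_mat_one: "act (mat 1) f = f"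
  by (simp add: act_def)

lemma act_form_mat_one: "act_form (mat 1) \<omega> = \<omega>"
  by (simp add: act_form_lam act_mat_one const_mat_one)

section \<open>Averaging over a finite unitary group\<close>

locale finite_unitary_group =
  fixes G :: "('n::{finite,linorder} cmat) set" and \<theta> :: "'n cmat \<Rightarrow> complex"
  assumes finite_G: "finite G" and subgroup_G: "subgroup G unitary_group"
    and character: "multiplicative_character G \<theta>"
begin

lemma G_unitary: "g \<in> G \<Longrightarrow> unitary g"
  using subgroup.subset[OF subgroup_G] by (auto simp: unitary_group_simps)

lemma G_mult: "g \<in> G \<Longrightarrow> h \<in> G \<Longrightarrow> g ** h \<in> G"
  using subgroup.m_closed[OF subgroup_G] by (simp add: unitary_group_simps)

lemma G_one: "mat 1 \<in> G"
  using subgroup.one_closed[OF subgroup_G] by (simp add: unitary_group_simps)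

lemma G_inv: "g \<in> G \<Longrightarrow> matrix_inv g \<in> G"
  using subgroup.m_inv_closed[OF subgroup_G] by (simp add: unitary_group_inv G_unitary)

lemma G_mult_inv:
  assumes "g \<in> G" shows "g ** matrix_inv g = mat 1" "matrix_inv g ** g = mat 1"
    "matrix_inv (matrix_inv g) = g"
  using unitary_mult_inv[OF G_unitary[OF assms]] by (auto intro: matrix_inv_eqI)

lemma \<theta>_mult: "g \<in> G \<Longrightarrow> h \<in> G \<Longrightarrow> \<theta> (g ** h) = \<theta> g * \<theta> h"
  using character by (auto simp: multiplicative_character_def hom_def unitary_group_def nonzero_complex_def)

lemma \<theta>_nonzero: "g \<in> G \<Longrightarrow> \<theta> g \<noteq> 0"
  using character by (auto simp: multiplicative_character_def hom_def unitary_group_def nonzero_complex_def)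

lemma \<theta>_one: "\<theta> (mat 1) = 1"
  using \<theta>_mult[OF G_one G_one] \<theta>_nonzero[OF G_one] by simp

lemma \<theta>_inv: "g \<in> G \<Longrightarrow> \<theta> (matrix_inv g) = inverse (\<theta> g)"
  using \<theta>_mult[of g "matrix_inv g"] by (simp add: G_inv G_mult_inv \<theta>_one inverse_unique)

lemma card_G: "of_nat (card G) \<noteq> (0 :: complex)"
  using finite_G G_one by auto

lemma bij_mult_left: "g \<in> G \<Longrightarrow> bij_betw (\<lambda>h. g ** h) G G"
  by (rule bij_betw_byWitness[where f' = "\<lambda>h. matrix_inv g ** h"])
    (auto simp: G_mult G_inv matrix_mul_assoc G_mult_inv)

definition reynolds :: "('n cvec \<Rightarrow> complex) \<Rightarrow> 'n cvec \<Rightarrow> complex" where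
  "reynolds f = (\<lambda>v. 1 / of_nat (card G)) * (\<Sum>g\<in>G. act g f)"

lemma polynomials_reynolds: "f \<in> polynomials \<Longrightarrow> reynolds f \<in> polynomials"
  unfolding reynolds_def by (intro polynomials_intros polynomials_act)

lemma reynolds_invariant: assumes "f \<in> polynomials" shows "reynolds f \<in> invariants G"
proof -
  have "act g (reynolds f) = reynolds f" if g: "g \<in> G" for g
  proof -
    have "act g (\<Sum>h\<in>G. act h f) = (\<Sum>h\<in>G. act (g ** h) f)"
      by (simp add: act_sum act_compose G_unitary g)
    also have "\<dots> = (\<Sum>h\<in>G. act h f)"
      by (rule sum.reindex_bij_betw[OF bij_mult_left[OF g]])
    finally show ?thesis by (simp add: reynolds_def act_mult act_const)
  qed
  with polynomials_reynolds[OF assms] show ?thesis by (simp add: invariants_def)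
qed

lemma reynolds_fixed: "f \<in> invariants G \<Longrightarrow> reynolds f = f"
  using card_G by (simp add: reynolds_def invariants_def fun_eq_iff sum_fun_apply)

lemma reynolds_mult: "r \<in> invariants G \<Longrightarrow> reynolds (r * f) = r * reynolds f"
  by (simp add: reynolds_def invariants_def act_mult sum_distrib_left[symmetric] mult.left_commute)

lemma reynolds_add: "reynolds (f + h) = reynolds f + reynolds h"
  by (simp add: reynolds_def act_add sum.distrib distrib_left)

lemma reynolds_zero [simp]: "reynolds 0 = 0"
  by (simp add: reynolds_def)

section \<open>Semi-invariant forms and the projection onto them\<close>

definition chi_invariant :: "'n form \<Rightarrow> bool" where
  "chi_invariant \<omega> \<longleftrightarrow> poly_form \<omega> \<and> (\<forall>g\<in>G. act_form g \<omega> = scale (\<lambda>v. \<theta> g) \<omega>)"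

lemma chi_forms_iff:
  "\<omega> \<in> chi_forms G \<theta> p \<longleftrightarrow> chi_invariant \<omega> \<and> (\<forall>I. card I \<noteq> p \<longrightarrow> \<omega> I = 0)"
  by (auto simp: chi_forms_def forms_def ext_power_def chi_invariant_def poly_form_def)

lemma chi_invariant_zero [simp]: "chi_invariant 0"
  by (simp add: chi_invariant_def)

lemma chi_invariant_scale: "r \<in> invariants G \<Longrightarrow> chi_invariant \<omega> \<Longrightarrow> chi_invariant (scale r \<omega>)"
  by (simp add: chi_invariant_def poly_form_scale invariants_def act_form_scale scale_scale mult.commute)

lemma chi_invariant_sum: "(\<And>x. x \<in> A \<Longrightarrow> chi_invariant (w x)) \<Longrightarrow> chi_invariant (\<Sum>x\<in>A. w x)"
  by (simp add: chi_invariant_def poly_form_sum act_form_sum scale_sum_right)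

definition chi_average :: "'n form \<Rightarrow> 'n form" where
  "chi_average \<omega> = scale (\<lambda>v. 1 / of_nat (card G)) (\<Sum>g\<in>G. scale (\<lambda>v. inverse (\<theta> g)) (act_form g \<omega>))"

lemma chi_average_invariant:
  assumes "poly_form \<omega>" shows "chi_invariant (chi_average \<omega>)"
proof -
  have pf: "poly_form (chi_average \<omega>)"
    unfolding chi_average_def
    by (intro poly_form_scale poly_form_sum poly_form_act polynomials.const assms)
  have "act_form g (chi_average \<omega>) = scale (\<lambda>v. \<theta> g) (chi_average \<omega>)" if g: "g \<in> G" for g
  proof -
    have "act_form g (\<Sum>h\<in>G. scale (\<lambda>v. inverse (\<theta> h)) (act_form h \<omega>)) =
       (\<Sum>h\<in>G. scale (\<lambda>v. inverse (\<theta> h)) (act_form (g ** h) \<omega>))"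
      by (simp add: act_form_sum act_form_scale act_const act_form_compose G_unitary g)
    also have "\<dots> = (\<Sum>h\<in>G. scale (\<lambda>v. \<theta> g * inverse (\<theta> (g ** h))) (act_form (g ** h) \<omega>))"
      by (rule sum.cong) (auto simp: \<theta>_mult \<theta>_nonzero g mult.assoc[symmetric] simp del: mult.assoc)
    also have "\<dots> = (\<Sum>h\<in>G. scale (\<lambda>v. \<theta> g * inverse (\<theta> h)) (act_form h \<omega>))"
      by (rule sum.reindex_bij_betw[OF bij_mult_left[OF g],
          where g = "\<lambda>h. scale (\<lambda>v. \<theta> g * inverse (\<theta> h)) (act_form h \<omega>)"])
    also have "\<dots> = scale (\<lambda>v. \<theta> g) (\<Sum>h\<in>G. scale (\<lambda>v. inverse (\<theta> h)) (act_form h \<omega>))"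
      by (simp add: scale_sum_right scale_scale times_fun_def)
    finally show ?thesis
      by (simp add: chi_average_def act_form_scale act_const scale_scale mult.commute)
  qed
  with pf show ?thesis by (simp add: chi_invariant_def)
qed

text \<open>The twist of \<omega> by the character cancels the inverse twist in the average, so that
  only f is averaged. Relations with polynomial coefficients between semi-invariant forms thereby
  become relations over the invariants.\<close>

lemma chi_average_scale_invariant:
  assumes "chi_invariant \<omega>" shows "chi_average (scale f \<omega>) = scale (reynolds f) \<omega>"
proof -
  have "scale (\<lambda>v. inverse (\<theta> g)) (act_form g (scale f \<omega>)) = scale (act g f) \<omega>" if "g \<in> G" for g
    using assms that by (auto simp: chi_invariant_def act_form_scale fun_eq_iff \<theta>_nonzero)
  then show ?thesis
    by (simp add: chi_average_def reynolds_def scale_sum_left[symmetric] scale_scale)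
qed

lemma reynolds_one: "reynolds 1 = 1"
  using card_G by (simp add: reynolds_def fun_eq_iff sum_fun_apply)

lemma chi_average_fixed: "chi_invariant \<omega> \<Longrightarrow> chi_average \<omega> = \<omega>"
  using chi_average_scale_invariant[of \<omega> 1] by (simp add: reynolds_one)

lemma chi_average_add: "chi_average (\<mu> + \<omega>) = chi_average \<mu> + chi_average \<omega>"
  by (simp add: chi_average_def act_form_add scale_add_right sum.distrib)

lemma chi_average_zero [simp]: "chi_average 0 = 0"
  by (simp add: chi_average_def)

lemma chi_average_scale:
  "r \<in> invariants G \<Longrightarrow> chi_average (scale r \<omega>) = scale r (chi_average \<omega>)"
  by (simp add: chi_average_def invariants_def act_form_scale scale_scale scale_sum_right mult_ac)

lemma chi_average_card:
  assumes "\<And>I. card I \<noteq> p \<Longrightarrow> \<omega> I = 0" "card I \<noteq> p"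
  shows "chi_average \<omega> I = 0"
proof -
  have "act_form g \<omega> I = 0" for g by (rule act_form_card[OF assms])
  then show ?thesis by (simp add: chi_average_def sum_fun_apply)
qed

end

section \<open>Chevalley's argument\<close>

text \<open>Finite sums of terms \<open>m a b\<close>. With multiplication for m these are ideals of
  invariants extended to all polynomials, with \<open>scale\<close> submodules of forms; an additive
  map has to be checked on single terms only.\<close>

inductive_set lincomb :: "('a \<Rightarrow> 'b \<Rightarrow> 'b::comm_monoid_add) \<Rightarrow> 'a set \<Rightarrow> 'b set \<Rightarrow> 'b set"
  for m A B where
  zero: "0 \<in> lincomb m A B"
| step: "a \<in> A \<Longrightarrow> b \<in> B \<Longrightarrow> x \<in> lincomb m A B \<Longrightarrow> m a b + x \<in> lincomb m A B"

lemma lincomb_add: "x \<in> lincomb m A B \<Longrightarrow> y \<in> lincomb m A B \<Longrightarrow> x + y \<in> lincomb m A B"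
  by (induction rule: lincomb.induct) (auto simp: add.assoc intro: lincomb.intros)

lemma lincomb_single: "a \<in> A \<Longrightarrow> b \<in> B \<Longrightarrow> m a b \<in> lincomb m A B"
  using lincomb.step[OF _ _ lincomb.zero, of a A b B m] by simp

lemma lincomb_sum: "(\<And>x. x \<in> X \<Longrightarrow> f x \<in> lincomb m A B) \<Longrightarrow> (\<Sum>x\<in>X. f x) \<in> lincomb m A B"
  by (induction X rule: infinite_finite_induct) (auto intro: lincomb_add lincomb.zero)

lemma lincomb_closed:
  assumes "x \<in> lincomb m A B" "0 \<in> C" "\<And>y z. y \<in> C \<Longrightarrow> z \<in> C \<Longrightarrow> y + z \<in> C"
    "\<And>y z. h (y + z) = h y + h z" "h 0 = 0" "\<And>a b. a \<in> A \<Longrightarrow> b \<in> B \<Longrightarrow> h (m a b) \<in> C"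
  shows "h x \<in> C"
  using assms(1) by induction (simp_all add: assms)

lemma lincomb_map:
  assumes "x \<in> lincomb m A B" "\<And>y z. h (y + z) = h y + h z" "h 0 = 0"
    "\<And>a b. a \<in> A \<Longrightarrow> b \<in> B \<Longrightarrow> h (m a b) \<in> lincomb m' A' B'"
  shows "h x \<in> lincomb m' A' B'"
  by (rule lincomb_closed[where h = h, OF assms(1) lincomb.zero lincomb_add assms(2,3,4)])

lemma homogeneous_cofactor:
  assumes \<alpha>: "linear_form \<alpha>" "\<alpha> \<noteq> 0" and h: "h \<in> polynomials" and hom: "homogeneous (Suc d) (\<alpha> * h)"
  shows "homogeneous d h"
proof -
  have pol: "\<alpha> \<in> polynomials" by (rule polynomials_linear_form[OF \<alpha>(1)])
  have 0: "hcomp k h = 0" if "k \<noteq> d" for k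
  proof -
    have "\<alpha> * hcomp k h = hcomp (Suc k) (\<alpha> * h)"
      by (simp add: hcomp_mult_homogeneous[OF homogeneous_linear_form[OF \<alpha>(1)] h])
    also have "\<dots> = 0" using that by (simp add: hcomp_of_homogeneous[OF hom])
    finally show ?thesis using poly_domain[OF pol poly_hcomp[OF h]] \<alpha>(2) by blast
  qed
  have "h = hcomp d h"
  proof (rule hcomp_eqI[OF h poly_hcomp[OF h]])
    fix k show "hcomp k h = hcomp k (hcomp d h)"
      unfolding hcomp_of_homogeneous[OF homogeneous_hcomp[OF h]] using 0 by simp
  qed
  with homogeneous_hcomp[OF h, of d] show ?thesis by simp
qed

text \<open>The grading is by the degree of the coefficients alone; the covectors count as degree
  zero.\<close>

definition form_comp :: "nat \<Rightarrow> 'n::finite form \<Rightarrow> 'n form" where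
  "form_comp k \<omega> = (\<lambda>I. hcomp k (\<omega> I))"

lemma form_comp_zero [simp]: "form_comp k 0 = 0"
  by (simp add: form_comp_def fun_eq_iff)

lemma form_comp_add: "poly_form \<mu> \<Longrightarrow> poly_form \<omega> \<Longrightarrow> form_comp k (\<mu> + \<omega>) = form_comp k \<mu> + form_comp k \<omega>"
  unfolding form_comp_def poly_form_def by (rule ext) (simp add: hcomp_add)

lemma poly_form_comp: "poly_form \<omega> \<Longrightarrow> poly_form (form_comp k \<omega>)"
  by (simp add: form_comp_def poly_form_def poly_hcomp)

lemma form_comp_scale:
  "f \<in> polynomials \<Longrightarrow> poly_form \<omega> \<Longrightarrow>
    form_comp k (scale f \<omega>) = (\<Sum>i\<le>k. scale (hcomp i f) (form_comp (k - i) \<omega>))"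
  unfolding form_comp_def poly_form_def by (rule ext) (simp add: hcomp_mult sum_fun_apply)

lemma form_comp_sum:
  assumes "\<And>x. x \<in> A \<Longrightarrow> poly_form (w x)"
  shows "form_comp k (\<Sum>x\<in>A. w x) = (\<Sum>x\<in>A. form_comp k (w x))"
proof
  fix I
  have "hcomp k (\<Sum>x\<in>A. w x I) = (\<Sum>x\<in>A. hcomp k (w x I))"
    by (rule hcomp_sum) (use assms in \<open>auto simp: poly_form_def\<close>)
  then show "form_comp k (\<Sum>x\<in>A. w x) I = (\<Sum>x\<in>A. form_comp k (w x)) I"
    by (simp add: form_comp_def sum_fun_apply)
qed

lemma row_wedge_const:
  "row_wedge (const_mat A) J I = (\<lambda>v. row_wedge (\<lambda>i j. A $ i $ j) J I)"
proof
  fix v show "row_wedge (const_mat A) J I v = row_wedge (\<lambda>i j. A $ i $ j) J I"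
    using row_wedge_hom[where h = "\<lambda>f. f v" and A = "const_mat A" and I = J and K = I]
    by (simp add: const_mat_def)
qed

lemma form_comp_act:
  assumes "poly_form \<omega>"
  shows "form_comp k (act_form g \<omega>) = act_form g (form_comp k \<omega>)"
proof
  fix I
  let ?c = "\<lambda>J. row_wedge (const_mat (matrix_inv g)) J I"
  have c: "homogeneous 0 (?c J)" for J unfolding row_wedge_const by (rule homogeneous_const)
  have pol: "act g (\<omega> J) \<in> polynomials" for J
    using assms by (simp add: poly_form_def polynomials_act)
  have pol': "?c J * act g (\<omega> J) \<in> polynomials" for J
    by (intro polynomials_mult homogeneous_poly[OF c] pol)
  have "form_comp k (act_form g \<omega>) I = hcomp k (\<Sum>J\<in>UNIV. ?c J * act g (\<omega> J))"
    by (simp add: form_comp_def act_form_lam lam_def sum_fun_apply mult.commute)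
  also have "\<dots> = (\<Sum>J\<in>UNIV. ?c J * act g (hcomp k (\<omega> J)))"
    by (simp add: hcomp_sum[OF pol'] hcomp_mult_homogeneous[OF c pol] hcomp_act)
  also have "\<dots> = act_form g (form_comp k \<omega>) I"
    by (simp add: form_comp_def act_form_lam lam_def sum_fun_apply mult.commute)
  finally show "form_comp k (act_form g \<omega>) I = act_form g (form_comp k \<omega>) I" .
qed

lemma form_comp_sum_bound:
  fixes \<omega> :: "'n::finite form"
  assumes "poly_form \<omega>"
  obtains N where "\<omega> = (\<Sum>k\<le>N. form_comp k \<omega>)"
proof -
  have "\<forall>I. \<exists>N. \<forall>k>N. hcomp k (\<omega> I) = 0"
    using assms hcomp_bound by (auto simp: poly_form_def)
  then obtain N where N: "\<And>I k. k > N I \<Longrightarrow> hcomp k (\<omega> I) = 0" by metis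
  have le: "N I \<le> Max (range N)" for I by (rule Max_ge) auto
  have "\<omega> I = (\<Sum>k\<le>Max (range N). form_comp k \<omega>) I" for I
  proof -
    have "\<forall>k>Max (range N). hcomp k (\<omega> I) = 0" using N le[of I] by (meson le_less_trans)
    from hcomp_sum_bound[OF _ this] assms show ?thesis
      by (simp add: form_comp_def sum_fun_apply poly_form_def)
  qed
  then show ?thesis by (intro that[of "Max (range N)"]) (rule ext)
qed

context finite_unitary_group
begin

lemma invariants_poly: "f \<in> invariants G \<Longrightarrow> f \<in> polynomials"
  by (simp add: invariants_def)

lemma invariants_const: "(\<lambda>v. c) \<in> invariants G"
  by (simp add: invariants_def polynomials.const act_const)

lemma invariants_zero [simp]: "0 \<in> invariants G" and invariants_one [simp]: "1 \<in> invariants G"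
  by (simp_all add: invariants_def)

lemma invariants_add: "f \<in> invariants G \<Longrightarrow> h \<in> invariants G \<Longrightarrow> f + h \<in> invariants G"
  by (simp add: invariants_def polynomials_add act_add)

lemma invariants_diff: "f \<in> invariants G \<Longrightarrow> h \<in> invariants G \<Longrightarrow> f - h \<in> invariants G"
  by (simp add: invariants_def polynomials_diff act_diff)

lemma invariants_mult: "f \<in> invariants G \<Longrightarrow> h \<in> invariants G \<Longrightarrow> f * h \<in> invariants G"
  by (simp add: invariants_def polynomials_mult act_mult)

lemma invariants_sum: "(\<And>x. x \<in> X \<Longrightarrow> f x \<in> invariants G) \<Longrightarrow> (\<Sum>x\<in>X. f x) \<in> invariants G"
  by (simp add: invariants_def polynomials_sum act_sum)

lemma invariants_hcomp: "f \<in> invariants G \<Longrightarrow> hcomp k f \<in> invariants G"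
  by (simp add: invariants_def poly_hcomp flip: hcomp_act)

definition invariants_pos :: "('n cvec \<Rightarrow> complex) set" where
  "invariants_pos = {f \<in> invariants G. f 0 = 0}"

definition hilbert_ideal :: "('n cvec \<Rightarrow> complex) set" where
  "hilbert_ideal = lincomb (*) invariants_pos polynomials"

definition inv_ideal :: "('n cvec \<Rightarrow> complex) set \<Rightarrow> bool" where
  "inv_ideal A \<longleftrightarrow> A \<subseteq> invariants G \<and> 0 \<in> A \<and> (\<forall>x\<in>A. \<forall>y\<in>A. x + y \<in> A)
     \<and> (\<forall>r\<in>invariants G. \<forall>x\<in>A. r * x \<in> A)"

lemma lincomb_poly:
  assumes "x \<in> lincomb (*) A polynomials" "A \<subseteq> polynomials"
  shows "x \<in> polynomials"
  by (rule lincomb_closed[OF assms(1), where h = "\<lambda>x. x"])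
    (use assms(2) in \<open>auto intro: polynomials_add polynomials_mult\<close>)

lemma lincomb_poly_mult:
  assumes "x \<in> lincomb (*) A polynomials" "h \<in> polynomials"
  shows "h * x \<in> lincomb (*) A polynomials"
  by (rule lincomb_map[OF assms(1), where h = "\<lambda>x. h * x"])
    (auto simp: distrib_left mult.left_commute[of h] intro!: lincomb_single polynomials_mult assms)

lemma hilbert_ideal_act: "x \<in> hilbert_ideal \<Longrightarrow> g \<in> G \<Longrightarrow> act g x \<in> hilbert_ideal"
  unfolding hilbert_ideal_def
  by (rule lincomb_map[where h = "act g" and m = "(*)"])
    (auto simp: act_add act_mult invariants_pos_def invariants_def intro!: lincomb_single polynomials_act)

text \<open>Extending an ideal of invariants to all polynomials adds no new invariants:
  \<open>reynolds\<close> is linear over the invariants, so it carries each term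
  \<open>a * b\<close> to a times an invariant.\<close>

lemma reynolds_lincomb:
  assumes "inv_ideal A" "x \<in> lincomb (*) A polynomials"
  shows "reynolds x \<in> A"
  using assms(1)
  by (intro lincomb_closed[OF assms(2), where h = reynolds])
    (auto simp: reynolds_add inv_ideal_def reynolds_mult subset_iff mult.commute[of _ "reynolds _"]
      intro: reynolds_invariant)

text \<open>Take h to be 1 at v and 0 at the rest of its orbit. The average of \<open>h * c\<close>
  at v is then \<open>c v\<close> times the proportion of the stabilizer of v in G.\<close>

lemma reynolds_nondegenerate:
  assumes "c \<in> polynomials" "\<And>h. h \<in> polynomials \<Longrightarrow> reynolds (h * c) = 0"
  shows "c = 0"
proof
  fix v
  let ?S = "{g \<in> G. matrix_inv g *v v = v}"
  have "finite ((\<lambda>g. matrix_inv g *v v) ` G - {v})" using finite_G by simp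
  then obtain h where h: "h \<in> polynomials" "h v = 1"
    "\<And>w. w \<in> (\<lambda>g. matrix_inv g *v v) ` G - {v} \<Longrightarrow> h w = 0"
    by (rule separating_polynomial) auto
  have "(\<Sum>g\<in>G. act g (h * c) v) = (\<Sum>g\<in>G. if g \<in> ?S then c v else 0)"
    by (rule sum.cong) (use h in \<open>auto simp: act_def\<close>)
  also have "\<dots> = of_nat (card ?S) * c v"
    using finite_G by (simp add: sum.If_cases Int_def)
  finally have "of_nat (card ?S) * c v = of_nat (card G) * reynolds (h * c) v"
    using card_G by (simp add: reynolds_def sum_fun_apply)
  also have "\<dots> = 0" using assms(2)[OF h(1)] by simp
  finally have "of_nat (card ?S) * c v = 0" .
  moreover have "card ?S \<noteq> 0" using finite_G G_one by (auto simp: card_eq_0_iff)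
  ultimately show "c v = 0 v" by simp
qed

end

section \<open>Divided differences along reflections\<close>

locale reflection_setup = finite_unitary_group G \<theta>
  for G :: "('n::{finite,linorder} cmat) set" and \<theta> +
  fixes \<alpha> :: "('n cvec) set \<Rightarrow> 'n cvec \<Rightarrow> complex"
  assumes generated: "\<exists>T. (\<forall>t\<in>T. reflection t) \<and> G = generate unitary_group T"
    and \<alpha>_kernel: "\<And>H. H \<in> reflecting_hyperplanes G \<Longrightarrow> linear_form_with_kernel (\<alpha> H) H"
begin

abbreviation arrangement :: "'n cvec set set" where
  "arrangement \<equiv> reflecting_hyperplanes G"

lemma \<alpha>_linear: "H \<in> arrangement \<Longrightarrow> linear_form (\<alpha> H)"
  and \<alpha>_zero_iff: "H \<in> arrangement \<Longrightarrow> \<alpha> H v = 0 \<longleftrightarrow> v \<in> H"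
  using \<alpha>_kernel[of H] by (auto simp: linear_form_with_kernel_def)

lemma \<alpha>_nonzero: assumes "H \<in> arrangement" shows "\<alpha> H \<noteq> 0"
proof
  assume "\<alpha> H = 0"
  then have "H = UNIV" using \<alpha>_zero_iff[OF assms] by auto
  then have "vec.dim H = CARD('n)" by (simp only: vec_dim_card)
  moreover have "hyperplane H" using assms by (simp add: reflecting_hyperplanes_def)
  ultimately show False by (simp add: hyperplane_def)
qed

lemma \<alpha>_poly: "H \<in> arrangement \<Longrightarrow> \<alpha> H \<in> polynomials"
  by (rule polynomials_linear_form[OF \<alpha>_linear])

lemma reflection_hyperplane:
  assumes "t \<in> G" "reflection t"
  obtains H where "H \<in> arrangement" "\<And>v. v \<in> H \<Longrightarrow> t *v v = v"
  using assms unfolding reflection_def reflecting_hyperplanes_def by blast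

lemma G_induct [consumes 1, case_names one refl inv mult]:
  assumes "g \<in> G" and one: "P (mat 1)"
    and refl: "\<And>t. t \<in> G \<Longrightarrow> reflection t \<Longrightarrow> P t"
    and inv: "\<And>t. t \<in> G \<Longrightarrow> reflection t \<Longrightarrow> P (matrix_inv t)"
    and mult: "\<And>g h. g \<in> G \<Longrightarrow> h \<in> G \<Longrightarrow> P g \<Longrightarrow> P h \<Longrightarrow> P (g ** h)"
  shows "P g"
proof -
  obtain T where T: "\<forall>t\<in>T. reflection t" "G = generate unitary_group T" using generated by blast
  have T_G: "t \<in> G" if "t \<in> T" for t using that T(2) by (auto intro: generate.incl)
  have "g \<in> generate unitary_group T" using assms(1) T(2) by simp
  then have "P g \<and> g \<in> G"
  proof (induction rule: generate.induct)
    case one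
    then show ?case using assms(2) G_one by (simp add: unitary_group_simps)
  next
    case (incl t)
    then show ?case using assms(3) T T_G by blast
  next
    case (inv t)
    then show ?case using assms(4) T T_G G_inv by (simp add: unitary_group_inv G_unitary)
  next
    case (eng g h)
    then show ?case using assms(5) G_mult by (simp add: unitary_group_simps)
  qed
  then show ?thesis by blast
qed

lemma matrix_inv_fixes:
  assumes "g \<in> G" "g *v v = v" shows "matrix_inv g *v v = v"
  using matrix_inv_mult_vec[OF G_mult_inv(2)[OF assms(1)], of v] assms(2) by simp

text \<open>An element fixing H pointwise does not change f on H. The quotient h is the divided
  difference of f; it is linear over the invariants and lowers the degree of a homogeneous f by
  one.\<close>

lemma demazure:
  assumes H: "H \<in> arrangement" and t: "t \<in> G" "\<And>v. v \<in> H \<Longrightarrow> t *v v = v" and f: "f \<in> polynomials"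
  obtains h where "h \<in> polynomials" "f - act t f = \<alpha> H * h"
proof (rule vanishing_divisible[OF \<alpha>_linear[OF H] \<alpha>_nonzero[OF H]])
  show "f - act t f \<in> polynomials" using f by (intro polynomials_diff polynomials_act)
  show "(f - act t f) v = 0" if "\<alpha> H v = 0" for v
    using that t matrix_inv_fixes[of t v] \<alpha>_zero_iff[OF H] by (simp add: act_def)
qed

lemma demazure_ideal:
  assumes H: "H \<in> arrangement" and t: "t \<in> G" "\<And>v. v \<in> H \<Longrightarrow> t *v v = v" and A: "A \<subseteq> invariants G"
    and x: "x \<in> lincomb (*) A polynomials"
  shows "x - act t x \<in> (\<lambda>y. \<alpha> H * y) ` lincomb (*) A polynomials"
proof (rule lincomb_closed[OF x, where h = "\<lambda>x. x - act t x"])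
  have "\<alpha> H * 0 = 0" by simp
  then show "0 \<in> (\<lambda>y. \<alpha> H * y) ` lincomb (*) A polynomials" using lincomb.zero by (metis imageI)
next
  fix y z assume "y \<in> (\<lambda>y. \<alpha> H * y) ` lincomb (*) A polynomials" "z \<in> (\<lambda>y. \<alpha> H * y) ` lincomb (*) A polynomials"
  then show "y + z \<in> (\<lambda>y. \<alpha> H * y) ` lincomb (*) A polynomials"
    by (auto simp: distrib_left[symmetric] intro: lincomb_add)
next
  fix a and b :: "'n cvec \<Rightarrow> complex" assume ab: "a \<in> A" "b \<in> polynomials"
  obtain h where h: "h \<in> polynomials" "b - act t b = \<alpha> H * h" by (rule demazure[OF H t ab(2)])
  have "a * b - act t (a * b) = a * (b - act t b)"
    using ab A t by (auto simp: act_mult right_diff_distrib invariants_def)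
  also have "\<dots> = \<alpha> H * (a * h)" by (simp add: h(2) mult.left_commute)
  finally show "a * b - act t (a * b) \<in> (\<lambda>y. \<alpha> H * y) ` lincomb (*) A polynomials"
    using lincomb_single[OF ab(1) h(1), of "(*)"] by simp
qed (simp_all add: act_add)

text \<open>Divided differences of u satisfy the same hypothesis in lower degree, because r is
  invariant. Hence u agrees with all its translates, and so with its average, modulo
  \<open>hilbert_ideal\<close>; in positive degree that average is an invariant without constant
  term. In degree zero a nonzero u would put r into the extended ideal, and averaging would put r
  into A.\<close>

lemma chevalley_homogeneous:
  assumes A: "inv_ideal A" and r: "r \<in> invariants G" "r \<notin> A"
  shows "homogeneous d u \<Longrightarrow> r * u \<in> lincomb (*) A polynomials \<Longrightarrow> u \<in> hilbert_ideal"
proof (induction d arbitrary: u)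
  case (0 u)
  have "u v = u 0" for v
    using 0(1) by (simp add: homogeneous_def) (metis mult_1 vector_ssub_ldistrib vector_smult_lzero)
  then have u: "u = (\<lambda>v. u 0)" by blast
  show ?case
  proof (cases "u 0 = 0")
    case True
    then have "u = 0" using u by (simp add: zero_fun_def)
    then show ?thesis using lincomb.zero by (metis hilbert_ideal_def)
  next
    case False
    have "(\<lambda>v. 1 / u 0) * (r * u) = r" using False by (subst u) (simp add: fun_eq_iff)
    then have "r \<in> lincomb (*) A polynomials"
      using lincomb_poly_mult[OF 0(2) polynomials.const[of "1 / u 0"]] by metis
    from reynolds_lincomb[OF A this] r show ?thesis by (simp add: reynolds_fixed)
  qed
next
  case (Suc d u)
  have u: "u \<in> polynomials" by (rule homogeneous_poly[OF Suc.prems(1)])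
  have A': "A \<subseteq> invariants G" using A by (simp add: inv_ideal_def)
  have reflI: "u - act t u \<in> hilbert_ideal"
    if t: "t \<in> G" "\<And>v. v \<in> H \<Longrightarrow> t *v v = v" and H: "H \<in> arrangement" for t H
  proof -
    obtain h where h: "h \<in> polynomials" "u - act t u = \<alpha> H * h" by (rule demazure[OF H t u])
    have "r * u - act t (r * u) = r * (u - act t u)"
      using r t by (simp add: act_mult right_diff_distrib invariants_def)
    also have "\<dots> = \<alpha> H * (r * h)" by (simp add: h(2) mult.left_commute)
    finally have "r * u - act t (r * u) = \<alpha> H * (r * h)" .
    moreover have "r * u \<in> lincomb (*) A polynomials" by (rule Suc.prems(2))
    ultimately have "\<alpha> H * (r * h) \<in> (\<lambda>y. \<alpha> H * y) ` lincomb (*) A polynomials"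
      using demazure_ideal[OF H t A'] by metis
    then obtain y where y: "y \<in> lincomb (*) A polynomials" "\<alpha> H * (r * h) = \<alpha> H * y" by blast
    have "y \<in> polynomials" using lincomb_poly[OF y(1)] A' invariants_poly by blast
    then have "r * h = y"
      using poly_cancel_left[OF \<alpha>_poly[OF H] _ _ \<alpha>_nonzero[OF H] y(2)] r(1) h(1)
      by (simp add: polynomials_mult invariants_poly)
    moreover have "homogeneous (Suc d) (\<alpha> H * h)"
      using Suc.prems(1) polynomials_diff[OF u polynomials_act[OF u]]
      unfolding h(2)[symmetric] homogeneous_def
      by (simp add: act_def right_diff_distrib vector_scalar_commute)
    then have "homogeneous d h"
      by (rule homogeneous_cofactor[OF \<alpha>_linear[OF H] \<alpha>_nonzero[OF H] h(1)])
    ultimately have "h \<in> hilbert_ideal" using Suc.IH y(1) by blast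
    then show ?thesis unfolding h(2) hilbert_ideal_def by (rule lincomb_poly_mult[OF _ \<alpha>_poly[OF H]])
  qed
  have all: "u - act g u \<in> hilbert_ideal" if "g \<in> G" for g
    using that
  proof (induction rule: G_induct)
    case one
    have "u - act (mat 1) u = 0" by (simp add: act_mat_one)
    then show ?case using lincomb.zero by (metis hilbert_ideal_def)
  next
    case (refl t)
    then obtain H where "H \<in> arrangement" "\<And>v. v \<in> H \<Longrightarrow> t *v v = v" by (rule reflection_hyperplane) blast
    then show ?case using reflI[OF \<open>t \<in> G\<close>] by blast
  next
    case (inv t)
    then obtain H where "H \<in> arrangement" "\<And>v. v \<in> H \<Longrightarrow> t *v v = v" by (rule reflection_hyperplane) blast
    then show ?case using reflI[OF G_inv[OF \<open>t \<in> G\<close>]] matrix_inv_fixes[OF \<open>t \<in> G\<close>] by blast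
  next
    case (mult g h)
    have "u - act (g ** h) u = (u - act g u) + act g (u - act h u)"
      using mult by (simp add: act_diff act_compose G_unitary)
    moreover have "u - act g u \<in> hilbert_ideal" by (rule mult.IH(1))
    moreover have "act g (u - act h u) \<in> hilbert_ideal" by (rule hilbert_ideal_act[OF mult.IH(2) mult.hyps(1)])
    then have "(u - act g u) + act g (u - act h u) \<in> hilbert_ideal"
      using calculation(2) unfolding hilbert_ideal_def by (intro lincomb_add)
    ultimately show ?case by (simp only:)
  qed
  have "u - reynolds u = (\<lambda>v. 1 / of_nat (card G)) * (\<Sum>g\<in>G. u - act g u)"
    using card_G by (simp add: reynolds_def fun_eq_iff sum_fun_apply sum_subtractf right_diff_distrib)
  also have "\<dots> \<in> hilbert_ideal"
    using all unfolding hilbert_ideal_def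
    by (intro lincomb_poly_mult lincomb_sum polynomials.const)
  finally have 1: "u - reynolds u \<in> hilbert_ideal" .
  have "u 0 = 0" using Suc.prems(1) unfolding homogeneous_def by (metis mult_zero_left power_0_Suc vector_smult_lzero)
  then have "reynolds u 0 = 0" by (simp add: reynolds_def sum_fun_apply act_def)
  then have "reynolds u \<in> invariants_pos" using reynolds_invariant[OF u] by (simp add: invariants_pos_def)
  then have "reynolds u * 1 \<in> hilbert_ideal"
    unfolding hilbert_ideal_def by (intro lincomb_single polynomials_one)
  with 1 have "(u - reynolds u) + reynolds u * 1 \<in> hilbert_ideal"
    unfolding hilbert_ideal_def by (rule lincomb_add)
  then show ?case by simp
qed

text \<open>A is stable under taking components and r is homogeneous, so the hypothesis passes to
  each component of u.\<close>

lemma chevalley: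
  assumes A: "inv_ideal A" "\<And>a k. a \<in> A \<Longrightarrow> hcomp k a \<in> A"
    and r: "r \<in> invariants G" "r \<notin> A" "homogeneous e r"
    and u: "u \<in> polynomials" "r * u \<in> lincomb (*) A polynomials"
  shows "u \<in> hilbert_ideal"
proof -
  have A': "a \<in> polynomials" if "a \<in> A" for a using that A(1) invariants_poly by (auto simp: inv_ideal_def)
  have ideal: "x \<in> polynomials \<and> hcomp k x \<in> lincomb (*) A polynomials"
    if "x \<in> lincomb (*) A polynomials" for x k
    using that
  proof induction
    case zero
    have "0 \<in> polynomials \<and> hcomp k 0 \<in> lincomb (*) A polynomials" using lincomb.zero by simp
    then show ?case .
  next
    case (step a b x)
    have "hcomp k (a * b) \<in> lincomb (*) A polynomials"
      unfolding hcomp_mult[OF A'[OF step(1)] step(2)]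
      using A(2) step by (intro lincomb_sum lincomb_single poly_hcomp) auto
    moreover have IH: "x \<in> polynomials \<and> hcomp k x \<in> lincomb (*) A polynomials" by (rule step.IH)
    moreover have "a * b \<in> polynomials" using A' step by (intro polynomials_mult) auto
    ultimately have "a * b + x \<in> polynomials \<and> hcomp k (a * b + x) \<in> lincomb (*) A polynomials"
      using IH by (simp add: polynomials_add hcomp_add lincomb_add)
    then show ?case .
  qed
  have "hcomp k u \<in> hilbert_ideal" for k
  proof -
    have "r * hcomp k u = hcomp (k + e) (r * u)" by (simp add: hcomp_mult_homogeneous[OF r(3) u(1)])
    then have "r * hcomp k u \<in> lincomb (*) A polynomials" using ideal[OF u(2)] by metis
    then show ?thesis by (rule chevalley_homogeneous[OF A(1) r(1,2) homogeneous_hcomp[OF u(1)]])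
  qed
  then have "(\<Sum>k\<le>N. hcomp k u) \<in> hilbert_ideal" for N
    unfolding hilbert_ideal_def by (intro lincomb_sum)
  moreover obtain N where "\<forall>k>N. hcomp k u = 0" using hcomp_bound[OF u(1)] by blast
  ultimately show ?thesis using hcomp_sum_bound[OF u(1)] by metis
qed

end

section \<open>Generators of the module of semi-invariant 1-forms\<close>

context finite_unitary_group
begin

abbreviation chi_one_forms :: "'n form set" where
  "chi_one_forms \<equiv> chi_forms G \<theta> 1"

definition decomposable :: "'n form set" where
  "decomposable = lincomb scale invariants_pos chi_one_forms"

definition homogeneous_form :: "nat \<Rightarrow> 'n form \<Rightarrow> bool" where
  "homogeneous_form d \<omega> \<longleftrightarrow> (\<forall>I. homogeneous d (\<omega> I))"

text \<open>Homogeneous forms whose classes modulo \<open>decomposable\<close> are linearly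
  independent over the complex numbers. As in the graded form of Nakayama's lemma, a maximal such
  family will generate.\<close>

definition irredundant :: "'n form set \<Rightarrow> bool" where
  "irredundant B \<longleftrightarrow> finite B \<and> B \<subseteq> chi_one_forms \<and> (\<forall>b\<in>B. \<exists>d. homogeneous_form d b)
     \<and> (\<forall>c::'n form \<Rightarrow> complex. (\<Sum>b\<in>B. scale (\<lambda>v. c b) b) \<in> decomposable \<longrightarrow> (\<forall>b\<in>B. c b = 0))"

lemma chi_one_formD: "\<omega> \<in> chi_one_forms \<Longrightarrow> chi_invariant \<omega>" "\<omega> \<in> chi_one_forms \<Longrightarrow> card I \<noteq> 1 \<Longrightarrow> \<omega> I = 0"
  by (auto simp: chi_forms_iff)

lemma chi_invariant_poly: "chi_invariant \<omega> \<Longrightarrow> poly_form \<omega>"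
  by (simp add: chi_invariant_def)

lemma chi_forms_zero [simp]: "0 \<in> chi_forms G \<theta> p"
  by (simp add: chi_forms_iff)

lemma chi_forms_scale: "r \<in> invariants G \<Longrightarrow> \<omega> \<in> chi_forms G \<theta> p \<Longrightarrow> scale r \<omega> \<in> chi_forms G \<theta> p"
  by (simp add: chi_forms_iff chi_invariant_scale)

lemma chi_forms_sum: "(\<And>x. x \<in> X \<Longrightarrow> w x \<in> chi_forms G \<theta> p) \<Longrightarrow> (\<Sum>x\<in>X. w x) \<in> chi_forms G \<theta> p"
  by (simp add: chi_forms_iff chi_invariant_sum sum_fun_apply)

lemma chi_invariant_comp: "chi_invariant \<omega> \<Longrightarrow> chi_invariant (form_comp k \<omega>)"
proof -
  assume \<omega>: "chi_invariant \<omega>"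
  have "act_form g (form_comp k \<omega>) = scale (\<lambda>v. \<theta> g) (form_comp k \<omega>)" if "g \<in> G" for g
  proof -
    have "act_form g (form_comp k \<omega>) = form_comp k (scale (\<lambda>v. \<theta> g) \<omega>)"
      using form_comp_act[OF chi_invariant_poly[OF \<omega>], of k g] \<omega> that by (simp add: chi_invariant_def)
    also have "\<dots> = scale (\<lambda>v. \<theta> g) (form_comp k \<omega>)"
      using chi_invariant_poly[OF \<omega>] unfolding form_comp_def poly_form_def
      by (intro ext) (simp add: hcomp_mult_homogeneous[OF homogeneous_const])
    finally show ?thesis .
  qed
  then show ?thesis using \<omega> by (simp add: chi_invariant_def poly_form_comp)
qed

lemma chi_forms_comp: "\<omega> \<in> chi_forms G \<theta> p \<Longrightarrow> form_comp k \<omega> \<in> chi_forms G \<theta> p"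
  by (simp add: chi_forms_iff chi_invariant_comp) (simp add: form_comp_def)

lemma homogeneous_form_comp: "poly_form \<omega> \<Longrightarrow> homogeneous_form k (form_comp k \<omega>)"
  by (simp add: homogeneous_form_def form_comp_def poly_form_def homogeneous_hcomp)

lemma form_comp_of_homogeneous: "homogeneous_form d \<omega> \<Longrightarrow> form_comp k \<omega> = (if k = d then \<omega> else 0)"
  by (cases "k = d") (simp_all add: form_comp_def homogeneous_form_def hcomp_of_homogeneous[of d] fun_eq_iff)

text \<open>w is its own average. A coefficient in \<open>hilbert_ideal\<close> is a sum of terms
  \<open>a * b\<close> with a an invariant of constant term 0; averaging leaves a outside and turns
  b times a basis covector into a semi-invariant 1-form.\<close>

lemma chi_average_ideal_form:
  assumes w: "w \<in> chi_one_forms" and J: "\<And>I. w I \<in> hilbert_ideal"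
  shows "w \<in> decomposable"
proof -
  have "chi_average (scale (w I) (ext_basis I)) \<in> decomposable" if "card I = 1" for I
    unfolding decomposable_def
  proof (rule lincomb_map[OF J[unfolded hilbert_ideal_def], where h = "\<lambda>x. chi_average (scale x (ext_basis I))"])
    fix a b :: "'n cvec \<Rightarrow> complex" assume ab: "a \<in> invariants_pos" "b \<in> polynomials"
    let ?e = "scale b (ext_basis I)"
    have "chi_average ?e \<in> chi_one_forms"
      unfolding chi_forms_iff
    proof (intro conjI allI impI)
      show "chi_invariant (chi_average ?e)"
        by (intro chi_average_invariant poly_form_scale poly_form_basis ab)
      show "chi_average ?e K = 0" if "card K \<noteq> 1" for K
        by (rule chi_average_card[OF _ that]) (use \<open>card I = 1\<close> in \<open>auto simp: ext_basis_def\<close>)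
    qed
    then show "chi_average (scale (a * b) (ext_basis I)) \<in> lincomb scale invariants_pos chi_one_forms"
      using chi_average_scale[of a ?e] ab lincomb_single[of a invariants_pos _ chi_one_forms scale]
      by (simp add: scale_scale invariants_pos_def)
  qed (simp_all add: scale_add_left chi_average_add)
  then have 1: "chi_average (scale (w I) (ext_basis I)) \<in> decomposable" for I
  proof (cases "card I = 1")
    case False
    then have "scale (w I) (ext_basis I) = 0" using chi_one_formD(2)[OF w] by simp
    then show ?thesis using lincomb.zero by (simp add: decomposable_def)
  qed
  have "w = chi_average w" by (rule chi_average_fixed[OF chi_one_formD(1)[OF w], symmetric])
  also have "\<dots> = chi_average (\<Sum>I\<in>UNIV. scale (w I) (ext_basis I))"
    using ext_basis_expand[of w] by simp
  also have "\<dots> = (\<Sum>I\<in>UNIV. chi_average (scale (w I) (ext_basis I)))"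
    using sum_comp_morphism[of chi_average "\<lambda>I. scale (w I) (ext_basis I)" UNIV]
    by (simp only: chi_average_add chi_average_zero o_def)
  also have "\<dots> \<in> decomposable" using 1 unfolding decomposable_def by (intro lincomb_sum)
  finally show ?thesis .
qed

section \<open>Finitely generated ideals of invariants\<close>

definition gen_ideal :: "('i \<Rightarrow> 'n cvec \<Rightarrow> complex) \<Rightarrow> 'i set \<Rightarrow> ('n cvec \<Rightarrow> complex) set" where
  "gen_ideal r K = {\<Sum>i\<in>K. c i * r i | c. \<forall>i. c i \<in> invariants G}"

lemma gen_idealI: "(\<And>i. c i \<in> invariants G) \<Longrightarrow> (\<Sum>i\<in>K. c i * r i) \<in> gen_ideal r K"
  by (auto simp: gen_ideal_def)

lemma inv_ideal_gen:
  assumes "\<And>i. i \<in> K \<Longrightarrow> r i \<in> invariants G"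
  shows "inv_ideal (gen_ideal r K)"
  unfolding inv_ideal_def
proof (intro conjI ballI)
  show "gen_ideal r K \<subseteq> invariants G"
    using assms by (auto simp: gen_ideal_def intro!: invariants_sum invariants_mult)
  show "0 \<in> gen_ideal r K" using gen_idealI[of "\<lambda>_. 0" r K] by simp
next
  fix x y assume "x \<in> gen_ideal r K" "y \<in> gen_ideal r K"
  then obtain c d where cd: "\<And>i. c i \<in> invariants G" "\<And>i. d i \<in> invariants G"
    "x = (\<Sum>i\<in>K. c i * r i)" "y = (\<Sum>i\<in>K. d i * r i)" unfolding gen_ideal_def by blast
  have "x + y = (\<Sum>i\<in>K. (c i + d i) * r i)" by (simp add: cd(3,4) sum.distrib distrib_right)
  also have "\<dots> \<in> gen_ideal r K" by (intro gen_idealI invariants_add cd(1,2))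
  finally show "x + y \<in> gen_ideal r K" .
next
  fix f x assume f: "f \<in> invariants G" and "x \<in> gen_ideal r K"
  then obtain c where c: "\<And>i. c i \<in> invariants G" "x = (\<Sum>i\<in>K. c i * r i)"
    unfolding gen_ideal_def by blast
  have "f * x = (\<Sum>i\<in>K. (f * c i) * r i)" by (simp add: c(2) sum_distrib_left mult.assoc)
  also have "\<dots> \<in> gen_ideal r K" by (intro gen_idealI invariants_mult c(1) f)
  finally show "f * x \<in> gen_ideal r K" .
qed

lemma gen_ideal_hcomp:
  assumes r: "\<And>i. i \<in> K \<Longrightarrow> r i \<in> invariants G" "\<And>i. i \<in> K \<Longrightarrow> homogeneous (e i) (r i)"
    and x: "x \<in> gen_ideal r K"
  shows "hcomp k x \<in> gen_ideal r K"
proof -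
  obtain c where c: "\<And>i. c i \<in> invariants G" "x = (\<Sum>i\<in>K. c i * r i)"
    using x unfolding gen_ideal_def by blast
  have pol: "c i * r i \<in> polynomials" if "i \<in> K" for i
    by (intro polynomials_mult invariants_poly r(1) c(1) that)
  have "hcomp k x = (\<Sum>i\<in>K. hcomp k (r i * c i))"
    unfolding c(2) using pol by (subst hcomp_sum) (simp_all add: mult.commute)
  also have "\<dots> = (\<Sum>i\<in>K. (if k < e i then 0 else hcomp (k - e i) (c i)) * r i)"
  proof (rule sum.cong[OF HOL.refl])
    fix i assume i: "i \<in> K"
    show "hcomp k (r i * c i) = (if k < e i then 0 else hcomp (k - e i) (c i)) * r i"
      by (simp only: hcomp_mult_homogeneous[OF r(2)[OF i] invariants_poly[OF c(1)]]) (simp add: mult.commute)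
  qed
  also have "\<dots> \<in> gen_ideal r K" by (rule gen_idealI) (auto intro: invariants_hcomp c)
  finally show ?thesis .
qed

lemma gen_ideal_base:
  assumes "finite K" "i \<in> K" shows "r i \<in> gen_ideal r K"
proof -
  have "(\<Sum>j\<in>K. (if j = i then 1 else 0) * r j) = r i"
    using assms by (simp add: if_distrib[of "\<lambda>x. x * _"] sum.delta cong: if_cong)
  then show ?thesis using gen_idealI[of "\<lambda>j. if j = i then 1 else 0" r K] by simp
qed

lemma minimal_generator:
  assumes B: "finite B" and r: "\<And>b. b \<in> B \<Longrightarrow> r b \<in> invariants G" and nz: "b0 \<in> B" "r b0 \<noteq> 0"
  obtains K b1 where "K \<subseteq> B" "b1 \<in> K" "r b1 \<notin> gen_ideal r (K - {b1})" "\<And>b. b \<in> B \<Longrightarrow> r b \<in> gen_ideal r K"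
proof -
  let ?P = "\<lambda>K. K \<subseteq> B \<and> (\<forall>b\<in>B. r b \<in> gen_ideal r K)"
  have "?P B" using gen_ideal_base[OF B] by blast
  then obtain K where K: "?P K" "\<And>K'. ?P K' \<Longrightarrow> card K \<le> card K'"
    using ex_has_least_nat[of ?P B card] by blast
  have fin: "finite K" using K(1) B finite_subset by blast
  have "K \<noteq> {}"
  proof
    assume "K = {}"
    then have "r b0 \<in> {0}" using K(1) nz(1) by (auto simp: gen_ideal_def)
    with nz(2) show False by simp
  qed
  then obtain b1 where b1: "b1 \<in> K" by blast
  have "r b1 \<notin> gen_ideal r (K - {b1})"
  proof
    assume mem: "r b1 \<in> gen_ideal r (K - {b1})"
    have ideal: "inv_ideal (gen_ideal r (K - {b1}))" by (rule inv_ideal_gen) (use r K(1) in blast)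
    have "r b \<in> gen_ideal r (K - {b1})" if "b \<in> B" for b
    proof -
      have "r b \<in> gen_ideal r K" using K(1) that by blast
      then obtain c where c: "\<And>i. c i \<in> invariants G" "r b = (\<Sum>i\<in>K. c i * r i)"
        unfolding gen_ideal_def by blast
      have "r b = c b1 * r b1 + (\<Sum>i\<in>K - {b1}. c i * r i)"
        unfolding c(2) by (rule sum.remove[OF fin b1])
      moreover have "c b1 * r b1 \<in> gen_ideal r (K - {b1})" using ideal mem c(1) by (simp add: inv_ideal_def)
      moreover have "(\<Sum>i\<in>K - {b1}. c i * r i) \<in> gen_ideal r (K - {b1})" by (intro gen_idealI c(1))
      ultimately show ?thesis using ideal by (simp add: inv_ideal_def)
    qed
    then have "card K \<le> card (K - {b1})" using K by blast
    with b1 fin show False by (metis card_Diff1_less not_le)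
  qed
  with that b1 K(1) show ?thesis by blast
qed

end

section \<open>Independence and number of the generators\<close>

context reflection_setup
begin

text \<open>Modulo an ideal A generated by some of the coefficients, every coefficient is a multiple
  \<open>C b\<close> of a single \<open>r' b1\<close> outside A. Up to A the relation then says that
  \<open>r' b1\<close> annihilates w, the sum of the forms b with coefficients \<open>C b\<close>;
  \<open>chevalley\<close> puts the coefficients of w into \<open>hilbert_ideal\<close>, so w is
  decomposable. Modulo \<open>decomposable\<close> only the constant terms of the \<open>C b\<close>
  matter, and that of b1 is 1.\<close>

lemma irredundant_independent:
  assumes B: "irredundant B" and r: "\<And>b. b \<in> B \<Longrightarrow> r b \<in> invariants G"
    and rel: "(\<Sum>b\<in>B. scale (r b) b) = 0" and b0: "b0 \<in> B"
  shows "r b0 = 0"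
proof (rule ccontr)
  assume nz: "r b0 \<noteq> 0"
  have finB: "finite B" and BM: "\<And>b. b \<in> B \<Longrightarrow> b \<in> chi_one_forms"
    and irr: "\<And>c::'n form \<Rightarrow> complex. (\<Sum>b\<in>B. scale (\<lambda>v. c b) b) \<in> decomposable \<Longrightarrow> \<forall>b\<in>B. c b = 0"
    using B by (auto simp: irredundant_def)
  obtain dg where dg: "\<And>b. b \<in> B \<Longrightarrow> homogeneous_form (dg b) b"
    using B unfolding irredundant_def by metis
  obtain k0 where k0: "hcomp k0 (r b0) \<noteq> 0"
    using hcomp_eqI[OF invariants_poly[OF r[OF b0]] polynomials_zero] nz by auto
  \<comment> \<open>The relation is cut down to its part of total degree e, chosen so that b0 keeps
    a nonzero coefficient. Terms whose form has degree above e drop out, hence the value 0 in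
    \<open>r'\<close>.\<close>
  define e where "e = k0 + dg b0"
  define r' where "r' b = (if dg b \<le> e then hcomp (e - dg b) (r b) else 0)" for b
  have r'R: "r' b \<in> invariants G" if "b \<in> B" for b
    using r[OF that] by (simp add: r'_def invariants_hcomp)
  have r'hom: "homogeneous (e - dg b) (r' b)" if "b \<in> B" for b
    using r[OF that] by (simp add: r'_def homogeneous_hcomp invariants_poly)
  have r'nz: "r' b0 \<noteq> 0" using k0 by (simp add: r'_def e_def)
  have rel': "(\<Sum>b\<in>B. r' b * b I) = 0" for I
  proof -
    have pol: "b I * r b \<in> polynomials" "r b \<in> polynomials" if "b \<in> B" for b
      using dg[OF that] r[OF that] homogeneous_poly invariants_poly
      by (auto simp: homogeneous_form_def intro!: polynomials_mult)
    have "(\<Sum>b\<in>B. b I * r b) = 0"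
      using fun_cong[OF rel, of I] by (simp add: sum_fun_apply mult.commute)
    then have "hcomp e (\<Sum>b\<in>B. b I * r b) = 0" by simp
    then have "(\<Sum>b\<in>B. hcomp e (b I * r b)) = 0" using pol by (simp add: hcomp_sum)
    moreover have "hcomp e (b I * r b) = r' b * b I" if "b \<in> B" for b
      using hcomp_mult_homogeneous[of "dg b" "b I" "r b" e] dg[OF that] pol[OF that]
      by (simp add: r'_def homogeneous_form_def mult.commute)
    ultimately show ?thesis by simp
  qed
  obtain K b1 where K: "K \<subseteq> B" "b1 \<in> K" "r' b1 \<notin> gen_ideal r' (K - {b1})"
    "\<And>b. b \<in> B \<Longrightarrow> r' b \<in> gen_ideal r' K"
    by (rule minimal_generator[where B = B and r = r', OF finB r'R b0 r'nz], assumption) (rule that)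
  let ?A = "gen_ideal r' (K - {b1})"
  have finK: "finite K" using K(1) finB finite_subset by blast
  have A: "inv_ideal ?A" by (rule inv_ideal_gen) (use r'R K(1) in blast)
  have Ahom: "hcomp k a \<in> ?A" if "a \<in> ?A" for a k
    by (rule gen_ideal_hcomp[OF _ _ that, where e = "\<lambda>b. e - dg b"]) (use r'R r'hom K(1) in blast)+
  have b1B: "b1 \<in> B" using K by blast
  have "\<exists>C\<in>invariants G. C * r' b1 - r' b \<in> ?A" if b: "b \<in> B" for b
  proof -
    obtain c where c: "\<And>i. c i \<in> invariants G" "r' b = (\<Sum>i\<in>K. c i * r' i)"
      using K(4)[OF b] unfolding gen_ideal_def by blast
    have "r' b = c b1 * r' b1 + (\<Sum>i\<in>K - {b1}. c i * r' i)"
      unfolding c(2) by (rule sum.remove[OF finK K(2)])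
    then have "c b1 * r' b1 - r' b = (\<Sum>i\<in>K - {b1}. (- 1 * c i) * r' i)"
      by (simp add: sum_negf)
    moreover have "- 1 * c i \<in> invariants G" for i
      using invariants_diff[OF invariants_zero c(1)[of i]] by simp
    then have "(\<Sum>i\<in>K - {b1}. (- 1 * c i) * r' i) \<in> ?A" by (rule gen_idealI)
    ultimately show ?thesis using c(1) by metis
  qed
  then obtain C0 where C0: "\<And>b. b \<in> B \<Longrightarrow> C0 b \<in> invariants G \<and> C0 b * r' b1 - r' b \<in> ?A" by metis
  define C where "C = C0(b1 := 1)"
  have C: "C b \<in> invariants G" "C b * r' b1 - r' b \<in> ?A" if "b \<in> B" for b
    using C0[OF that] A by (auto simp: C_def inv_ideal_def)
  define w where "w = (\<Sum>b\<in>B. scale (C b) b)"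
  have wM: "w \<in> chi_one_forms" unfolding w_def by (intro chi_forms_sum chi_forms_scale C BM)
  have "w I \<in> hilbert_ideal" for I
  proof (rule chevalley[OF A Ahom r'R[OF b1B] K(3) r'hom[OF b1B]])
    show "w I \<in> polynomials" using chi_one_formD(1)[OF wM] by (simp add: chi_invariant_def poly_form_def)
    \<comment> \<open>The subtracted sum is zero by the relation; it makes each single coefficient
      an element of A.\<close>
    have "r' b1 * w I = (\<Sum>b\<in>B. r' b1 * (C b * b I)) - (\<Sum>b\<in>B. r' b * b I)"
      by (simp add: rel' w_def sum_fun_apply sum_distrib_left)
    also have "\<dots> = (\<Sum>b\<in>B. (C b * r' b1 - r' b) * b I)"
      unfolding sum_subtractf[symmetric] by (intro sum.cong) (auto simp: algebra_simps)
    also have "\<dots> \<in> lincomb (*) ?A polynomials"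
      using dg homogeneous_poly by (intro lincomb_sum lincomb_single C) (auto simp: homogeneous_form_def)
    finally show "r' b1 * w I \<in> lincomb (*) ?A polynomials" .
  qed
  with wM have wD: "w \<in> decomposable" by (rule chi_average_ideal_form)
  \<comment> \<open>Replacing \<open>C b\<close> by its constant term changes the sum by an element
    of \<open>decomposable\<close>, and constant coefficients are what irredundancy speaks
    about.\<close>
  have "scale ((\<lambda>v. C b 0) - C b) b \<in> decomposable" if "b \<in> B" for b
  proof -
    have "(\<lambda>v. C b 0) - C b \<in> invariants G"
      by (intro invariants_diff invariants_const C(1) that)
    moreover have "((\<lambda>v. C b 0) - C b) 0 = 0" by simp
    ultimately show ?thesis
      unfolding decomposable_def by (intro lincomb_single BM[OF that]) (simp only: invariants_pos_def mem_Collect_eq simp_thms)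
  qed
  then have "(\<Sum>b\<in>B. scale ((\<lambda>v. C b 0) - C b) b) \<in> decomposable"
    unfolding decomposable_def by (intro lincomb_sum)
  with wD have "w + (\<Sum>b\<in>B. scale ((\<lambda>v. C b 0) - C b) b) \<in> decomposable"
    unfolding decomposable_def by (rule lincomb_add)
  moreover have "w + (\<Sum>b\<in>B. scale ((\<lambda>v. C b 0) - C b) b) = (\<Sum>b\<in>B. scale (\<lambda>v. C b 0) b)"
    unfolding w_def sum.distrib[symmetric] scale_add_left[symmetric] by simp
  ultimately have "\<forall>b\<in>B. C b 0 = 0" using irr[of "\<lambda>b. C b 0"] by simp
  with b1B show False by (auto simp: C_def)
qed

text \<open>More than n one-forms satisfy a relation with polynomial coefficients. Multiplied by any
  h and averaged, it becomes a relation over the invariants, which is trivial by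
  \<open>irredundant_independent\<close>; so \<open>reynolds (h * c b0) = 0\<close> for all h, which
  forces \<open>c b0 = 0\<close>.\<close>

lemma irredundant_card:
  assumes B: "irredundant B" shows "card B \<le> CARD('n)"
proof (rule ccontr)
  assume "\<not> ?thesis"
  moreover have finB: "finite B" and BM: "\<And>b. b \<in> B \<Longrightarrow> b \<in> chi_one_forms"
    using B by (auto simp: irredundant_def)
  \<comment> \<open>Set to 0 off B, because \<open>poly_vectors_dependent\<close> asks for
    polynomial entries at all indices.\<close>
  define u where "u b i = (if b \<in> B then b {i} else 0)" for b and i :: 'n
  have "u b i \<in> polynomials" for b i
    using chi_one_formD(1)[OF BM] by (simp add: u_def chi_invariant_def poly_form_def)
  ultimately obtain c where c: "\<And>b. c b \<in> polynomials" "\<exists>b\<in>B. c b \<noteq> 0"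
    "\<And>i. (\<Sum>b\<in>B. c b * u b i) = 0"
    using poly_vectors_dependent[of "UNIV :: 'n set" B u] finB by auto
  have rel: "(\<Sum>b\<in>B. scale (c b) b) = 0"
  proof
    fix I
    show "(\<Sum>b\<in>B. scale (c b) b) I = 0 I"
    proof (cases "card I = 1")
      case True
      then obtain i where I: "I = {i}" by (auto simp: card_1_singleton_iff)
      have "(\<Sum>b\<in>B. c b * b {i}) = (\<Sum>b\<in>B. c b * u b i)" by (rule sum.cong) (auto simp: u_def)
      then show ?thesis by (simp add: sum_fun_apply I c(3))
    next
      case False
      then have "(\<Sum>b\<in>B. c b * b I) = 0" using chi_one_formD(2)[OF BM] by (intro sum.neutral) auto
      then show ?thesis by (simp add: sum_fun_apply)
    qed
  qed
  obtain b0 where b0: "b0 \<in> B" "c b0 \<noteq> 0" using c(2) by blast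
  have "c b0 = 0"
  proof (rule reynolds_nondegenerate[OF c(1)])
    fix h :: "'n cvec \<Rightarrow> complex" assume h: "h \<in> polynomials"
    have "(\<Sum>b\<in>B. scale (reynolds (h * c b)) b) = (\<Sum>b\<in>B. chi_average (scale (h * c b) b))"
      by (rule sum.cong) (simp_all add: chi_average_scale_invariant chi_one_formD(1)[OF BM])
    also have "\<dots> = chi_average (\<Sum>b\<in>B. scale (h * c b) b)"
      using sum_comp_morphism[of chi_average "\<lambda>b. scale (h * c b) b" B]
      by (simp add: chi_average_add o_def)
    also have "(\<Sum>b\<in>B. scale (h * c b) b) = scale h (\<Sum>b\<in>B. scale (c b) b)"
      by (simp add: scale_sum_right scale_scale)
    also have "chi_average (scale h (\<Sum>b\<in>B. scale (c b) b)) = 0" unfolding rel by simp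
    finally have "(\<Sum>b\<in>B. scale (reynolds (h * c b)) b) = 0" .
    then show "reynolds (h * c b0) = 0"
      by (rule irredundant_independent[OF B _ _ b0(1), rotated])
        (intro reynolds_invariant polynomials_mult h c(1))
  qed
  with b0(2) show False by simp
qed

text \<open>A maximal irredundant family spans the homogeneous 1-forms modulo
  \<open>decomposable\<close>. In a decomposable form each invariant factor has no constant term, so
  in a given degree the form factors have smaller degree, and induction on the degree
  applies.\<close>

lemma chi_one_forms_generated:
  obtains \<omega> :: "'n \<Rightarrow> 'n form" where "\<And>i. \<omega> i \<in> chi_one_forms"
    "\<And>u. u \<in> chi_one_forms \<Longrightarrow> \<exists>r. (\<forall>i. r i \<in> invariants G) \<and> u = (\<Sum>i\<in>UNIV. scale (r i) (\<omega> i))"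
proof -
  have "irredundant {}" by (simp add: irredundant_def)
  moreover have "\<forall>B. irredundant B \<longrightarrow> card B < Suc (CARD('n))"
    using irredundant_card by (auto simp: less_Suc_eq_le)
  ultimately obtain B where B: "irredundant B" "\<And>B'. irredundant B' \<Longrightarrow> card B' \<le> card B"
    using ex_has_greatest_nat[of irredundant "{}" card "Suc (CARD('n))"] by blast
  have finB: "finite B" and BM: "\<And>b. b \<in> B \<Longrightarrow> b \<in> chi_one_forms"
    and Bhom: "\<And>b. b \<in> B \<Longrightarrow> \<exists>d. homogeneous_form d b"
    and irr: "\<And>c::'n form \<Rightarrow> complex. (\<Sum>b\<in>B. scale (\<lambda>v. c b) b) \<in> decomposable \<Longrightarrow> \<forall>b\<in>B. c b = 0"
    using B(1) by (auto simp: irredundant_def)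
  define S where "S = {\<Sum>b\<in>B. scale (r b) b | r. \<forall>b. r b \<in> invariants G}"
  have S_I: "(\<Sum>b\<in>B. scale (r b) b) \<in> S" if "\<And>b. r b \<in> invariants G" for r
    using that by (auto simp: S_def)
  have S_add: "x + y \<in> S" if "x \<in> S" "y \<in> S" for x y
  proof -
    from that obtain p q where "\<And>b. p b \<in> invariants G" "\<And>b. q b \<in> invariants G"
      "x = (\<Sum>b\<in>B. scale (p b) b)" "y = (\<Sum>b\<in>B. scale (q b) b)" unfolding S_def by blast
    then show ?thesis using S_I[of "\<lambda>b. p b + q b"]
      by (simp add: invariants_add scale_add_left sum.distrib)
  qed
  have S_scale: "scale f x \<in> S" if "f \<in> invariants G" "x \<in> S" for f x
  proof -
    from that(2) obtain p where "\<And>b. p b \<in> invariants G" "x = (\<Sum>b\<in>B. scale (p b) b)"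
      unfolding S_def by blast
    then show ?thesis using S_I[of "\<lambda>b. f * p b"] that(1)
      by (simp add: invariants_mult scale_sum_right scale_scale)
  qed
  have S_zero: "0 \<in> S" using S_I[of "\<lambda>_. 0"] by simp
  have S_sum: "(\<Sum>x\<in>X. f x) \<in> S" if "\<And>x. x \<in> X \<Longrightarrow> f x \<in> S" for X :: "nat set" and f
    using that by (induction X rule: infinite_finite_induct) (simp_all add: S_zero S_add)
  have S_base: "b \<in> S" if "b \<in> B" for b
  proof -
    have "(\<Sum>x\<in>B. scale (if x = b then 1 else 0) x) = (\<Sum>x\<in>B. if x = b then b else 0)"
      by (rule sum.cong) auto
    also have "\<dots> = b" using that finB by simp
    finally show ?thesis using S_I[of "\<lambda>x. if x = b then 1 else 0"] by simp
  qed
  have dec: "\<exists>c. \<exists>y\<in>decomposable. u = (\<Sum>b\<in>B. scale (\<lambda>v. c b) b) + y"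
    if u: "u \<in> chi_one_forms" "homogeneous_form d u" for u d
  proof (cases "u \<in> B")
    case True
    have "(\<Sum>b\<in>B. scale (\<lambda>v. if b = u then 1 else 0) b) = (\<Sum>b\<in>B. if b = u then u else 0)"
      by (rule sum.cong) (auto simp: fun_eq_iff)
    then have "u = (\<Sum>b\<in>B. scale (\<lambda>v. if b = u then 1 else 0) b) + 0" using True finB by simp
    moreover have "0 \<in> decomposable" unfolding decomposable_def by (rule lincomb.zero)
    ultimately show ?thesis by (intro exI[of _ "\<lambda>b. if b = u then 1 else 0"] bexI[of _ 0])
  next
    case False
    \<comment> \<open>By maximality the enlarged family has a nontrivial relation; since B has none,
      it can be solved for u.\<close>
    have "\<not> irredundant (insert u B)" using B(2)[of "insert u B"] finB False by auto
    then obtain c where c: "(\<Sum>b\<in>insert u B. scale (\<lambda>v. c b) b) \<in> decomposable"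
      "\<exists>b\<in>insert u B. c b \<noteq> (0::complex)"
      using finB BM Bhom u unfolding irredundant_def by auto
    have sum: "(\<Sum>b\<in>insert u B. scale (\<lambda>v. c b) b) = scale (\<lambda>v. c u) u + (\<Sum>b\<in>B. scale (\<lambda>v. c b) b)"
      using finB False by simp
    have "c u \<noteq> 0"
    proof
      assume 0: "c u = 0"
      then have "scale (\<lambda>v. c u) u = 0" by (simp add: fun_eq_iff)
      with c(1) sum have "(\<Sum>b\<in>B. scale (\<lambda>v. c b) b) \<in> decomposable" by simp
      from irr[OF this] c(2) 0 show False by auto
    qed
    define y where "y = (\<Sum>b\<in>insert u B. scale (\<lambda>v. c b) b)"
    have "scale (\<lambda>v. 1 / c u) y \<in> decomposable"
      using c(1) unfolding decomposable_def y_def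
    proof (rule lincomb_map[where h = "scale (\<lambda>v. 1 / c u)"])
      fix a b assume "a \<in> invariants_pos" "b \<in> chi_one_forms"
      then have "scale a (scale (\<lambda>v. 1 / c u) b) \<in> lincomb scale invariants_pos chi_one_forms"
        by (intro lincomb_single chi_forms_scale invariants_const)
      then show "scale (\<lambda>v. 1 / c u) (scale a b) \<in> lincomb scale invariants_pos chi_one_forms"
        by (simp add: scale_scale mult.commute)
    qed (simp_all add: scale_add_right)
    moreover have "u = (\<Sum>b\<in>B. scale (\<lambda>v. - c b / c u) b) + scale (\<lambda>v. 1 / c u) y"
    proof (intro ext)
      fix I v
      have "y I v = c u * u I v + (\<Sum>b\<in>B. c b * b I v)"
        unfolding y_def sum by (simp add: sum_fun_apply)
      then show "u I v = ((\<Sum>b\<in>B. scale (\<lambda>v. - c b / c u) b) + scale (\<lambda>v. 1 / c u) y) I v"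
        using \<open>c u \<noteq> 0\<close> by (simp add: sum_fun_apply sum_divide_distrib[symmetric] sum_negf field_simps)
    qed
    ultimately show ?thesis
      by (intro exI[of _ "\<lambda>b. - c b / c u"] bexI[of _ "scale (\<lambda>v. 1 / c u) y"])
  qed
  have hom: "homogeneous_form d u \<Longrightarrow> u \<in> chi_one_forms \<Longrightarrow> u \<in> S" for u d
  proof (induction d arbitrary: u rule: less_induct)
    case (less d)
    obtain c y where cy: "y \<in> decomposable" "u = (\<Sum>b\<in>B. scale (\<lambda>v. c b) b) + y"
      using dec[OF less.prems(2,1)] by blast
    have y: "poly_form x \<and> form_comp d x \<in> S" if "x \<in> decomposable" for x
      using that unfolding decomposable_def
    proof induction
      case zero
      have "poly_form 0 \<and> form_comp d 0 \<in> S" using S_zero by simp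
      then show ?case .
    next
      case (step a b x)
      have b: "poly_form b" using step(2) chi_one_formD(1) chi_invariant_poly by blast
      have a: "a \<in> polynomials" "a \<in> invariants G" using step(1) by (auto simp: invariants_pos_def invariants_def)
      have "scale (hcomp i a) (form_comp (d - i) b) \<in> S" if "i \<le> d" for i
      proof (cases "i = 0")
        case True
        have "hcomp i a = 0" using True step(1) a by (simp add: hcomp_0 invariants_pos_def fun_eq_iff)
        then show ?thesis using S_zero by simp
      next
        case False
        then have "form_comp (d - i) b \<in> S"
          using that by (intro less.IH[of "d - i"] homogeneous_form_comp b chi_forms_comp step(2)) auto
        then show ?thesis by (intro S_scale invariants_hcomp a)
      qed
      then have "form_comp d (scale a b) \<in> S"
        unfolding form_comp_scale[OF a(1) b] by (intro S_sum) simp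
      moreover have "poly_form x \<and> form_comp d x \<in> S" by (rule step.IH)
      ultimately have "poly_form (scale a b + x) \<and> form_comp d (scale a b + x) \<in> S"
        using poly_form_scale[OF a(1) b] by (simp add: form_comp_add poly_form_add S_add)
      then show ?case .
    qed
    have cb: "poly_form (scale (\<lambda>v. c b) b)" if "b \<in> B" for b
      using chi_one_formD(1)[OF BM[OF that]] by (intro poly_form_scale polynomials.const chi_invariant_poly)
    have "u = form_comp d u" using form_comp_of_homogeneous[OF less.prems(1)] by simp
    also have "\<dots> = (\<Sum>b\<in>B. form_comp d (scale (\<lambda>v. c b) b)) + form_comp d y"
      unfolding cy(2) using cb y[OF cy(1)] by (simp add: form_comp_add form_comp_sum poly_form_sum)
    finally have u: "u = (\<Sum>b\<in>B. form_comp d (scale (\<lambda>v. c b) b)) + form_comp d y" .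
    \<comment> \<open>Only forms of degree d contribute. A form that is homogeneous of two degrees
      is zero, so the test does not depend on the degree k picked for b.\<close>
    have "(\<Sum>b\<in>B. form_comp d (scale (\<lambda>v. c b) b)) =
        (\<Sum>b\<in>B. scale (if homogeneous_form d b then (\<lambda>v. c b) else 0) b)"
    proof (rule sum.cong[OF HOL.refl])
      fix b assume b: "b \<in> B"
      then obtain k where k: "homogeneous_form k b" using Bhom by blast
      have "homogeneous_form k (scale (\<lambda>v. c b) b)"
        unfolding homogeneous_form_def
      proof
        fix I show "homogeneous k (scale (\<lambda>v. c b) b I)"
          using homogeneous_mult[OF homogeneous_const[of "c b"], of k "b I"] k
          by (simp add: homogeneous_form_def)
      qed
      note 1 = form_comp_of_homogeneous[OF this, of d]
      show "form_comp d (scale (\<lambda>v. c b) b) = scale (if homogeneous_form d b then (\<lambda>v. c b) else 0) b"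
      proof (cases "k = d")
        case True
        then show ?thesis using 1 k by simp
      next
        case False
        have "b = 0" if "homogeneous_form d b"
          using form_comp_of_homogeneous[OF k, of d] form_comp_of_homogeneous[OF that, of d] False by simp
        then show ?thesis using 1 False by auto
      qed
    qed
    also have "\<dots> \<in> S" by (rule S_I) (auto intro: invariants_const)
    finally have "(\<Sum>b\<in>B. form_comp d (scale (\<lambda>v. c b) b)) \<in> S" .
    with y[OF cy(1)] have "(\<Sum>b\<in>B. form_comp d (scale (\<lambda>v. c b) b)) + form_comp d y \<in> S"
      using S_add by blast
    then have "u \<in> S" unfolding u[symmetric] .
    then show ?case .
  qed
  have all: "u \<in> S" if u: "u \<in> chi_one_forms" for u
  proof -
    have pf: "poly_form u" using chi_one_formD(1)[OF u] by (rule chi_invariant_poly)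
    obtain N where N: "u = (\<Sum>k\<le>N. form_comp k u)" by (rule form_comp_sum_bound[OF pf])
    have "(\<Sum>k\<le>N. form_comp k u) \<in> S"
      by (intro S_sum hom[OF homogeneous_form_comp[OF pf]] chi_forms_comp u)
    then show ?thesis using N by simp
  qed
  obtain f :: "'n form \<Rightarrow> 'n" where f: "inj_on f B"
    using card_le_inj[OF finB _ irredundant_card[OF B(1)]] by auto
  \<comment> \<open>B may have fewer than n members, and the remaining indices receive the zero
    form. That there are none of them follows once the product of all \<omega> i turns out to be
    nonzero.\<close>
  define \<omega> where "\<omega> i = (if i \<in> f ` B then inv_into B f i else 0)" for i
  show ?thesis
  proof (rule that[of \<omega>])
    show "\<omega> i \<in> chi_one_forms" for i
      by (auto simp: \<omega>_def f BM[simplified])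
    fix u assume "u \<in> chi_one_forms"
    from all[OF this] obtain r where r: "\<And>b. r b \<in> invariants G" "u = (\<Sum>b\<in>B. scale (r b) b)"
      unfolding S_def by blast
    have "(\<Sum>i\<in>UNIV. scale (r (\<omega> i)) (\<omega> i)) = (\<Sum>i\<in>f ` B. scale (r (\<omega> i)) (\<omega> i))"
      by (rule sum.mono_neutral_right) (auto simp: \<omega>_def)
    also have "\<dots> = (\<Sum>b\<in>B. scale (r (\<omega> (f b))) (\<omega> (f b)))"
      by (rule sum.reindex_cong[OF f]) auto
    also have "\<dots> = u" unfolding r(2) by (rule sum.cong) (auto simp: \<omega>_def f)
    finally show "\<exists>r. (\<forall>i. r i \<in> invariants G) \<and> u = (\<Sum>i\<in>UNIV. scale (r i) (\<omega> i))"
      using r(1) by (intro exI[of _ "\<lambda>i. r (\<omega> i)"]) simp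
  qed
qed

end

section \<open>Eigenframes at a reflecting hyperplane\<close>

lemma matrix_left_inverse_commute:
  fixes A B :: "'k::field^'n^'n" shows "A ** B = mat 1 \<Longrightarrow> B ** A = mat 1"
  using matrix_left_right_inverse by blast

text \<open>Coordinates adapted to the splitting of the space into the kernel of \<alpha> and the
  line of e: \<alpha> replaces a coordinate i0 that occurs in it, and the others are corrected by
  multiples of \<alpha> so as to vanish at e.\<close>

lemma eigenframe:
  fixes \<alpha> :: "'n::finite cvec \<Rightarrow> complex"
  assumes \<alpha>: "linear_form \<alpha>" and e: "\<alpha> e \<noteq> 0"
  obtains P P' :: "'n cmat" and i0 where "P ** P' = mat 1" "P' ** P = mat 1"
    "\<And>v. (P *v v) $ i0 = \<alpha> v" "\<And>i. i \<noteq> i0 \<Longrightarrow> (P *v e) $ i = 0"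
proof -
  let ?a = "\<lambda>j. \<alpha> (axis j 1)"
  have \<alpha>sum: "(\<Sum>j\<in>UNIV. ?a j * v $ j) = \<alpha> v" for v
    by (rule linear_form_expand[OF \<alpha>, symmetric])
  obtain i0 where i0: "?a i0 \<noteq> 0"
  proof (rule ccontr)
    assume "\<not> thesis"
    then have "?a j = 0" for j using that by blast
    then show False using \<alpha>sum[of e] e by simp
  qed
  define P :: "'n cmat" where
    "P = (\<chi> i j. if i = i0 then ?a j else (if i = j then 1 else 0) - e $ i * ?a j / \<alpha> e)"
  have P0: "(P *v v) $ i0 = \<alpha> v" for v
    by (simp add: P_def matrix_vector_mult_def \<alpha>sum)
  have P1: "(P *v v) $ i = v $ i - e $ i * \<alpha> v / \<alpha> e" if "i \<noteq> i0" for v i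
  proof -
    have "(P *v v) $ i = (\<Sum>j\<in>UNIV. (if i = j then v $ j else 0) - e $ i / \<alpha> e * (?a j * v $ j))"
      using that by (simp add: P_def matrix_vector_mult_def) (rule sum.cong, auto simp: algebra_simps)
    also have "\<dots> = v $ i - e $ i / \<alpha> e * \<alpha> v"
      unfolding sum_subtractf sum_distrib_left[symmetric] \<alpha>sum by simp
    finally show ?thesis by simp
  qed
  have "v = 0" if "P *v v = 0" for v
  proof -
    have "\<alpha> v = 0" using P0[of v] that by simp
    then have vi: "v $ i = 0" if "i \<noteq> i0" for i using P1[OF that, of v] \<open>P *v v = 0\<close> by simp
    have "(\<Sum>j\<in>UNIV. ?a j * v $ j) = (\<Sum>j\<in>UNIV. if j = i0 then ?a i0 * v $ i0 else 0)"
      by (rule sum.cong) (auto simp: vi)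
    then have "\<alpha> v = ?a i0 * v $ i0" unfolding \<alpha>sum by simp
    then have "v $ i0 = 0" using \<open>\<alpha> v = 0\<close> i0 by simp
    then have "v $ i = 0" for i using vi by (cases "i = i0") auto
    then show ?thesis by (simp add: vec_eq_iff)
  qed
  then obtain P' where P': "P' ** P = mat 1" using matrix_left_invertible_ker[of P] by blast
  show ?thesis
    by (rule that[OF matrix_left_inverse_commute[OF P'] P' P0]) (use P1 e in auto)
qed

lemma eigenframe_conjugates:
  fixes \<alpha> :: "'n::finite cvec \<Rightarrow> complex" and P A :: "'n cmat"
  assumes \<alpha>: "linear_form \<alpha>" and e: "\<alpha> e \<noteq> 0"
    and P: "\<And>v. (P *v v) $ i0 = \<alpha> v" "\<And>i. i \<noteq> i0 \<Longrightarrow> (P *v e) $ i = 0"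
    and A: "\<And>v. \<alpha> v = 0 \<Longrightarrow> A *v v = v" "A *v e = c *s e"
  shows "P ** A = (\<chi> i j. if i = j then if i = i0 then c else 1 else 0) ** P"
proof -
  let ?D = "(\<chi> i j. if i = j then if i = i0 then c else 1 else 0) :: 'n cmat"
  have "(P ** A) *v v = (?D ** P) *v v" for v
  proof -
    define h where "h = v - (\<alpha> v / \<alpha> e) *s e"
    have h: "\<alpha> h = 0" using e by (simp add: h_def linear_form_diff linear_form_scale \<alpha>)
    have v: "v = h + (\<alpha> v / \<alpha> e) *s e" by (simp add: h_def)
    have Av: "A *v v = h + (\<alpha> v / \<alpha> e * c) *s e"
      by (subst v) (simp add: matrix_vector_right_distrib vector_scalar_commute A(1)[OF h] A(2) vector_smult_assoc)
    have D: "(?D *v w) $ i = (if i = i0 then c else 1) * w $ i" for w i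
      by (simp add: matrix_vector_mult_def if_distrib[of "\<lambda>x. x * _"] cong: if_cong)
    have "(P *v (A *v v)) $ i = (?D *v (P *v v)) $ i" for i
    proof (cases "i = i0")
      case True
      have "\<alpha> (A *v v) = c * \<alpha> v"
        unfolding Av using e h by (simp add: linear_form_add linear_form_scale \<alpha>)
      then show ?thesis using True by (simp add: D P(1))
    next
      case False
      have "(P *v v) $ i = (P *v h) $ i"
        by (subst v) (simp add: matrix_vector_right_distrib vector_scalar_commute P(2)[OF False])
      then show ?thesis unfolding D Av
        by (simp add: matrix_vector_right_distrib vector_scalar_commute P(2)[OF False] False)
    qed
    then show ?thesis by (simp add: vec_eq_iff flip: matrix_vector_mul_assoc)
  qed
  then show ?thesis by (simp add: matrix_eq)
qed

lemma det_of_conjugate: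
  fixes A P P' :: "'n::finite cmat"
  assumes "P ** P' = mat 1" "P ** A = (\<chi> i j. if i = j then d i else 0) ** P"
  shows "det A = (\<Prod>i\<in>UNIV. d i)"
proof -
  have "det P * det P' = 1" using arg_cong[OF assms(1), of det] by (simp add: det_mul)
  then have "det P \<noteq> 0" by auto
  moreover have "det P * det A = det (\<chi> i j. if i = j then d i else 0) * det P"
    using arg_cong[OF assms(2), of det] by (simp add: det_mul)
  moreover have "det (\<chi> i j. if i = j then d i else 0) = (\<Prod>i\<in>UNIV. d i)"
    by (subst det_diagonal) auto
  ultimately show ?thesis by simp
qed

context finite_unitary_group
begin

lemma finite_order: assumes g: "g \<in> G" shows "group.ord unitary_group g > 0"
proof -
  interpret U: group "unitary_group :: 'n cmat monoid" by (rule group_unitary)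
  have c: "g \<in> carrier unitary_group" using G_unitary[OF g] by (simp add: unitary_group_simps)
  have "g [^]\<^bsub>unitary_group\<^esub> (k::nat) \<in> G" for k
    by (induction k) (use g G_one G_mult in \<open>auto simp: unitary_group_simps\<close>)
  then have "range (\<lambda>k::nat. g [^]\<^bsub>unitary_group\<^esub> k) \<subseteq> G" by blast
  then have "\<not> inj (\<lambda>k::nat. g [^]\<^bsub>unitary_group\<^esub> k)"
    using finite_G finite_subset finite_imageD infinite_UNIV_nat by blast
  then obtain i j :: nat where ij: "i < j" "g [^]\<^bsub>unitary_group\<^esub> i = g [^]\<^bsub>unitary_group\<^esub> j"
    by (metis injI linorder_neqE_nat)
  have "g [^]\<^bsub>unitary_group\<^esub> i \<otimes>\<^bsub>unitary_group\<^esub> g [^]\<^bsub>unitary_group\<^esub> (j - i) = g [^]\<^bsub>unitary_group\<^esub> i"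
    using ij U.nat_pow_mult[OF c, of i "j - i"] by simp
  then have "g [^]\<^bsub>unitary_group\<^esub> (j - i) = \<one>\<^bsub>unitary_group\<^esub>"
    using U.l_cancel_one[OF U.nat_pow_closed[OF c, of i] U.nat_pow_closed[OF c, of "j - i"]] by simp
  with ij show ?thesis using U.ord_eq_0[OF c] by (metis gr0I zero_less_diff not_less_zero)
qed

lemma reflectionI:
  assumes g: "g \<in> G" "g \<noteq> mat 1" and H: "hyperplane H" "\<And>v. v \<in> H \<Longrightarrow> g *v v = v"
  shows "reflection g" "H \<in> reflecting_hyperplanes G"
proof -
  interpret U: group "unitary_group :: 'n cmat monoid" by (rule group_unitary)
  have c: "g \<in> carrier unitary_group" using G_unitary[OF g(1)] by (simp add: unitary_group_simps)
  have "g [^]\<^bsub>unitary_group\<^esub> group.ord unitary_group g = mat 1"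
    using U.pow_ord_eq_1[OF c] by (simp add: unitary_group_simps)
  then show "reflection g"
    unfolding reflection_def using G_unitary g H finite_order[OF g(1)] by blast
  then show "H \<in> reflecting_hyperplanes G"
    unfolding reflecting_hyperplanes_def using g H by blast
qed

end

section \<open>The cyclic stabilizer of a reflecting hyperplane\<close>

locale reflection_data = reflection_setup G \<theta> \<alpha>
  for G :: "('n::{finite,linorder} cmat) set" and \<theta> \<alpha> +
  fixes s :: "('n cvec) set \<Rightarrow> 'n cmat"
  assumes generator: "\<And>H. H \<in> reflecting_hyperplanes G \<Longrightarrow>
    generate unitary_group {s H} = pointwise_stabilizer G H"
begin

lemma s_stabilizes:
  assumes "H \<in> arrangement"
  shows "s H \<in> G" "\<And>v. v \<in> H \<Longrightarrow> s H *v v = v"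
  using generate.incl[of "s H" "{s H}" unitary_group] generator[OF assms]
  by (auto simp: pointwise_stabilizer_def)

lemma stabilizer_induct [consumes 2, case_names one gen inv mult]:
  assumes H: "H \<in> arrangement" and g: "g \<in> pointwise_stabilizer G H"
    and one: "P (mat 1)" and gen: "P (s H)" and inv: "P (matrix_inv (s H))"
    and mult: "\<And>g h. g \<in> G \<Longrightarrow> h \<in> G \<Longrightarrow> P g \<Longrightarrow> P h \<Longrightarrow> P (g ** h)"
  shows "P g"
proof -
  have "g \<in> generate unitary_group {s H}" using generator[OF H] g by simp
  then have "P g \<and> g \<in> G"
  proof (induction rule: generate.induct)
    case one
    then show ?case using assms(3) G_one by (simp add: unitary_group_simps)
  next
    case (incl t)
    then show ?case using gen s_stabilizes[OF H] by blast
  next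
    case (inv t)
    then show ?case using assms(5) s_stabilizes[OF H] G_inv by (simp add: unitary_group_inv G_unitary)
  next
    case (eng g h)
    then show ?case using assms(6) G_mult by (simp add: unitary_group_simps)
  qed
  then show ?thesis by blast
qed

lemma s_nontrivial: assumes H: "H \<in> arrangement" shows "s H \<noteq> mat 1"
proof
  assume 1: "s H = mat 1"
  obtain g where g: "g \<in> G" "reflection g" "\<forall>v\<in>H. g *v v = v"
    using H by (auto simp: reflecting_hyperplanes_def)
  then have "g \<in> pointwise_stabilizer G H" by (simp add: pointwise_stabilizer_def)
  with H have "g = mat 1" by (induction rule: stabilizer_induct) (auto simp: 1)
  with g(2) show False by (simp add: reflection_def)
qed

lemma arrangement_fixed_space:
  assumes H: "H \<in> arrangement" and A: "\<And>v. v \<in> H \<Longrightarrow> A *v v = v" "A *v e = e" "e \<notin> H"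
  shows "A = mat 1"
proof -
  note lin = \<alpha>_linear[OF H]
  have e: "\<alpha> H e \<noteq> 0" using A(3) \<alpha>_zero_iff[OF H] by simp
  have "A *v v = v" for v
  proof -
    define h where "h = v - (\<alpha> H v / \<alpha> H e) *s e"
    have "h \<in> H" using e by (simp add: h_def linear_form_diff linear_form_scale lin flip: \<alpha>_zero_iff[OF H])
    then have "A *v (h + (\<alpha> H v / \<alpha> H e) *s e) = h + (\<alpha> H v / \<alpha> H e) *s e"
      by (simp add: matrix_vector_right_distrib vector_scalar_commute A)
    moreover have "h + (\<alpha> H v / \<alpha> H e) *s e = v" by (simp add: h_def)
    ultimately show ?thesis by simp
  qed
  then show ?thesis by (simp add: matrix_eq)
qed

abbreviation ord_s :: "'n cvec set \<Rightarrow> nat" where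
  "ord_s H \<equiv> group.ord unitary_group (s H)"

abbreviation exponent :: "'n cvec set \<Rightarrow> nat" where
  "exponent H \<equiv> char_exponent \<theta> (s H)"

lemma s_power:
  assumes H: "H \<in> arrangement"
  shows "s H [^]\<^bsub>unitary_group\<^esub> (k::nat) \<in> G"
    "\<And>v. v \<in> H \<Longrightarrow> (s H [^]\<^bsub>unitary_group\<^esub> k) *v v = v"
    "\<And>v c. s H *v v = c *s v \<Longrightarrow> (s H [^]\<^bsub>unitary_group\<^esub> k) *v v = c ^ k *s v"
    "\<theta> (s H [^]\<^bsub>unitary_group\<^esub> k) = \<theta> (s H) ^ k"
proof -
  interpret U: group "unitary_group :: 'n cmat monoid" by (rule group_unitary)
  note s = s_stabilizes[OF H]
  have *: "s H [^]\<^bsub>unitary_group\<^esub> Suc k = (s H [^]\<^bsub>unitary_group\<^esub> k) ** s H" for k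
    by (simp add: unitary_group_simps)
  have 0: "s H [^]\<^bsub>unitary_group\<^esub> (0::nat) = mat 1" by (simp add: unitary_group_simps)
  show mem: "s H [^]\<^bsub>unitary_group\<^esub> k \<in> G" for k :: nat
    by (induction k) (simp_all only: 0 * G_one G_mult s)
  show "(s H [^]\<^bsub>unitary_group\<^esub> k) *v v = v" if "v \<in> H" for v
    by (induction k) (simp_all only: 0 * s that matrix_vector_mul_lid flip: matrix_vector_mul_assoc)
  show "(s H [^]\<^bsub>unitary_group\<^esub> k) *v v = c ^ k *s v" if "s H *v v = c *s v" for v c
    by (induction k) (simp_all only: 0 * s that matrix_vector_mul_lid vector_scalar_commute
        vector_smult_assoc power_0 power_Suc vector_smult_lid flip: matrix_vector_mul_assoc)
  show "\<theta> (s H [^]\<^bsub>unitary_group\<^esub> k) = \<theta> (s H) ^ k"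
    by (induction k) (simp_all only: 0 * s \<theta>_one \<theta>_mult mem power_0 power_Suc2)
qed

lemma ord_s_pos: "H \<in> arrangement \<Longrightarrow> ord_s H > 0"
  using finite_order s_stabilizes(1) by blast

text \<open>\<xi> is the inverse of the eigenvalue \<zeta> of \<open>s H\<close> transversal to H,
  because the action on functions uses the inverse matrix. A power of \<open>s H\<close> is trivial
  as soon as it fixes e, so \<xi> is a primitive root of unity of order
  \<open>ord_s H\<close>.\<close>

lemma local_data:
  assumes H: "H \<in> arrangement"
  obtains \<xi> e where "\<xi> \<noteq> 0" "\<And>k. \<xi> ^ k = 1 \<longleftrightarrow> ord_s H dvd k" "\<alpha> H e \<noteq> 0" "s H *v e = inverse \<xi> *s e"
    "matrix_inv (s H) *v e = \<xi> *s e" "\<And>v. \<alpha> H (matrix_inv (s H) *v v) = \<xi> * \<alpha> H v"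
    "det (s H) = inverse \<xi>"
proof -
  interpret U: group "unitary_group :: 'n cmat monoid" by (rule group_unitary)
  note lin = \<alpha>_linear[OF H] and s = s_stabilizes[OF H]
  have c: "s H \<in> carrier unitary_group" using G_unitary[OF s(1)] by (simp add: unitary_group_simps)
  have "linear_form (\<lambda>v. \<alpha> H (s H *v v))" by (rule linear_form_matrix[OF lin])
  moreover have "\<alpha> H (s H *v v) = 0" if "\<alpha> H v = 0" for v
    using that \<alpha>_zero_iff[OF H] s(2) by simp
  ultimately obtain \<zeta> where \<zeta>: "\<And>v. \<alpha> H (s H *v v) = \<zeta> * \<alpha> H v"
    using linear_form_proportional[OF lin _ \<alpha>_nonzero[OF H]] by blast
  obtain x where x: "\<alpha> H x \<noteq> 0" using \<alpha>_nonzero[OF H] by (auto simp: fun_eq_iff)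
  define h where "h = s H *v x - \<zeta> *s x"
  have hH: "h \<in> H"
    by (simp add: h_def linear_form_diff linear_form_scale lin \<zeta> flip: \<alpha>_zero_iff[OF H])
  have sx: "s H *v x = \<zeta> *s x + h" by (simp add: h_def)
  \<comment> \<open>Otherwise \<open>s H\<close> would be a transvection, its k-th power moving x by
    k times h; finite order in characteristic zero then forces h = 0 and
    \<open>s H = mat 1\<close>.\<close>
  have "\<zeta> \<noteq> 1"
  proof
    assume 1: "\<zeta> = 1"
    have pow: "(s H [^]\<^bsub>unitary_group\<^esub> k) *v x = x + of_nat k *s h" for k :: nat
    proof (induction k)
      case 0
      then show ?case by (simp add: unitary_group_simps)
    next
      case (Suc k)
      have "(s H [^]\<^bsub>unitary_group\<^esub> Suc k) *v x = (s H [^]\<^bsub>unitary_group\<^esub> k) *v (s H *v x)"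
        by (simp add: unitary_group_simps matrix_vector_mul_assoc)
      also have "\<dots> = x + of_nat (Suc k) *s h"
        using sx 1 Suc s_power(2)[OF H hH, of k]
        by (simp add: matrix_vector_right_distrib vec.scale_left_distrib algebra_simps)
      finally show ?case .
    qed
    have "s H [^]\<^bsub>unitary_group\<^esub> ord_s H = mat 1" using U.pow_ord_eq_1[OF c] by (simp add: unitary_group_simps)
    then have "of_nat (ord_s H) *s h = 0" using pow[of "ord_s H"] by simp
    then have "h = 0" using ord_s_pos[OF H] by (simp add: vec_eq_iff)
    then have "s H *v x = x" using sx 1 by simp
    then have "s H = mat 1"
      using arrangement_fixed_space[OF H s(2)] x \<alpha>_zero_iff[OF H] by blast
    with s_nontrivial[OF H] show False by simp
  qed
  \<comment> \<open>The multiple c of h solves \<open>1 + c = \<zeta> * c\<close>, which turns x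
    into an eigenvector.\<close>
  define e where "e = x + (1 / (\<zeta> - 1)) *s h"
  have \<alpha>e: "\<alpha> H e \<noteq> 0"
    using x hH[folded \<alpha>_zero_iff[OF H]] by (simp add: e_def linear_form_add linear_form_scale lin)
  have se: "s H *v e = \<zeta> *s e"
    using \<open>\<zeta> \<noteq> 1\<close> s(2)[OF hH]
    by (simp add: e_def matrix_vector_right_distrib vector_scalar_commute sx vec_eq_iff field_simps)
  have inv: "matrix_inv (s H) *v (s H *v v) = v" for v
    by (rule matrix_inv_mult_vec[OF G_mult_inv(2)[OF s(1)]])
  have inv': "s H *v (matrix_inv (s H) *v v) = v" for v
    by (rule matrix_inv_mult_vec[OF G_mult_inv(1)[OF s(1)]])
  have \<zeta>0: "\<zeta> \<noteq> 0"
    using \<zeta>[of "matrix_inv (s H) *v e"] \<alpha>e by (auto simp: inv')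
  have ie: "matrix_inv (s H) *v e = inverse \<zeta> *s e"
  proof -
    have "matrix_inv (s H) *v (\<zeta> *s e) = e" using inv[of e] se by simp
    then have "\<zeta> *s (matrix_inv (s H) *v e) = e" by (simp add: vector_scalar_commute)
    then have "inverse \<zeta> *s (\<zeta> *s (matrix_inv (s H) *v e)) = inverse \<zeta> *s e" by simp
    then show ?thesis using \<zeta>0 by (simp add: vector_smult_assoc)
  qed
  have pw: "inverse \<zeta> ^ k = 1 \<longleftrightarrow> ord_s H dvd k" for k
  proof -
    have "s H [^]\<^bsub>unitary_group\<^esub> k = mat 1 \<longleftrightarrow> \<zeta> ^ k = 1"
    proof
      assume "s H [^]\<^bsub>unitary_group\<^esub> k = mat 1"
      then have "\<zeta> ^ k *s e = e" using s_power(3)[OF H se, of k] by simp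
      then have "\<alpha> H (\<zeta> ^ k *s e) = \<alpha> H e" by simp
      then show "\<zeta> ^ k = 1" using \<alpha>e by (simp add: linear_form_scale lin)
    next
      assume "\<zeta> ^ k = 1"
      then have "(s H [^]\<^bsub>unitary_group\<^esub> k) *v e = e" using s_power(3)[OF H se, of k] by simp
      then show "s H [^]\<^bsub>unitary_group\<^esub> k = mat 1"
        using arrangement_fixed_space[OF H s_power(2)[OF H]] \<alpha>e \<alpha>_zero_iff[OF H] by blast
    qed
    then show ?thesis using U.pow_eq_id[OF c, of k]
      by (simp add: unitary_group_simps power_inverse)
  qed
  obtain P P' :: "'n cmat" and i0 where P: "P ** P' = mat 1" "P' ** P = mat 1"
    "\<And>v. (P *v v) $ i0 = \<alpha> H v" "\<And>i. i \<noteq> i0 \<Longrightarrow> (P *v e) $ i = 0"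
    using eigenframe[OF lin \<alpha>e] by metis
  have "P ** s H = (\<chi> i j. if i = j then if i = i0 then \<zeta> else 1 else 0) ** P"
    using P(3,4) se s(2) \<alpha>_zero_iff[OF H] by (intro eigenframe_conjugates[OF lin \<alpha>e]) auto
  from det_of_conjugate[OF P(1) this] have det: "det (s H) = \<zeta>" by simp
  show ?thesis
  proof (rule that[of "inverse \<zeta>" e])
    show "\<alpha> H (matrix_inv (s H) *v v) = inverse \<zeta> * \<alpha> H v" for v
      using \<zeta>[of "matrix_inv (s H) *v v"] \<zeta>0 by (simp add: inv' field_simps)
  qed (use \<zeta>0 pw \<alpha>e se ie det in auto)
qed

text \<open>\<open>\<theta> (s H)\<close> is a solution of \<open>z ^ ord_s H = 1\<close>, and the
  powers of \<xi> with exponent below \<open>ord_s H\<close> exhaust these solutions; so the set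
  under \<open>LEAST\<close> is nonempty.\<close>

lemma exponent_props:
  assumes H: "H \<in> arrangement" and \<xi>: "\<xi> \<noteq> 0" "\<And>k. \<xi> ^ k = 1 \<longleftrightarrow> ord_s H dvd k" "det (s H) = inverse \<xi>"
  shows "exponent H < ord_s H" "\<theta> (s H) = \<xi> ^ exponent H" "\<And>b. \<theta> (s H) = \<xi> ^ b \<Longrightarrow> exponent H \<le> b"
proof -
  interpret U: group "unitary_group :: 'n cmat monoid" by (rule group_unitary)
  have c: "s H \<in> carrier unitary_group"
    using G_unitary[OF s_stabilizes(1)[OF H]] by (simp add: unitary_group_simps)
  let ?o = "ord_s H"
  have pos: "?o > 0" by (rule ord_s_pos[OF H])
  \<comment> \<open>The determinant is the inverse of \<xi>, so its negative powers are the positive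
    powers of \<xi>.\<close>
  have powi: "det (s H) powi - int a = \<xi> ^ a" for a
    using \<xi>(1,3) by (simp add: power_int_minus power_inverse)
  have inj: "inj_on (\<lambda>k. \<xi> ^ k) {..<?o}"
  proof (rule linorder_inj_onI)
    fix i j assume ij: "i < j" "i \<in> {..<?o}" "j \<in> {..<?o}"
    show "\<xi> ^ i \<noteq> \<xi> ^ j"
    proof
      assume "\<xi> ^ i = \<xi> ^ j"
      moreover have "\<xi> ^ j = \<xi> ^ i * \<xi> ^ (j - i)" using ij by (simp flip: power_add)
      ultimately have "\<xi> ^ (j - i) = 1" using \<xi>(1) by simp
      then have "?o dvd j - i" by (simp add: \<xi>(2))
      then show False using ij by (auto dest: dvd_imp_le)
    qed
  qed auto
  have "(\<lambda>k. \<xi> ^ k) ` {..<?o} = {z. z ^ ?o = 1}"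
  proof (rule card_subset_eq)
    show "finite {z::complex. z ^ ?o = 1}" using pos by (intro finite_roots_unity) auto
    show "card ((\<lambda>k. \<xi> ^ k) ` {..<?o}) = card {z::complex. z ^ ?o = 1}"
      using card_roots_unity_eq[OF pos] by (simp add: card_image[OF inj])
    show "(\<lambda>k. \<xi> ^ k) ` {..<?o} \<subseteq> {z. z ^ ?o = 1}"
    proof -
      have "(\<xi> ^ k) ^ ?o = 1" for k
        using \<xi>(2)[of ?o] by (metis dvd_refl mult.commute power_mult power_one)
      then show ?thesis by auto
    qed
  qed
  moreover have "\<theta> (s H) ^ ?o = 1"
    using s_power(4)[OF H, of ?o] U.pow_ord_eq_1[OF c] by (simp add: unitary_group_simps \<theta>_one)
  ultimately obtain k where k: "k < ?o" "\<theta> (s H) = \<xi> ^ k" by blast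
  have def: "exponent H = (LEAST a. a < ?o \<and> \<theta> (s H) = \<xi> ^ a)"
    unfolding char_exponent_def powi ..
  have *: "exponent H < ?o \<and> \<theta> (s H) = \<xi> ^ exponent H"
    unfolding def by (rule LeastI[of _ k]) (use k in auto)
  then show "exponent H < ?o" "\<theta> (s H) = \<xi> ^ exponent H" by auto
  fix b assume b: "\<theta> (s H) = \<xi> ^ b"
  show "exponent H \<le> b"
  proof (cases "b < ?o")
    case True
    then show ?thesis unfolding def using b by (intro Least_le) auto
  next
    case False
    with * show ?thesis by linarith
  qed
qed

lemma stabilizer_eigenform:
  assumes H: "H \<in> arrangement" and eig: "act_form (s H) \<omega> = scale (\<lambda>v. \<theta> (s H)) \<omega>"
    and g: "g \<in> pointwise_stabilizer G H"
  shows "act_form g \<omega> = scale (\<lambda>v. \<theta> g) \<omega>"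
  using H g
proof (induction rule: stabilizer_induct)
  case one
  have "act_form (mat 1) \<omega> = scale (\<lambda>v. \<theta> (mat 1)) \<omega>"
    by (simp add: act_form_mat_one \<theta>_one fun_eq_iff)
  then show ?case .
next
  case gen
  show ?case by (rule eig)
next
  case inv
  note s = s_stabilizes(1)[OF H]
  have "scale (\<lambda>v. \<theta> (s H)) (act_form (matrix_inv (s H)) \<omega>) = act_form (matrix_inv (s H)) (act_form (s H) \<omega>)"
    unfolding eig by (simp add: act_form_scale act_const)
  also have "\<dots> = \<omega>"
    using s by (simp add: act_form_compose G_unitary G_inv G_mult_inv act_form_mat_one)
  finally have "\<theta> (s H) * act_form (matrix_inv (s H)) \<omega> I v = \<omega> I v" for I v
    by (metis scale_apply times_fun_apply)
  then have "act_form (matrix_inv (s H)) \<omega> I v = \<theta> (matrix_inv (s H)) * \<omega> I v" for I v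
    using \<theta>_nonzero[OF s] by (simp add: \<theta>_inv[OF s] field_simps)
  then have "act_form (matrix_inv (s H)) \<omega> = scale (\<lambda>v. \<theta> (matrix_inv (s H))) \<omega>"
    by (intro ext) simp
  then show ?case .
next
  case (mult g h)
  have "act_form (g ** h) \<omega> = act_form g (act_form h \<omega>)" using mult.hyps by (simp add: act_form_compose G_unitary)
  also have "act_form h \<omega> = scale (\<lambda>v. \<theta> h) \<omega>" by (rule mult.IH(2))
  also have "act_form g (scale (\<lambda>v. \<theta> h) \<omega>) = scale (\<lambda>v. \<theta> h) (act_form g \<omega>)"
    by (simp add: act_form_scale act_const)
  also have "act_form g \<omega> = scale (\<lambda>v. \<theta> g) \<omega>" by (rule mult.IH(1))
  finally have "act_form (g ** h) \<omega> = scale (\<lambda>v. \<theta> (g ** h)) \<omega>"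
    using mult.hyps by (simp add: \<theta>_mult fun_eq_iff)
  then show ?case .
qed

text \<open>This description of the exponent does not mention the chosen generator, so that it is
  constant on orbits of hyperplanes.\<close>

lemma exponent_iff:
  assumes H: "H \<in> arrangement"
  shows "(\<forall>g\<in>pointwise_stabilizer G H. act g (\<alpha> H ^ exponent H) = (\<lambda>v. \<theta> g) * \<alpha> H ^ exponent H)"
    and "(\<forall>g\<in>pointwise_stabilizer G H. act g (\<alpha> H ^ b) = (\<lambda>v. \<theta> g) * \<alpha> H ^ b) \<Longrightarrow> exponent H \<le> b"
proof -
  obtain \<xi> e where \<xi>: "\<xi> \<noteq> 0" "\<And>k. \<xi> ^ k = 1 \<longleftrightarrow> ord_s H dvd k" and e: "\<alpha> H e \<noteq> 0"
    and \<alpha>\<xi>: "\<And>v. \<alpha> H (matrix_inv (s H) *v v) = \<xi> * \<alpha> H v" and det: "det (s H) = inverse \<xi>"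
    by (rule local_data[OF H]) blast
  note a = exponent_props[OF H \<xi> det]
  have s: "act (s H) (\<alpha> H ^ k) = (\<lambda>v. \<xi> ^ k) * \<alpha> H ^ k" for k
    by (simp add: act_def fun_eq_iff power_fun_apply \<alpha>\<xi> power_mult_distrib)
  let ?f = "\<alpha> H ^ exponent H"
  have eig: "act (s H) ?f = (\<lambda>v. \<theta> (s H)) * ?f" by (simp add: s a(2))
  show "\<forall>g\<in>pointwise_stabilizer G H. act g ?f = (\<lambda>v. \<theta> g) * ?f"
  proof
    fix g assume g: "g \<in> pointwise_stabilizer G H"
    \<comment> \<open>Functions are treated as forms of degree zero, so that
      \<open>stabilizer_eigenform\<close> covers them.\<close>
    have "act_form (s H) (degree0 ?f) = scale (\<lambda>v. \<theta> (s H)) (degree0 ?f)"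
      by (simp only: act_form_degree0 eig) (simp add: degree0_def fun_eq_iff)
    from stabilizer_eigenform[OF H this g]
    have "(degree0 (act g ?f) :: 'n form) = scale (\<lambda>v. \<theta> g) (degree0 ?f)" by (simp only: act_form_degree0)
    from fun_cong[OF this, of "{}"] show "act g ?f = (\<lambda>v. \<theta> g) * ?f" by (simp add: degree0_def)
  qed
  assume b: "\<forall>g\<in>pointwise_stabilizer G H. act g (\<alpha> H ^ b) = (\<lambda>v. \<theta> g) * \<alpha> H ^ b"
  have "s H \<in> pointwise_stabilizer G H"
    using s_stabilizes[OF H] by (simp add: pointwise_stabilizer_def)
  with b s have "(\<lambda>v. \<xi> ^ b) * \<alpha> H ^ b = (\<lambda>v. \<theta> (s H)) * \<alpha> H ^ b" by metis
  then have "\<xi> ^ b * \<alpha> H e ^ b = \<theta> (s H) * \<alpha> H e ^ b"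
    by (metis power_fun_apply times_fun_apply)
  then have "\<theta> (s H) = \<xi> ^ b" using e by simp
  then show "exponent H \<le> b" by (rule a(3))
qed

end

section \<open>Divisibility by the semi-invariant\<close>

definition pdvd :: "('n::finite cvec \<Rightarrow> complex) \<Rightarrow> ('n cvec \<Rightarrow> complex) \<Rightarrow> bool" where
  "pdvd m f \<longleftrightarrow> (\<exists>h\<in>polynomials. f = m * h)"

lemma pdvdI: "h \<in> polynomials \<Longrightarrow> f = m * h \<Longrightarrow> pdvd m f"
  by (auto simp: pdvd_def)

lemma pdvd_zero: "pdvd m 0"
  by (rule pdvdI[of 0]) auto

lemma pdvd_add: "pdvd m f \<Longrightarrow> pdvd m g \<Longrightarrow> pdvd m (f + g)"
proof -
  assume "pdvd m f" "pdvd m g"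
  then obtain h k where "h \<in> polynomials" "k \<in> polynomials" "f = m * h" "g = m * k"
    unfolding pdvd_def by blast
  then show ?thesis by (intro pdvdI[of "h + k"] polynomials_add) (simp_all add: distrib_left)
qed

lemma pdvd_mult_left: "pdvd m f \<Longrightarrow> g \<in> polynomials \<Longrightarrow> pdvd m (g * f)"
  unfolding pdvd_def by (metis mult.left_commute polynomials_mult)

lemma pdvd_mult_right: "pdvd m f \<Longrightarrow> g \<in> polynomials \<Longrightarrow> pdvd m (f * g)"
  using pdvd_mult_left[of m f g] by (simp add: mult.commute)

lemma pdvd_sum: "(\<And>x. x \<in> A \<Longrightarrow> pdvd m (f x)) \<Longrightarrow> pdvd m (\<Sum>x\<in>A. f x)"
  by (induction A rule: infinite_finite_induct) (auto intro: pdvd_zero pdvd_add)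

lemma pdvd_lam_const:
  assumes "\<And>I. pdvd m (\<omega> I)" shows "pdvd m (lam (const_mat A) \<omega> K)"
proof -
  have "lam (const_mat A) \<omega> K = (\<Sum>I\<in>UNIV. \<omega> I * row_wedge (const_mat A) I K)"
    unfolding lam_def by (simp only: sum_fun_apply scale_apply)
  moreover have "pdvd m (\<Sum>I\<in>UNIV. \<omega> I * row_wedge (const_mat A) I K)"
    by (intro pdvd_sum pdvd_mult_right assms) (simp add: row_wedge_const polynomials.const)
  ultimately show ?thesis by simp
qed

context reflection_data
begin

lemma finite_arrangement: "finite arrangement"
proof (rule finite_subset)
  show "arrangement \<subseteq> (\<lambda>g. {v. g *v v = v}) ` G"
  proof
    fix H assume H: "H \<in> arrangement"
    have "{v. s H *v v = v} = H"
      using arrangement_fixed_space[OF H s_stabilizes(2)[OF H]] s_stabilizes(2)[OF H] s_nontrivial[OF H]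
      by blast
    then show "H \<in> (\<lambda>g. {v. g *v v = v}) ` G" using s_stabilizes(1)[OF H] by blast
  qed
qed (simp add: finite_G)

lemma arrangement_independent:
  assumes H: "H \<in> arrangement" and K: "K \<in> arrangement" and "H \<noteq> K"
  shows "\<exists>v. \<alpha> K v = 0 \<and> \<alpha> H v \<noteq> 0"
proof (rule ccontr)
  assume *: "\<not> ?thesis"
  obtain c where c: "\<And>v. \<alpha> H v = c * \<alpha> K v"
    using linear_form_proportional[OF \<alpha>_linear[OF K] \<alpha>_linear[OF H] \<alpha>_nonzero[OF K]] * by blast
  have "c \<noteq> 0"
  proof
    assume "c = 0"
    then have "\<alpha> H = 0" using c by (simp add: fun_eq_iff)
    with \<alpha>_nonzero[OF H] show False by simp
  qed
  then have "v \<in> H \<longleftrightarrow> v \<in> K" for v using c[of v] \<alpha>_zero_iff[OF H] \<alpha>_zero_iff[OF K] by (metis mult_eq_0_iff)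
  with \<open>H \<noteq> K\<close> show False by blast
qed

text \<open>The covector transversal to H contributes a factor \<xi> of its own, so with a the
  exponent its coefficient must belong to the eigenvalue of index a - 1. The value is the residue of
  a - 1 modulo the order of \<open>s H\<close>.\<close>

definition coexponent :: "'n cvec set \<Rightarrow> nat" where
  "coexponent H = (if exponent H = 0 then ord_s H - 1 else exponent H - 1)"

text \<open>In a frame of eigencovectors of \<open>s H\<close> semi-invariance becomes an eigenvalue
  equation for each coefficient, with index \<open>exponent H\<close> or \<open>coexponent H\<close>
  according to whether I avoids or contains i0. Both lie below the order, so
  \<open>eigenfunction_divisible\<close> splits off the full power. Conversely, the frame covectors
  with exactly these powers are semi-invariant under the pointwise stabilizer of H; they are the
  local models for \<open>local_determinant\<close>.\<close>

lemma local_frame: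
  assumes H: "H \<in> arrangement"
  obtains P P' :: "'n cmat" and i0 e where "P ** P' = mat 1" "P' ** P = mat 1" "\<alpha> H e \<noteq> 0"
    "\<And>\<omega> I. chi_invariant \<omega> \<Longrightarrow>
      pdvd (\<alpha> H ^ (if i0 \<in> I then coexponent H else exponent H)) (lam (const_mat P') \<omega> I)"
    "\<And>i g. g \<in> pointwise_stabilizer G H \<Longrightarrow>
      act_form g (scale (\<alpha> H ^ (if i = i0 then coexponent H else exponent H)) (row_form (const_mat P) i)) =
      scale (\<lambda>v. \<theta> g) (scale (\<alpha> H ^ (if i = i0 then coexponent H else exponent H)) (row_form (const_mat P) i))"
proof -
  note lin = \<alpha>_linear[OF H] and s = s_stabilizes[OF H]
  obtain \<xi> e where \<xi>: "\<xi> \<noteq> 0" "\<And>k. \<xi> ^ k = 1 \<longleftrightarrow> ord_s H dvd k" and e: "\<alpha> H e \<noteq> 0"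
    "matrix_inv (s H) *v e = \<xi> *s e"
    and \<alpha>\<xi>: "\<And>v. \<alpha> H (matrix_inv (s H) *v v) = \<xi> * \<alpha> H v" and det: "det (s H) = inverse \<xi>"
    by (rule local_data[OF H]) blast
  note a = exponent_props[OF H \<xi> det]
  obtain P P' :: "'n cmat" and i0 where P: "P ** P' = mat 1" "P' ** P = mat 1"
    "\<And>v. (P *v v) $ i0 = \<alpha> H v" "\<And>i. i \<noteq> i0 \<Longrightarrow> (P *v e) $ i = 0"
    using eigenframe[OF lin e(1)] by metis
  have fixH: "matrix_inv (s H) *v v = v" if "\<alpha> H v = 0" for v
    using matrix_inv_fixes[OF s(1)] s(2) that \<alpha>_zero_iff[OF H] by simp
  let ?d = "\<lambda>i. if i = i0 then \<xi> else 1"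
  have conj: "P ** matrix_inv (s H) = (\<chi> i j. if i = j then ?d i else 0) ** P"
    using eigenframe_conjugates[OF lin e(1) P(3,4) fixH e(2)] .
  let ?D = "\<lambda>i. (\<lambda>v. ?d i) :: 'n cvec \<Rightarrow> complex"
  have D: "const_mat (\<chi> i j. if i = j then ?d i else 0) = diag ?D"
    by (auto simp: const_mat_def diag_def fun_eq_iff)
  have prodD: "(\<Prod>i\<in>I. ?D i) = (\<lambda>v. if i0 \<in> I then \<xi> else 1)" for I
    by (rule ext) (simp add: prod_fun_apply prod.delta)
  \<comment> \<open>Relative to the frame, \<open>s H\<close> acts on the coefficients and
    multiplies by \<xi> exactly the terms that contain the transversal covector.\<close>
  have act_frame: "act_form (s H) (lam (const_mat P) c) =
      lam (const_mat P) (\<lambda>I. (\<lambda>v. if i0 \<in> I then \<xi> else 1) * act (s H) (c I))" for c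
  proof -
    have "act_form (s H) (lam (const_mat P) c) =
        lam (const_mat (P ** matrix_inv (s H))) (\<lambda>I. act (s H) (c I))"
      by (simp add: act_form_lam act_lam act_const_mat lam_lam const_mat_prod)
    also have "\<dots> = lam (const_mat P) (lam (diag ?D) (\<lambda>I. act (s H) (c I)))"
      by (simp add: conj lam_lam const_mat_prod flip: D)
    also have "lam (diag ?D) (\<lambda>I. act (s H) (c I)) = (\<lambda>I. (\<lambda>v. if i0 \<in> I then \<xi> else 1) * act (s H) (c I))"
      by (rule ext) (simp only: lam_diag prodD)
    finally show ?thesis .
  qed
  \<comment> \<open>For exponent 0 this is \<open>\<xi> ^ ord_s H = 1\<close>, the wrap-around built
    into \<open>coexponent\<close>.\<close>
  have co: "\<xi> * \<xi> ^ coexponent H = \<xi> ^ exponent H"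
  proof (cases "exponent H = 0")
    case True
    have "\<xi> ^ ord_s H = 1" by (simp add: \<xi>(2))
    then show ?thesis using True ord_s_pos[OF H] by (simp add: coexponent_def flip: power_Suc)
  next
    case False
    then show ?thesis by (simp add: coexponent_def flip: power_Suc)
  qed
  have co_lt: "coexponent H < ord_s H" using a(1) ord_s_pos[OF H] by (auto simp: coexponent_def)
  have ne1: "\<xi> ^ k \<noteq> 1" if "0 < k" "k < ord_s H" for k
    using that by (auto simp: \<xi>(2) dest: dvd_imp_le)
  have div: "pdvd (\<alpha> H ^ k) f" if k: "k < ord_s H" and f: "f \<in> polynomials"
    "\<And>v. f (matrix_inv (s H) *v v) = \<xi> ^ k * f v" for k f
    unfolding pdvd_def
    by (rule eigenfunction_divisible[OF lin \<alpha>_nonzero[OF H] fixH \<alpha>\<xi> \<xi>(1) _ f polynomials_matrix])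
      (use ne1 k in auto)
  show ?thesis
  proof (rule that[OF P(1,2) e(1)])
    fix \<omega> I assume \<omega>: "chi_invariant \<omega>"
    define c where "c = lam (const_mat P') \<omega>"
    have c_pol: "poly_form c"
      unfolding c_def by (intro poly_form_lam polynomials_const_mat chi_invariant_poly \<omega>)
    have \<omega>c: "\<omega> = lam (const_mat P) c" by (simp add: c_def lam_const_inverse[OF P(2)])
    have inj: "c1 = c2" if "lam (const_mat P) c1 = lam (const_mat P) c2" for c1 c2
      using arg_cong[OF that, of "lam (const_mat P')"] by (simp add: lam_const_inverse[OF P(1)])
    have "lam (const_mat P) (\<lambda>I. (\<lambda>v. if i0 \<in> I then \<xi> else 1) * act (s H) (c I)) =
        lam (const_mat P) (scale (\<lambda>v. \<theta> (s H)) c)"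
      using \<omega> s(1) act_frame[of c] by (simp add: chi_invariant_def lam_scale flip: \<omega>c)
    then have "(\<lambda>I. (\<lambda>v. if i0 \<in> I then \<xi> else 1) * act (s H) (c I)) = scale (\<lambda>v. \<theta> (s H)) c"
      by (rule inj)
    from fun_cong[OF fun_cong[OF this, of I]]
    have "((\<lambda>v. if i0 \<in> I then \<xi> else 1) * act (s H) (c I)) v = scale (\<lambda>v. \<theta> (s H)) c I v" for v .
    then have eig: "(if i0 \<in> I then \<xi> else 1) * c I (matrix_inv (s H) *v v) = \<xi> ^ exponent H * c I v" for v
      by (simp add: act_def a(2))
    have "pdvd (\<alpha> H ^ (if i0 \<in> I then coexponent H else exponent H)) (c I)"
    proof (rule div)
      show "(if i0 \<in> I then coexponent H else exponent H) < ord_s H" using co_lt a(1) by simp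
      show "c I \<in> polynomials" using c_pol by (simp add: poly_form_def)
      show "c I (matrix_inv (s H) *v v) = \<xi> ^ (if i0 \<in> I then coexponent H else exponent H) * c I v" for v
        using eig[of v] \<xi>(1) by (auto simp: mult.assoc simp flip: co)
    qed
    then show "pdvd (\<alpha> H ^ (if i0 \<in> I then coexponent H else exponent H)) (lam (const_mat P') \<omega> I)"
      by (simp add: c_def)
  next
    fix i g assume g: "g \<in> pointwise_stabilizer G H"
    let ?m = "if i = i0 then coexponent H else exponent H"
    have row: "scale (\<alpha> H ^ ?m) (row_form (const_mat P) i) = lam (const_mat P) (scale (\<alpha> H ^ ?m) (ext_basis {i}))"
      by (simp add: lam_scale)
    have "(\<lambda>I. (\<lambda>v. if i0 \<in> I then \<xi> else 1) * act (s H) (scale (\<alpha> H ^ ?m) (ext_basis {i}) I)) =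
        scale (\<lambda>v. \<theta> (s H)) (scale (\<alpha> H ^ ?m) (ext_basis {i}))" (is "?l = ?r")
    proof (intro ext)
      fix I v
      have m: "(if i0 = i then \<xi> else 1) * \<xi> ^ ?m = \<theta> (s H)" by (auto simp: a(2) co)
      show "?l I v = ?r I v"
      proof (cases "I = {i}")
        case True
        have "?l I v = ((if i0 = i then \<xi> else 1) * \<xi> ^ ?m) * \<alpha> H v ^ ?m"
          by (simp add: True ext_basis_def act_def power_fun_apply \<alpha>\<xi> power_mult_distrib)
        also have "\<dots> = ?r I v" unfolding m by (simp add: True ext_basis_def power_fun_apply)
        finally show ?thesis .
      qed (simp add: ext_basis_def)
    qed
    then have "act_form (s H) (scale (\<alpha> H ^ ?m) (row_form (const_mat P) i)) =
        scale (\<lambda>v. \<theta> (s H)) (scale (\<alpha> H ^ ?m) (row_form (const_mat P) i))"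
      unfolding row act_frame lam_scale[symmetric] by simp
    then show "act_form g (scale (\<alpha> H ^ ?m) (row_form (const_mat P) i)) =
        scale (\<lambda>v. \<theta> g) (scale (\<alpha> H ^ ?m) (row_form (const_mat P) i))"
      by (rule stabilizer_eigenform[OF H _ g])
  qed
qed

text \<open>The transversal index i0 lies in at most one of I and L - I. The coefficient at the
  other set alone carries the full power \<open>\<alpha> H ^ exponent H\<close>.\<close>

lemma wedge_divisible_local:
  assumes H: "H \<in> arrangement" and \<mu>: "chi_invariant \<mu>" and \<omega>: "chi_invariant \<omega>"
  shows "pdvd (\<alpha> H ^ exponent H) (wedge \<mu> \<omega> K)"
proof -
  obtain P P' :: "'n cmat" and i0 e where P: "P ** P' = mat 1" "P' ** P = mat 1"
    and div: "\<And>\<omega> I. chi_invariant \<omega> \<Longrightarrow>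
      pdvd (\<alpha> H ^ (if i0 \<in> I then coexponent H else exponent H)) (lam (const_mat P') \<omega> I)"
    using local_frame[OF H] by metis
  let ?c = "lam (const_mat P') \<mu>" and ?d = "lam (const_mat P') \<omega>"
  have pol: "?c I \<in> polynomials" "?d I \<in> polynomials" for I
    using poly_form_lam[OF polynomials_const_mat chi_invariant_poly[OF \<mu>]]
      poly_form_lam[OF polynomials_const_mat chi_invariant_poly[OF \<omega>]] by (auto simp: poly_form_def)
  have prod: "pdvd (\<alpha> H ^ exponent H) (?c I * ?d (L - I))" for I L
  proof (cases "i0 \<in> I")
    case True
    then show ?thesis using div[OF \<omega>, of "L - I"] pol by (simp add: pdvd_mult_left)
  next
    case False
    then show ?thesis using div[OF \<mu>, of I] pol by (simp add: pdvd_mult_right)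
  qed
  have "pdvd (\<alpha> H ^ exponent H) (wedge ?c ?d L)" for L
    unfolding wedge_inversions
    by (rule pdvd_sum, rule pdvd_mult_left[OF prod polynomials_neg_one_power])
  then have "pdvd (\<alpha> H ^ exponent H) (lam (const_mat P) (wedge ?c ?d) K)"
    by (rule pdvd_lam_const)
  then show ?thesis by (simp add: lam_wedge lam_const_inverse[OF P(2)])
qed

section \<open>The semi-invariant and the twisted product\<close>

abbreviation Q :: "'n cvec \<Rightarrow> complex" where
  "Q \<equiv> Q_poly G \<theta> s \<alpha>"

text \<open>This is Q for the character \<theta> times det. The volume form is multiplied by the
  inverse determinant, so a top form is semi-invariant for \<theta> if and only if its coefficient
  is semi-invariant for that product.\<close>

definition Q_dual :: "'n cvec \<Rightarrow> complex" where
  "Q_dual = (\<Prod>H\<in>arrangement. \<alpha> H ^ coexponent H)"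

lemma arrangement_prod_poly: "(\<Prod>H\<in>A. \<alpha> H ^ m H) \<in> polynomials" if "A \<subseteq> arrangement"
  using that \<alpha>_poly by (intro polynomials_prod polynomials_power) blast

lemma arrangement_prod_nonzero: "(\<Prod>H\<in>A. \<alpha> H ^ m H) \<noteq> 0" if "A \<subseteq> arrangement"
  by (intro poly_prod_nonzero conjI polynomials_power poly_power_nonzero finite_subset[OF that finite_arrangement])
    (use that \<alpha>_poly \<alpha>_nonzero in blast)+

lemma arrangement_prod_pdvd:
  assumes "f \<in> polynomials" "\<And>H. H \<in> arrangement \<Longrightarrow> pdvd (\<alpha> H ^ m H) f"
  shows "pdvd (\<Prod>H\<in>arrangement. \<alpha> H ^ m H) f"
  unfolding pdvd_def
  by (rule prod_divides[OF finite_arrangement assms(1)])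
    (use \<alpha>_linear \<alpha>_nonzero arrangement_independent assms(2) in \<open>auto simp: pdvd_def\<close>)

lemma Q_polynomial: "Q \<in> polynomials" and Q_nonzero: "Q \<noteq> 0"
  unfolding Q_poly_def by (rule arrangement_prod_poly[OF subset_refl], rule arrangement_prod_nonzero[OF subset_refl])

lemma hyperplane_image:
  assumes H: "H \<in> arrangement" and g: "g \<in> G"
  shows "(\<lambda>v. g *v v) ` H \<in> arrangement"
    and "\<exists>c. c \<noteq> 0 \<and> act g (\<alpha> H) = (\<lambda>v. c) * \<alpha> ((\<lambda>v. g *v v) ` H)"
proof -
  let ?gH = "(\<lambda>v. g *v v) ` H"
  have inv: "g *v (matrix_inv g *v v) = v" "matrix_inv g *v (g *v v) = v" for v
    using matrix_inv_mult_vec[OF G_mult_inv(1)[OF g]] matrix_inv_mult_vec[OF G_mult_inv(2)[OF g]] by auto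
  have lin: "linear_form (act g (\<alpha> H))" unfolding act_def by (rule linear_form_matrix[OF \<alpha>_linear[OF H]])
  obtain x where "\<alpha> H x \<noteq> 0" using \<alpha>_nonzero[OF H] by (auto simp: fun_eq_iff)
  then have "act g (\<alpha> H) (g *v x) \<noteq> 0 (g *v x)" by (simp add: act_def inv)
  then have nz: "act g (\<alpha> H) \<noteq> 0" by metis
  have ker: "act g (\<alpha> H) v = 0 \<longleftrightarrow> v \<in> ?gH" for v
    unfolding act_def \<alpha>_zero_iff[OF H] by (metis (no_types, lifting) imageE imageI inv)
  then have "{v. act g (\<alpha> H) v = 0} = ?gH" by blast
  then have hyp: "hyperplane ?gH" using hyperplane_kernel[OF lin nz] by simp
  show gH: "?gH \<in> arrangement"
  proof (rule reflectionI(2)[OF _ _ hyp])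
    show "g ** s H ** matrix_inv g \<in> G" by (intro G_mult G_inv g s_stabilizes(1)[OF H])
    show "g ** s H ** matrix_inv g \<noteq> mat 1"
    proof
      assume "g ** s H ** matrix_inv g = mat 1"
      then have "s H *v v = v" for v
        by (metis inv(2) matrix_vector_mul_assoc matrix_vector_mul_lid)
      then have "s H = mat 1" by (simp add: matrix_eq)
      with s_nontrivial[OF H] show False by simp
    qed
    show "(g ** s H ** matrix_inv g) *v v = v" if "v \<in> ?gH" for v
      using that s_stabilizes(2)[OF H] by (auto simp: inv simp flip: matrix_vector_mul_assoc)
  qed
  obtain c where c: "\<And>v. act g (\<alpha> H) v = c * \<alpha> ?gH v"
    using linear_form_proportional[OF \<alpha>_linear[OF gH] lin \<alpha>_nonzero[OF gH]] ker \<alpha>_zero_iff[OF gH] by blast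
  then have eq: "act g (\<alpha> H) = (\<lambda>v. c) * \<alpha> ?gH" by (simp add: fun_eq_iff)
  moreover have "c \<noteq> 0"
  proof
    assume "c = 0"
    then have "act g (\<alpha> H) = 0" using c by (simp add: fun_eq_iff)
    with nz show False ..
  qed
  ultimately show "\<exists>c. c \<noteq> 0 \<and> act g (\<alpha> H) = (\<lambda>v. c) * \<alpha> ?gH" by blast
qed

lemma image_image_inv:
  assumes "g \<in> G" shows "(\<lambda>v. matrix_inv g *v v) ` (\<lambda>v. g *v v) ` H = H"
  by (simp add: image_image matrix_inv_mult_vec[OF G_mult_inv(2)[OF assms]])

text \<open>Conjugation by g identifies the two stabilizers and does not change \<theta>, and the
  linear form of the image is a multiple of the transported one. Hence the exponent of H also works
  for the image, and minimality gives the inequality; the converse is the same statement for the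
  inverse of g.\<close>

lemma exponent_image_le:
  assumes H: "H \<in> arrangement" and g: "g \<in> G"
  shows "exponent ((\<lambda>v. g *v v) ` H) \<le> exponent H"
proof (rule exponent_iff(2)[OF hyperplane_image(1)[OF H g]], rule ballI)
  let ?gH = "(\<lambda>v. g *v v) ` H"
  let ?b = "exponent H"
  fix h assume h: "h \<in> pointwise_stabilizer G ?gH"
  then have hG: "h \<in> G" by (simp add: pointwise_stabilizer_def)
  obtain c where c: "c \<noteq> 0" "act g (\<alpha> H) = (\<lambda>v. c) * \<alpha> ?gH" using hyperplane_image(2)[OF H g] by blast
  have \<alpha>g: "\<alpha> ?gH ^ ?b = (\<lambda>v. inverse c ^ ?b) * act g (\<alpha> H ^ ?b)"
    using c(1) unfolding act_power c(2) by (simp add: fun_eq_iff power_fun_apply power_mult_distrib power_inverse)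
  let ?k = "matrix_inv g ** h ** g"
  have kG: "?k \<in> G" by (intro G_mult G_inv g hG)
  have "?k *v v = v" if "v \<in> H" for v
  proof -
    have "h *v (g *v v) = g *v v" using h that by (auto simp: pointwise_stabilizer_def)
    then show ?thesis
      by (simp add: matrix_inv_mult_vec[OF G_mult_inv(2)[OF g]] flip: matrix_vector_mul_assoc)
  qed
  with kG have "?k \<in> pointwise_stabilizer G H" by (simp add: pointwise_stabilizer_def)
  then have k: "act ?k (\<alpha> H ^ ?b) = (\<lambda>v. \<theta> ?k) * \<alpha> H ^ ?b" using exponent_iff(1)[OF H] by blast
  have "g ** ?k = g ** matrix_inv g ** h ** g" by (simp only: matrix_mul_assoc)
  then have gk: "h ** g = g ** ?k" by (simp add: G_mult_inv[OF g])
  have "\<theta> g * \<theta> ?k = \<theta> (h ** g)" unfolding gk by (rule \<theta>_mult[OF g kG, symmetric])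
  also have "\<dots> = \<theta> g * \<theta> h" by (simp add: \<theta>_mult hG g mult.commute)
  finally have \<theta>k: "\<theta> ?k = \<theta> h" using \<theta>_nonzero[OF g] by simp
  have "act h (act g (\<alpha> H ^ ?b)) = act g (act ?k (\<alpha> H ^ ?b))"
    using gk by (simp add: act_compose G_unitary hG g kG)
  also have "\<dots> = (\<lambda>v. \<theta> h) * act g (\<alpha> H ^ ?b)" unfolding k \<theta>k by (simp add: act_mult act_const)
  finally show "act h (\<alpha> ?gH ^ ?b) = (\<lambda>v. \<theta> h) * \<alpha> ?gH ^ ?b"
    unfolding \<alpha>g act_mult act_const by (simp add: mult.left_commute)
qed

lemma exponent_image:
  assumes H: "H \<in> arrangement" and g: "g \<in> G"
  shows "exponent ((\<lambda>v. g *v v) ` H) = exponent H"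
  using exponent_image_le[OF H g] exponent_image_le[OF hyperplane_image(1)[OF H g] G_inv[OF g]]
  by (simp add: image_image_inv[OF g])

text \<open>The cofactor of \<open>\<alpha> K ^ exponent K\<close> is multiplied by a scalar, which is \<open>1\<close> because the
  cofactor does not vanish identically on \<open>K\<close>.\<close>

lemma Q_semi_invariant_reflection:
  assumes K: "K \<in> arrangement" and t: "t \<in> G" "\<And>v. v \<in> K \<Longrightarrow> t *v v = v"
  shows "act t Q = (\<lambda>v. \<theta> t) * Q"
proof -
  let ?t = "\<lambda>H. (\<lambda>v. t *v v) ` H"
  let ?P = "\<Prod>H\<in>arrangement - {K}. \<alpha> H ^ exponent H"
  have tK: "?t K = K" using t(2) by force
  have "bij_betw ?t arrangement arrangement"
    using hyperplane_image(1) image_image_inv[OF t(1)] image_image_inv[OF G_inv[OF t(1)]] t(1) G_inv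
    by (intro bij_betw_byWitness[where f' = "\<lambda>H. (\<lambda>v. matrix_inv t *v v) ` H"])
      (auto simp: G_mult_inv)
  then have bij: "bij_betw ?t (arrangement - {K}) (arrangement - {K})"
    using bij_betw_DiffI[of ?t arrangement arrangement "{K}" "{K}"] K tK
    by (auto simp: bij_betw_def)
  obtain c where c: "\<And>H. H \<in> arrangement \<Longrightarrow> act t (\<alpha> H) = (\<lambda>v. c H) * \<alpha> (?t H)"
    using hyperplane_image(2)[OF _ t(1)] by metis
  define C where "C = (\<Prod>H\<in>arrangement - {K}. c H ^ exponent H)"
  have "act t ?P = (\<Prod>H\<in>arrangement - {K}. (\<lambda>v. c H ^ exponent H) * \<alpha> (?t H) ^ exponent (?t H))"
    unfolding act_prod act_power
    by (rule prod.cong) (auto simp: c exponent_image t(1) power_fun_apply power_mult_distrib fun_eq_iff)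
  also have "\<dots> = (\<lambda>v. C) * (\<Prod>H\<in>arrangement - {K}. \<alpha> (?t H) ^ exponent (?t H))"
    by (simp add: prod.distrib C_def fun_eq_iff prod_fun_apply)
  also have "(\<Prod>H\<in>arrangement - {K}. \<alpha> (?t H) ^ exponent (?t H)) = ?P"
    by (rule prod.reindex_bij_betw[OF bij])
  finally have tP: "act t ?P = (\<lambda>v. C) * ?P" .
  have "\<exists>v. \<alpha> K v = 0 \<and> ?P v \<noteq> 0"
  proof (rule nonvanishing_prod[OF \<alpha>_linear[OF K]])
    show "finite (arrangement - {K})" using finite_arrangement by simp
    fix H assume "H \<in> arrangement - {K}"
    then have H: "H \<in> arrangement" "H \<noteq> K" by auto
    obtain v where "\<alpha> K v = 0" "\<alpha> H v \<noteq> 0" using arrangement_independent[OF H(1) K H(2)] by blast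
    then show "\<alpha> H ^ exponent H \<in> polynomials \<and> (\<exists>v. \<alpha> K v = 0 \<and> (\<alpha> H ^ exponent H) v \<noteq> 0)"
      using polynomials_power[OF \<alpha>_poly[OF H(1)]] by (auto simp: power_fun_apply)
  qed
  then obtain v where v: "\<alpha> K v = 0" "?P v \<noteq> 0" by blast
  have "act t ?P v = ?P v"
    using v(1) t matrix_inv_fixes[OF t(1)] \<alpha>_zero_iff[OF K] by (simp add: act_def)
  then have "C = 1" using v(2) unfolding tP by simp
  then have tP1: "act t ?P = ?P" using tP by (simp add: fun_eq_iff)
  have "t \<in> pointwise_stabilizer G K" using t by (simp add: pointwise_stabilizer_def)
  then have tK: "act t (\<alpha> K ^ exponent K) = (\<lambda>v. \<theta> t) * \<alpha> K ^ exponent K"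
    using exponent_iff(1)[OF K] by blast
  have "Q = \<alpha> K ^ exponent K * ?P"
    unfolding Q_poly_def by (rule prod.remove[OF finite_arrangement K])
  then show ?thesis by (simp only: act_mult tK tP1 mult.assoc)
qed

lemma Q_semi_invariant: "g \<in> G \<Longrightarrow> act g Q = (\<lambda>v. \<theta> g) * Q"
proof (induction rule: G_induct)
  case one
  have "act (mat 1) Q = (\<lambda>v. \<theta> (mat 1)) * Q" by (simp add: act_mat_one \<theta>_one fun_eq_iff)
  then show ?case .
next
  case (refl t)
  then obtain K where "K \<in> arrangement" "\<And>v. v \<in> K \<Longrightarrow> t *v v = v" by (rule reflection_hyperplane) blast
  then show ?case using Q_semi_invariant_reflection[OF _ \<open>t \<in> G\<close>] by blast
next
  case (inv t)
  then obtain K where "K \<in> arrangement" "\<And>v. v \<in> K \<Longrightarrow> t *v v = v" by (rule reflection_hyperplane) blast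
  then show ?case
    using Q_semi_invariant_reflection[OF _ G_inv[OF \<open>t \<in> G\<close>]] matrix_inv_fixes[OF \<open>t \<in> G\<close>] by blast
next
  case (mult g h)
  have "act (g ** h) Q = act g (act h Q)" using mult.hyps by (simp add: act_compose G_unitary)
  also have "act h Q = (\<lambda>v. \<theta> h) * Q" by (rule mult.IH(2))
  also have "act g ((\<lambda>v. \<theta> h) * Q) = (\<lambda>v. \<theta> h) * act g Q" by (simp add: act_mult act_const)
  also have "act g Q = (\<lambda>v. \<theta> g) * Q" by (rule mult.IH(1))
  finally have "act (g ** h) Q = (\<lambda>v. \<theta> (g ** h)) * Q"
    using mult.hyps by (simp add: \<theta>_mult fun_eq_iff)
  then show ?case .
qed

lemma chi_invariant_unit: "chi_invariant (degree0 Q)"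
proof -
  have "poly_form (degree0 Q)" by (simp add: degree0_scale poly_form_scale poly_form_basis Q_polynomial)
  moreover have "act_form g (degree0 Q) = scale (\<lambda>v. \<theta> g) (degree0 Q)" if "g \<in> G" for g
    by (simp only: act_form_degree0 Q_semi_invariant[OF that]) (simp add: degree0_scale scale_scale)
  ultimately show ?thesis by (simp add: chi_invariant_def)
qed

lemma scale_cancel:
  assumes "poly_form \<mu>" "poly_form \<omega>" "f \<in> polynomials" "f \<noteq> 0" "scale f \<mu> = scale f \<omega>"
  shows "\<mu> = \<omega>"
proof
  fix I
  have "f * \<mu> I = f * \<omega> I" using fun_cong[OF assms(5), of I] by simp
  then show "\<mu> I = \<omega> I"
    by (rule poly_cancel_left[OF assms(3) assms(1,2)[unfolded poly_form_def, THEN spec] assms(4)])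
qed

lemma chi_wedge_eqI:
  assumes "poly_form \<eta>" "scale Q \<eta> = wedge \<mu> \<omega>"
  shows "chi_wedge Q \<mu> \<omega> = \<eta>"
  unfolding chi_wedge_def
proof (rule the_equality)
  show "(\<forall>I. \<eta> I \<in> polynomials) \<and> scale Q \<eta> = wedge \<mu> \<omega>" using assms by (simp add: poly_form_def)
  fix \<eta>' assume "(\<forall>I. \<eta>' I \<in> polynomials) \<and> scale Q \<eta>' = wedge \<mu> \<omega>"
  then show "\<eta>' = \<eta>"
    using assms by (intro scale_cancel[OF _ assms(1) Q_polynomial Q_nonzero]) (auto simp: poly_form_def)
qed

text \<open>The powers of the pairwise coprime \<alpha> H divide every coefficient, hence so does Q.
  The wedge product transforms by the square of \<theta> and Q by \<theta>, so the quotient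
  transforms by \<theta>.\<close>

lemma chi_wedge_props:
  assumes \<mu>: "chi_invariant \<mu>" and \<omega>: "chi_invariant \<omega>"
  shows "chi_invariant (chi_wedge Q \<mu> \<omega>)" "scale Q (chi_wedge Q \<mu> \<omega>) = wedge \<mu> \<omega>"
proof -
  have pol: "poly_form (wedge \<mu> \<omega>)" by (intro poly_form_wedge chi_invariant_poly \<mu> \<omega>)
  have "\<exists>h\<in>polynomials. wedge \<mu> \<omega> I = Q * h" for I
    using arrangement_prod_pdvd[of "wedge \<mu> \<omega> I" exponent] wedge_divisible_local[OF _ \<mu> \<omega>] pol
    by (simp add: poly_form_def pdvd_def Q_poly_def)
  then obtain \<eta> where \<eta>: "\<And>I. \<eta> I \<in> polynomials" "\<And>I. wedge \<mu> \<omega> I = Q * \<eta> I" by metis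
  have pf: "poly_form \<eta>" using \<eta>(1) by (simp add: poly_form_def)
  have eq: "scale Q \<eta> = wedge \<mu> \<omega>" by (rule ext) (simp add: \<eta>(2))
  have ch: "chi_wedge Q \<mu> \<omega> = \<eta>" by (rule chi_wedge_eqI[OF pf eq])
  show "scale Q (chi_wedge Q \<mu> \<omega>) = wedge \<mu> \<omega>" by (simp add: ch eq)
  have "act_form g \<eta> = scale (\<lambda>v. \<theta> g) \<eta>" if g: "g \<in> G" for g
  proof (rule scale_cancel[OF _ _ _ _])
    let ?f = "(\<lambda>v. \<theta> g) * Q"
    show "poly_form (act_form g \<eta>)" "poly_form (scale (\<lambda>v. \<theta> g) \<eta>)"
      by (intro poly_form_act pf poly_form_scale polynomials.const)+
    show "?f \<in> polynomials" by (intro polynomials_mult polynomials.const Q_polynomial)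
    obtain v where "Q v \<noteq> 0" using Q_nonzero by (auto simp: fun_eq_iff)
    then have "?f v \<noteq> 0 v" using \<theta>_nonzero[OF g] by simp
    then show "?f \<noteq> 0" by metis
    have "scale ?f (act_form g \<eta>) = act_form g (scale Q \<eta>)"
      by (simp add: act_form_scale Q_semi_invariant[OF g])
    also have "\<dots> = scale (\<lambda>v. \<theta> g) (scale (\<lambda>v. \<theta> g) (wedge \<mu> \<omega>))"
      using \<mu> \<omega> g by (simp add: eq act_form_wedge chi_invariant_def wedge_scale_left wedge_scale_right)
    also have "\<dots> = scale ?f (scale (\<lambda>v. \<theta> g) \<eta>)"
      by (simp add: scale_scale mult_ac flip: eq)
    finally show "scale ?f (act_form g \<eta>) = scale ?f (scale (\<lambda>v. \<theta> g) \<eta>)" .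
  qed
  then show "chi_invariant (chi_wedge Q \<mu> \<omega>)" using pf by (simp add: ch chi_invariant_def)
qed

end

section \<open>The top exterior product of the generators\<close>

lemma wedge_basis_compl:
  fixes \<mu> :: "'n::{finite,linorder} set \<Rightarrow> 'r::comm_ring_1"
  shows "wedge \<mu> (ext_basis (- J)) UNIV = (- 1) ^ inversions J (- J) * \<mu> J"
proof -
  have "wedge \<mu> (ext_basis (- J)) UNIV = (\<Sum>I\<in>UNIV. if I = J then (- 1) ^ inversions J (- J) * \<mu> J else 0)"
    unfolding wedge_inversions Pow_UNIV
  proof (rule sum.cong[OF HOL.refl])
    fix I :: "'n set"
    have "UNIV - I = - J \<longleftrightarrow> I = J" by blast
    then show "(- 1) ^ inversions I (UNIV - I) * (\<mu> I * ext_basis (- J) (UNIV - I)) =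
        (if I = J then (- 1) ^ inversions J (- J) * \<mu> J else 0)"
      by (auto simp: ext_basis_def Compl_eq_Diff_UNIV)
  qed
  then show ?thesis by simp
qed

text \<open>The inverse by cofactors. Row k times the product of all rows except row i is the
  determinant up to sign for k = i and contains a repeated row otherwise; the sign enters twice and
  cancels.\<close>

lemma ext_det_invertible:
  fixes A :: "'n::{finite,linorder} \<Rightarrow> 'n \<Rightarrow> 'k::field"
  assumes D: "ext_det A \<noteq> 0"
  obtains B where "mat_prod B A = diag (\<lambda>_. 1)"
proof -
  let ?\<sigma> = "\<lambda>i. (- 1) ^ inversions {i} (- {i}) :: 'k"
  define B where "B j i = ?\<sigma> i / ext_det A * wedge (ext_basis {j}) (row_wedge A (- {i})) UNIV" for j i
  have "mat_prod A B k i = diag (\<lambda>_. 1) k i" for k i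
  proof -
    have "mat_prod A B k i = ?\<sigma> i / ext_det A * (\<Sum>j\<in>UNIV. A k j * wedge (ext_basis {j}) (row_wedge A (- {i})) UNIV)"
      by (simp add: mat_prod_def B_def sum_distrib_left mult_ac)
    also have "(\<Sum>j\<in>UNIV. A k j * wedge (ext_basis {j}) (row_wedge A (- {i})) UNIV) =
        wedge (row_form A k) (row_wedge A (- {i})) UNIV"
      by (simp add: row_form_def wedge_sum_left wedge_scale_left sum_fun_apply)
    also have "\<dots> = (if k = i then ?\<sigma> i * ext_det A else 0)"
    proof (cases "k = i")
      case True
      have "insert i (- {i}) = UNIV" by blast
      then show ?thesis using True by (simp add: row_form_wedge_row_wedge ext_det_def)
    qed (simp add: row_form_wedge_row_wedge)
    finally show ?thesis using D by (simp add: diag_def power_mult_distrib[symmetric])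
  qed
  then have "mat_prod A B = diag (\<lambda>_. 1)" by (intro ext)
  from that[OF mat_prod_inverse_commute[OF this]] show ?thesis .
qed

lemma mat_prod_diag_left: "mat_prod (diag d) B = (\<lambda>i j. d i * B i j)"
  by (simp add: mat_prod_def diag_def fun_eq_iff if_distrib[of "\<lambda>x. x * _"] cong: if_cong)

lemma pline_sum:
  "(\<And>x. x \<in> X \<Longrightarrow> f x \<in> polynomials) \<Longrightarrow> pline (\<Sum>x\<in>X. f x) v w = (\<Sum>x\<in>X. pline (f x) v w)"
  by (rule pline_unique) (simp add: poly_sum sum_fun_apply)

lemma pline_power: "f \<in> polynomials \<Longrightarrow> pline (f ^ k) v w = pline f v w ^ k"
  by (rule pline_unique) (simp add: poly_power power_fun_apply)

lemma polynomials_ext_det: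
  fixes A :: "'n::{finite,linorder} \<Rightarrow> 'n \<Rightarrow> 'n cvec \<Rightarrow> complex"
  shows "(\<And>i j. A i j \<in> polynomials) \<Longrightarrow> ext_det A \<in> polynomials"
  using poly_form_row_wedge[of A UNIV] by (simp add: ext_det_def poly_form_def)

lemma pline_ext_det:
  fixes A :: "'n::{finite,linorder} \<Rightarrow> 'n \<Rightarrow> 'n cvec \<Rightarrow> complex"
  assumes "\<And>i j. A i j \<in> polynomials"
  shows "pline (ext_det A) v w = ext_det (\<lambda>i j. pline (A i j) v w)"
  by (rule pline_unique) (simp add: ext_det_poly ext_det_eval[of A] assms)

lemma row_form_of_one_form:
  assumes "\<And>I. card I \<noteq> 1 \<Longrightarrow> \<omega> I = 0"
  shows "\<omega> = row_form (\<lambda>_ j. \<omega> {j}) i"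
proof
  fix I show "\<omega> I = row_form (\<lambda>_ j. \<omega> {j}) i I"
    using assms[of I] row_form_card[of I]
    by (cases "card I = 1") (auto simp: card_1_singleton_iff)
qed

section \<open>Generic points\<close>

context reflection_data
begin

text \<open>Stated through stabilizers, since \<open>local_determinant\<close> asks for an
  eigenvalue equation under the elements that fix v; for a point on H these equations come from
  \<open>local_frame\<close>.\<close>

definition generic :: "'n cvec \<Rightarrow> bool" where
  "generic v \<longleftrightarrow> (\<forall>g\<in>G. g *v v = v \<longrightarrow> g = mat 1) \<or>
    (\<exists>H\<in>arrangement. v \<in> H \<and> (\<forall>g\<in>G. g *v v = v \<longrightarrow> g \<in> pointwise_stabilizer G H))"

text \<open>The fixed space is the common kernel of the components of \<open>g *v v - v\<close>.
  Were all of them multiples of one, g would fix a hyperplane pointwise, and that hyperplane would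
  belong to the arrangement.\<close>

lemma fixed_space_codim_two:
  assumes g: "g \<in> G" "g \<noteq> mat 1" and nf: "\<And>H. H \<in> arrangement \<Longrightarrow> \<exists>v\<in>H. g *v v \<noteq> v"
  shows "\<exists>f k. linear_form f \<and> linear_form k \<and> f \<noteq> 0 \<and> (\<forall>c. \<exists>v. k v \<noteq> c * f v)
    \<and> (\<forall>v. g *v v = v \<longrightarrow> f v = 0 \<and> k v = 0)"
proof -
  let ?l = "\<lambda>i v. (g *v v - v) $ i"
  have lin: "linear_form (?l i)" for i
    by (rule linear_formI) (simp_all add: matrix_vector_right_distrib vector_scalar_commute right_diff_distrib)
  have fixed: "?l i v = 0" if "g *v v = v" for i v using that by simp
  obtain v where "g *v v \<noteq> v" using g(2) by (auto simp: matrix_eq)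
  then obtain i where "?l i v \<noteq> 0 v" by (auto simp: vec_eq_iff)
  then have nz: "?l i \<noteq> 0" by metis
  have "\<exists>j. \<forall>c. \<exists>v. ?l j v \<noteq> c * ?l i v"
  proof (rule ccontr)
    assume *: "\<not> ?thesis"
    have "g *v v = v" if "?l i v = 0" for v
    proof -
      have "?l j v = 0" for j using * that by (metis mult_zero_right)
      then show ?thesis by (simp add: vec_eq_iff)
    qed
    then have fix_ker: "\<And>v. v \<in> {v. ?l i v = 0} \<Longrightarrow> g *v v = v" by blast
    have "{v. ?l i v = 0} \<in> arrangement"
      by (rule reflectionI(2)[OF g hyperplane_kernel[OF lin nz] fix_ker])
    from nf[OF this] fix_ker show False by blast
  qed
  then obtain j where "\<And>c. \<exists>v. ?l j v \<noteq> c * ?l i v" by blast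
  with lin nz fixed show ?thesis by (intro exI[of _ "?l i"] exI[of _ "?l j"] conjI allI impI) simp_all
qed

text \<open>The zero locus of a nonconstant polynomial has codimension one, so that it is not contained in
  the union of the finitely many subspaces of codimension two avoided by generic points.\<close>

lemma generic_zero:
  assumes r: "r \<in> polynomials" and nc: "\<And>c. r \<noteq> (\<lambda>v. c)"
  obtains v where "r v = 0" "generic v"
proof -
  let ?B = "{g \<in> G. g \<noteq> mat 1 \<and> (\<forall>H\<in>arrangement. \<exists>v\<in>H. g *v v \<noteq> v)}"
  let ?ok = "\<lambda>f k. linear_form f \<and> linear_form k \<and> f \<noteq> 0 \<and> (\<forall>c. \<exists>v. k v \<noteq> c * f v)"
  have "\<forall>g\<in>?B. \<exists>fk. ?ok (fst fk) (snd fk) \<and> (\<forall>v. g *v v = v \<longrightarrow> fst fk v = 0 \<and> snd fk v = 0)"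
  proof
    fix g assume g: "g \<in> ?B"
    obtain f k where "?ok f k" "\<forall>v. g *v v = v \<longrightarrow> f v = 0 \<and> k v = 0"
      using fixed_space_codim_two[of g] g by blast
    then show "\<exists>fk. ?ok (fst fk) (snd fk) \<and> (\<forall>v. g *v v = v \<longrightarrow> fst fk v = 0 \<and> snd fk v = 0)"
      by (intro exI[of _ "(f, k)"]) simp
  qed
  from bchoice[OF this] obtain pr where
    "\<forall>g\<in>?B. ?ok (fst (pr g)) (snd (pr g)) \<and> (\<forall>v. g *v v = v \<longrightarrow> fst (pr g) v = 0 \<and> snd (pr g) v = 0)" ..
  then have pr: "\<And>g. g \<in> ?B \<Longrightarrow> ?ok (fst (pr g)) (snd (pr g))"
    "\<And>g v. g \<in> ?B \<Longrightarrow> g *v v = v \<Longrightarrow> fst (pr g) v = 0 \<and> snd (pr g) v = 0"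
    by blast+
  \<comment> \<open>Pairs of independent linear forms whose common zeros are to be avoided: those of
    two different hyperplanes, and two equations valid on the fixed space of a nontrivial element
    that fixes no hyperplane of the arrangement pointwise.\<close>
  define L where "L = (\<lambda>(H, K). (\<alpha> H, \<alpha> K)) ` {(H, K). H \<in> arrangement \<and> K \<in> arrangement \<and> H \<noteq> K} \<union> pr ` ?B"
  have "finite {(H, K). H \<in> arrangement \<and> K \<in> arrangement \<and> H \<noteq> K}"
    by (rule finite_subset[of _ "arrangement \<times> arrangement"]) (use finite_arrangement in auto)
  then have finL: "finite L" using finite_G by (simp add: L_def)
  have ok: "?ok f k" if fk: "(f, k) \<in> L" for f k
  proof (cases "(f, k) \<in> pr ` ?B")
    case True
    then obtain g where g: "g \<in> ?B" "pr g = (f, k)" by (elim imageE) simp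
    from pr(1)[OF g(1)] show ?thesis unfolding g(2) by simp
  next
    case False
    then obtain H K where HK: "H \<in> arrangement" "K \<in> arrangement" "H \<noteq> K" "f = \<alpha> H" "k = \<alpha> K"
      using fk by (auto simp: L_def)
    obtain v where "\<alpha> H v = 0" "\<alpha> K v \<noteq> 0" using arrangement_independent[of K H] HK by blast
    then show ?thesis using HK \<alpha>_linear \<alpha>_nonzero by (auto intro!: exI[of _ v])
  qed
  have cond: "f \<in> polynomials \<and> f \<noteq> 0 \<and> (\<forall>w. f w \<noteq> 0 \<longrightarrow>
      (\<lambda>v. f v * k w - k v * f w) \<in> polynomials \<and> (\<lambda>v. f v * k w - k v * f w) \<noteq> 0)"
    if "(f, k) \<in> L" for f k
  proof (intro conjI allI impI)
    note fk = ok[OF that]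
    show f: "f \<in> polynomials" "f \<noteq> 0" using fk polynomials_linear_form by blast+
    fix w assume w: "f w \<noteq> 0"
    have "f * (\<lambda>v. k w) - k * (\<lambda>v. f w) \<in> polynomials"
      using fk polynomials_linear_form by (intro polynomials_diff polynomials_mult polynomials.const) blast+
    then show "(\<lambda>v. f v * k w - k v * f w) \<in> polynomials" by (simp add: fun_diff_def times_fun_def)
    obtain v where "k v \<noteq> k w / f w * f v" using fk by blast
    then have "(\<lambda>v. f v * k w - k v * f w) v \<noteq> 0 v" using w by (simp add: field_simps)
    then show "(\<lambda>v. f v * k w - k v * f w) \<noteq> 0" by metis
  qed
  obtain v0 w where v0: "\<And>c. \<not> (\<forall>t. r (v0 + t *s w) = c)"
    and avoid: "\<And>f k. (f, k) \<in> L \<Longrightarrow> f v0 * k w - k v0 * f w \<noteq> 0"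
    using poly_avoiding_zero[OF r nc finL cond] by metis
  \<comment> \<open>The fundamental theorem of algebra supplies a zero of r on this line, and the
    whole line avoids the common zeros of the pairs in L.\<close>
  have "\<not> constant (poly (pline r v0 w))"
  proof
    assume "constant (poly (pline r v0 w))"
    then have "r (v0 + t *s w) = r (v0 + 0 *s w)" for t
      unfolding constant_def poly_pline[OF r] by blast
    with v0[of "r (v0 + 0 *s w)"] show False by blast
  qed
  then obtain t where t: "r (v0 + t *s w) = 0"
    using fundamental_theorem_of_algebra[of "pline r v0 w"] r by auto
  let ?v = "v0 + t *s w"
  have not_both: "\<not> (f ?v = 0 \<and> k ?v = 0)" if "(f, k) \<in> L" for f k
  proof
    assume 0: "f ?v = 0 \<and> k ?v = 0"
    have "linear_form f" "linear_form k" using ok[OF that] by auto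
    with 0 have "f v0 = - (t * f w)" "k v0 = - (t * k w)"
      by (simp_all add: linear_form_add linear_form_scale eq_neg_iff_add_eq_0)
    with avoid[OF that] show False by simp
  qed
  have fixH: "\<exists>H\<in>arrangement. ?v \<in> H \<and> g \<in> pointwise_stabilizer G H"
    if g: "g \<in> G" "g *v ?v = ?v" "g \<noteq> mat 1" for g
  proof -
    have "g \<notin> ?B"
    proof
      assume gB: "g \<in> ?B"
      then have "(fst (pr g), snd (pr g)) \<in> L" by (simp add: L_def)
      from not_both[OF this] pr(2)[OF gB g(2)] show False by blast
    qed
    then obtain H where H: "H \<in> arrangement" "\<And>v. v \<in> H \<Longrightarrow> g *v v = v" using g by blast
    then have "?v \<in> H" using arrangement_fixed_space[OF H g(2)] g(3) by blast
    with H g(1) show ?thesis by (auto simp: pointwise_stabilizer_def)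
  qed
  have "generic ?v"
  proof (cases "\<forall>g\<in>G. g *v ?v = ?v \<longrightarrow> g = mat 1")
    case False
    then obtain H where H: "H \<in> arrangement" "?v \<in> H" using fixH by blast
    have "g \<in> pointwise_stabilizer G H" if g: "g \<in> G" "g *v ?v = ?v" for g
    proof (cases "g = mat 1")
      case True
      then show ?thesis using g by (simp add: pointwise_stabilizer_def)
    next
      case False
      obtain K where K: "K \<in> arrangement" "?v \<in> K" "g \<in> pointwise_stabilizer G K"
        using fixH[OF g False] by blast
      have "K = H"
      proof (rule ccontr)
        assume "K \<noteq> H"
        then have "(\<alpha> H, \<alpha> K) \<in> L" using H K by (auto simp: L_def)
        from not_both[OF this] show False using H K \<alpha>_zero_iff by blast
      qed
      with K(3) show ?thesis by simp
    qed
    with H show ?thesis unfolding generic_def by blast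
  qed (simp add: generic_def)
  with t show ?thesis by (rule that)
qed

end

section \<open>Determinants of semi-invariant forms near a generic point\<close>

locale chi_generators = reflection_data G \<theta> \<alpha> s
  for G :: "('n::{finite,linorder} cmat) set" and \<theta> \<alpha> s +
  fixes \<omega> :: "'n \<Rightarrow> 'n form"
  assumes \<omega>_one_form: "\<And>i. \<omega> i \<in> chi_one_forms"
    and \<omega>_generate: "\<And>u. u \<in> chi_one_forms \<Longrightarrow>
      \<exists>r. (\<forall>i. r i \<in> invariants G) \<and> u = (\<Sum>i\<in>UNIV. scale (r i) (\<omega> i))"
begin

definition A :: "'n \<Rightarrow> 'n \<Rightarrow> 'n cvec \<Rightarrow> complex" where
  "A i j = \<omega> i {j}"

lemma A_poly: "A i j \<in> polynomials"
  using chi_invariant_poly[OF chi_one_formD(1)[OF \<omega>_one_form]] by (simp add: A_def poly_form_def)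

lemma \<omega>_row: "\<omega> i = row_form A i"
  using row_form_of_one_form[of "\<omega> i" i] chi_one_formD(2)[OF \<omega>_one_form]
  by (simp add: row_form_def A_def)

text \<open>Averages of the forms \<open>h \<cdot> F i \<cdot> y i\<close>, with \<open>h\<close> concentrated at \<open>v\<close>, have a determinant whose
  order along a line through \<open>v\<close> is exactly the sum of the orders \<open>m i\<close> of the \<open>F i\<close>.\<close>

lemma local_determinant:
  assumes P: "P ** P' = mat 1"
    and F: "\<And>i. F i \<in> polynomials" "\<And>i. pline (F i) v e = [:0, 1:] ^ m i * [:b i:]" "\<And>i. b i \<noteq> 0"
    and eig: "\<And>g i. g \<in> G \<Longrightarrow> g *v v = v \<Longrightarrow>
      act_form g (scale (F i) (row_form (const_mat P) i)) =
      scale (\<lambda>v. \<theta> g) (scale (F i) (row_form (const_mat P) i))"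
  shows "\<exists>X\<in>polynomials. \<exists>q. poly q 0 \<noteq> 0 \<and>
    pline X v e * pline (ext_det A) v e = [:0, 1:] ^ (\<Sum>i\<in>UNIV. m i) * q"
proof -
  let ?t = "[:0, 1:] :: complex poly"
  define y where "y i = scale (F i) (row_form (const_mat P) i)" for i
  let ?S = "{g \<in> G. g *v v = v}"
  have Siff: "matrix_inv g *v v = v \<longleftrightarrow> g *v v = v" if "g \<in> G" for g
    using matrix_inv_fixes[OF that, of v] matrix_inv_fixes[OF G_inv[OF that], of v] G_mult_inv(3)[OF that] by auto
  have "finite ((\<lambda>g. matrix_inv g *v v) ` G - {v})" using finite_G by simp
  then obtain h where h: "h \<in> polynomials" "h v = 1"
    "\<And>w. w \<in> (\<lambda>g. matrix_inv g *v v) ` G - {v} \<Longrightarrow> h w = 0"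
    by (rule separating_polynomial) auto
  have y_pol: "poly_form (y i)" for i
    unfolding y_def by (intro poly_form_scale F(1) poly_form_row polynomials_const_mat)
  \<comment> \<open>The exponent \<open>Suc (m i)\<close> makes the summands of elements moving v
    vanish at v to an order above \<open>m i\<close>, so they do not disturb the leading term
    contributed by the stabilizer.\<close>
  define \<eta> where "\<eta> i = chi_average (scale (h ^ Suc (m i)) (y i))" for i
  have \<eta>_mem: "\<eta> i \<in> chi_one_forms" for i
    unfolding chi_forms_iff
  proof (intro conjI allI impI)
    show "chi_invariant (\<eta> i)"
      unfolding \<eta>_def by (intro chi_average_invariant poly_form_scale polynomials_power h(1) y_pol)
    show "\<eta> i I = 0" if "card I \<noteq> 1" for I
      unfolding \<eta>_def by (rule chi_average_card[OF _ that]) (simp add: y_def row_form_card)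
  qed
  \<comment> \<open>Here the generating property enters: the averages are combinations of the
    \<omega> i, so their determinant is a multiple of \<open>ext_det A\<close>.\<close>
  obtain R where R: "\<And>i k. R i k \<in> invariants G" "\<And>i. \<eta> i = (\<Sum>k\<in>UNIV. scale (R i k) (\<omega> k))"
    using \<omega>_generate[OF \<eta>_mem] by metis
  have R_pol: "R i k \<in> polynomials" for i k by (rule invariants_poly[OF R(1)])
  define M where "M = mat_prod (mat_prod R A) (const_mat P')"
  have \<eta>_row: "\<eta> i = row_form (mat_prod R A) i" for i
  proof -
    have "lam A (row_form R i) = (\<Sum>k\<in>UNIV. scale (R i k) (row_form A k))"
      by (simp add: row_form_def[of R] lam_sum lam_scale)
    then show ?thesis by (simp only: lam_row_form R(2) \<omega>_row[symmetric])
  qed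
  have M_pol: "M i j \<in> polynomials" for i j
    unfolding M_def mat_prod_def
    by (intro polynomials_sum polynomials_mult R_pol A_poly polynomials_const_mat)
  have M_lam: "M i j = lam (const_mat P') (\<eta> i) {j}" for i j
    unfolding \<eta>_row lam_row_form M_def by simp
  let ?X = "ext_det R * ext_det (const_mat P')"
  have X_pol: "?X \<in> polynomials"
    by (intro polynomials_mult polynomials_ext_det R_pol polynomials_const_mat)
  \<comment> \<open>Every element of the stabilizer contributes the same leading term, so averaging
    multiplies it by the proportion of the stabilizer in G.\<close>
  define \<kappa> where "\<kappa> = (of_nat (card ?S) / of_nat (card G) :: complex)"
  have "card ?S \<noteq> 0" using finite_G G_one by (auto simp: card_eq_0_iff)
  then have \<kappa>: "\<kappa> \<noteq> 0" using card_G by (simp add: \<kappa>_def)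
  have "\<exists>q. pline (M i j) v e = ?t ^ m i * q \<and> poly q 0 = (if i = j then \<kappa> * b i else 0)" for i j
  proof -
    define T where "T g = (\<lambda>v. inverse (\<theta> g)) * (act g (h ^ Suc (m i)) * lam (const_mat P') (act_form g (y i)) {j})" for g
    have lam_pol: "lam (const_mat P') (act_form g (y i)) {j} \<in> polynomials" for g
      using poly_form_lam[OF polynomials_const_mat poly_form_act[OF y_pol]] by (simp add: poly_form_def)
    have T_pol: "T g \<in> polynomials" for g
      unfolding T_def by (intro polynomials_mult polynomials.const polynomials_act polynomials_power h(1) lam_pol)
    have M_T: "M i j = (\<lambda>v. 1 / of_nat (card G)) * (\<Sum>g\<in>G. T g)"
      by (simp add: M_lam \<eta>_def chi_average_def lam_scale lam_sum act_form_scale sum_fun_apply T_def)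
    have "\<exists>q. pline (T g) v e = ?t ^ m i * q \<and> poly q 0 = (if g \<in> ?S \<and> i = j then b i else 0)"
      if g: "g \<in> G" for g
    proof (cases "g \<in> ?S")
      case True
      have "lam (const_mat P') (act_form g (y i)) = scale (\<lambda>v. \<theta> g) (scale (F i) (lam (const_mat P') (lam (const_mat P) (ext_basis {i}))))"
        using eig[of g i] True by (simp add: y_def lam_scale)
      then have "lam (const_mat P') (act_form g (y i)) = scale (\<lambda>v. \<theta> g) (scale (F i) (ext_basis {i}))"
        by (simp only: lam_const_inverse[OF P])
      then have "T g = act g (h ^ Suc (m i)) * (F i * (\<lambda>v. if i = j then 1 else 0))"
        unfolding T_def using \<theta>_nonzero[OF g] by (auto simp: fun_eq_iff ext_basis_def)
      then have "pline (T g) v e = ?t ^ m i * (pline (act g (h ^ Suc (m i))) v e * [:b i:] * [:if i = j then 1 else 0:])"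
        using h(1) F(1) by (simp only: pline_mult pline_const F(2) polynomials_mult polynomials.const polynomials_act
            polynomials_power mult_ac)
      moreover have "poly (pline (act g (h ^ Suc (m i))) v e * [:b i:] * [:if i = j then 1 else 0:]) 0 =
          (if i = j then b i else 0)"
      proof -
        have "poly (pline (act g (h ^ Suc (m i))) v e) 0 = act g (h ^ Suc (m i)) (v + 0 *s e)"
          by (intro poly_pline polynomials_act polynomials_power h(1))
        also have "\<dots> = 1" using h(2) True Siff[OF g] by (simp add: act_def power_fun_apply)
        finally show ?thesis by simp
      qed
      ultimately show ?thesis using True
        by (intro exI[of _ "pline (act g (h ^ Suc (m i))) v e * [:b i:] * [:if i = j then 1 else 0:]"] conjI)
          (simp_all only: simp_thms)
    next
      case False
      have "poly (pline (act g h) v e) 0 = 0"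
      proof -
        have "poly (pline (act g h) v e) 0 = act g h (v + 0 *s e)"
          by (intro poly_pline polynomials_act h(1))
        also have "\<dots> = 0" using h(3) False g Siff[OF g] by (simp add: act_def)
        finally show ?thesis .
      qed
      \<comment> \<open>\<open>act g h\<close> is zero at v because the inverse of g moves v to
        another point of its orbit; on the line this is a factor t.\<close>
      then obtain u where u: "pline (act g h) v e = ?t * u"
        by (metis dvdE poly_eq_0_iff_dvd minus_zero)
      have "pline (act g (h ^ Suc (m i))) v e = (?t * u) ^ Suc (m i)"
        by (simp only: act_power pline_power[OF polynomials_act[OF h(1)]] u)
      also have "\<dots> = ?t ^ m i * (?t * u ^ Suc (m i))" by (simp only: power_mult_distrib power_Suc mult_ac)
      finally have "pline (T g) v e = ?t ^ m i * (?t * (u ^ Suc (m i) * [:inverse (\<theta> g):] *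
          pline (lam (const_mat P') (act_form g (y i)) {j}) v e))"
        unfolding T_def using h(1)
        by (simp only: pline_mult pline_const lam_pol polynomials_mult polynomials.const polynomials_act
            polynomials_power mult_ac)
      moreover have "poly (?t * x) 0 = (if g \<in> ?S \<and> i = j then b i else 0)" for x
        using False by (simp only: simp_thms if_False) simp
      ultimately show ?thesis by blast
    qed
    then have "\<forall>g\<in>G. \<exists>q. pline (T g) v e = ?t ^ m i * q \<and> poly q 0 = (if g \<in> ?S \<and> i = j then b i else 0)"
      by blast
    from bchoice[OF this] obtain q where q: "\<And>g. g \<in> G \<Longrightarrow> pline (T g) v e = ?t ^ m i * q g"
      "\<And>g. g \<in> G \<Longrightarrow> poly (q g) 0 = (if g \<in> ?S \<and> i = j then b i else 0)" by blast
    have "pline (M i j) v e = [:1 / of_nat (card G):] * (\<Sum>g\<in>G. pline (T g) v e)"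
      unfolding M_T using T_pol by (simp only: pline_mult pline_const pline_sum polynomials.const polynomials_sum)
    also have "(\<Sum>g\<in>G. pline (T g) v e) = ?t ^ m i * (\<Sum>g\<in>G. q g)"
      unfolding sum_distrib_left by (rule sum.cong[OF HOL.refl], rule q(1))
    finally have "pline (M i j) v e = ?t ^ m i * ([:1 / of_nat (card G):] * (\<Sum>g\<in>G. q g))"
      by (simp only: mult.left_commute)
    moreover have "poly ([:1 / of_nat (card G):] * (\<Sum>g\<in>G. q g)) 0 = (if i = j then \<kappa> * b i else 0)"
    proof -
      have "(\<Sum>g\<in>G. poly (q g) 0) = (\<Sum>g\<in>G. if g \<in> ?S then if i = j then b i else 0 else 0)"
        by (rule sum.cong) (auto simp: q(2))
      also have "\<dots> = (\<Sum>g\<in>?S. if i = j then b i else 0)"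
        using finite_G by (simp only: sum.inter_filter[symmetric] mem_Collect_eq) (rule sum.cong, auto)
      finally show ?thesis by (simp add: poly_sum \<kappa>_def)
    qed
    ultimately show ?thesis by blast
  qed
  then obtain q where q: "\<And>i j. pline (M i j) v e = ?t ^ m i * q i j"
    "\<And>i j. poly (q i j) 0 = (if i = j then \<kappa> * b i else 0)" by metis
  \<comment> \<open>Row i is divisible by \<open>?t ^ m i\<close>, and the remaining matrix q is
    diagonal and invertible at t = 0. This fixes the order of the determinant.\<close>
  have "pline (ext_det M) v e = ext_det (mat_prod (diag (\<lambda>i. ?t ^ m i)) q)"
    by (simp only: pline_ext_det[OF M_pol] q(1) mat_prod_diag_left)
  also have "\<dots> = ?t ^ (\<Sum>i\<in>UNIV. m i) * ext_det q"
    by (simp only: ext_det_mult ext_det_diag power_sum)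
  finally have 1: "pline (ext_det M) v e = ?t ^ (\<Sum>i\<in>UNIV. m i) * ext_det q" .
  have "ext_det M = ?X * ext_det A" by (simp add: M_def ext_det_mult mult_ac)
  then have "pline (ext_det M) v e = pline ?X v e * pline (ext_det A) v e"
    using X_pol polynomials_ext_det[of A, OF A_poly] by (simp only: pline_mult)
  moreover have "poly (ext_det q) 0 = ext_det (diag (\<lambda>i. \<kappa> * b i))"
    unfolding ext_det_poly q(2) diag_def ..
  then have "poly (ext_det q) 0 \<noteq> 0" using \<kappa> F(3) by (simp add: ext_det_diag)
  ultimately show ?thesis using X_pol 1 by metis
qed

end

section \<open>Splitting semi-invariant forms by degree\<close>

context finite_unitary_group
begin

lemma act_form_degree_part:
  "act_form g (\<lambda>I. if card I = p then \<omega> I else 0) = (\<lambda>I. if card I = p then act_form g \<omega> I else 0)"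
proof
  fix K
  have *: "act g (\<omega> I) * row_wedge (const_mat (matrix_inv g)) I K = 0" if "card I \<noteq> card K" for I
    using row_wedge_card[of K I "const_mat (matrix_inv g)"] that by simp
  show "act_form g (\<lambda>I. if card I = p then \<omega> I else 0) K = (if card K = p then act_form g \<omega> K else 0)"
  proof (cases "card K = p")
    case True
    have "(\<Sum>I\<in>UNIV. act g (if card I = p then \<omega> I else 0) * row_wedge (const_mat (matrix_inv g)) I K) =
        (\<Sum>I\<in>UNIV. act g (\<omega> I) * row_wedge (const_mat (matrix_inv g)) I K)"
      by (rule sum.cong[OF HOL.refl]) (use True * in auto)
    then show ?thesis using True by (simp add: act_form_lam lam_def sum_fun_apply)
  next
    case False
    have "act_form g (\<lambda>I. if card I = p then \<omega> I else 0) K = 0"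
      by (rule act_form_card[of p]) (use False in auto)
    with False show ?thesis by simp
  qed
qed

lemma chi_invariant_degree_part:
  assumes "chi_invariant \<omega>" shows "chi_invariant (\<lambda>I. if card I = p then \<omega> I else 0)"
  using assms unfolding chi_invariant_def act_form_degree_part poly_form_def by (auto simp: fun_eq_iff)

lemma all_chi_forms_iff: "\<omega> \<in> all_chi_forms G \<theta> \<longleftrightarrow> chi_invariant \<omega>"
proof
  assume "\<omega> \<in> all_chi_forms G \<theta>"
  then show "chi_invariant \<omega>" by (auto simp: all_chi_forms_def chi_forms_iff intro: chi_invariant_sum)
next
  assume \<omega>: "chi_invariant \<omega>"
  let ?\<eta> = "\<lambda>p I. if card I = p then \<omega> I else 0"
  have "?\<eta> p \<in> chi_forms G \<theta> p" for p
    using chi_invariant_degree_part[OF \<omega>] by (simp add: chi_forms_iff)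
  moreover have "\<omega> = (\<Sum>p\<le>CARD('n). ?\<eta> p)"
  proof
    fix I :: "'n set"
    have "card I \<le> CARD('n)" by (rule card_mono) auto
    then show "\<omega> I = (\<Sum>p\<le>CARD('n). ?\<eta> p) I" by (simp add: sum_fun_apply)
  qed
  ultimately show "\<omega> \<in> all_chi_forms G \<theta>" unfolding all_chi_forms_def by blast
qed

end

section \<open>Twisted products of the generators\<close>

context chi_generators
begin

definition w :: "'n set \<Rightarrow> 'n form" where
  "w I = chi_wedge_set Q \<omega> I"

lemma w_empty: "w {} = degree0 Q"
  by (simp add: w_def chi_wedge_set_def)

lemma w_insert: "\<forall>j\<in>J. m < j \<Longrightarrow> w (insert m J) = chi_wedge Q (\<omega> m) (w J)"
  by (simp only: w_def chi_wedge_set_def sorted_list_of_set_min list.map foldr.simps o_apply)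

text \<open>The formula with Q to the power 1 - p, cleared of denominators so that it also covers
  the empty product.\<close>

lemma w_invariant_scale: "chi_invariant (w I) \<and> scale (Q ^ card I) (w I) = scale Q (row_wedge A I)"
proof (induction I rule: finite_linorder_min_induct[OF finite, case_names empty insert])
  case empty
  have "chi_invariant (w {}) \<and> scale (Q ^ card {}) (w {}) = scale Q (row_wedge A {})"
    using chi_invariant_unit by (simp add: w_empty degree0_scale)
  then show ?case .
next
  case (insert m J)
  then have m: "m \<notin> J" by auto
  have IH: "chi_invariant (w J)" "scale (Q ^ card J) (w J) = scale Q (row_wedge A J)"
    using insert.IH by blast+
  note cw = chi_wedge_props[OF chi_one_formD(1)[OF \<omega>_one_form] IH(1), of m]
  have "scale (Q ^ card (insert m J)) (w (insert m J)) = scale (Q ^ card J) (scale Q (chi_wedge Q (\<omega> m) (w J)))"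
    using m by (simp add: w_insert[OF insert.hyps(2)] scale_scale mult.commute)
  also have "\<dots> = wedge (\<omega> m) (scale (Q ^ card J) (w J))" by (simp only: cw(2) wedge_scale_right)
  also have "\<dots> = scale Q (row_wedge A (insert m J))"
    by (simp only: IH(2) wedge_scale_right row_wedge_min[OF insert.hyps(2)] \<omega>_row[symmetric])
  finally have "chi_invariant (w (insert m J)) \<and>
      scale (Q ^ card (insert m J)) (w (insert m J)) = scale Q (row_wedge A (insert m J))"
    using cw(1) by (simp add: w_insert[OF insert.hyps(2)])
  then show ?case .
qed

lemmas w_invariant = w_invariant_scale[THEN conjunct1]
lemmas w_scale = w_invariant_scale[THEN conjunct2]
lemmas w_poly = chi_invariant_poly[OF w_invariant]

lemma Q_power: "Q ^ k \<in> polynomials" "Q ^ k \<noteq> 0"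
  by (intro polynomials_power poly_power_nonzero Q_polynomial Q_nonzero)+

lemma w_card: assumes "card K \<noteq> card I" shows "w I K = 0"
proof -
  have "Q ^ card I * w I K = Q * row_wedge A I K"
    using fun_cong[OF w_scale[of I], of K] by simp
  also have "\<dots> = 0" using row_wedge_card[OF assms, of A] by simp
  finally show ?thesis
    using poly_domain[OF Q_power(1), of "w I K"] Q_power(2) w_poly[of I] by (auto simp: poly_form_def)
qed

lemma w_chi_forms: "w I \<in> chi_forms G \<theta> (card I)"
  by (simp add: chi_forms_iff w_invariant w_card)

lemma w_wedge:
  "wedge (w I) (w J) = (if I \<inter> J = {} then scale ((- 1) ^ inversions I J * Q) (w (I \<union> J)) else 0)"
proof (rule scale_cancel[OF _ _ Q_power])
  show "poly_form (wedge (w I) (w J))" by (intro poly_form_wedge w_poly)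
  show "poly_form (if I \<inter> J = {} then scale ((- 1) ^ inversions I J * Q) (w (I \<union> J)) else 0)"
    by (simp add: poly_form_scale w_poly polynomials_mult polynomials_neg_one_power Q_polynomial)
  have "scale (Q ^ (card I + card J)) (wedge (w I) (w J)) =
      wedge (scale (Q ^ card I) (w I)) (scale (Q ^ card J) (w J))"
    by (simp only: wedge_scale_left wedge_scale_right scale_scale power_add mult.commute)
  also have "\<dots> = scale (Q * Q) (wedge (row_wedge A I) (row_wedge A J))"
    by (simp add: w_scale wedge_scale_left wedge_scale_right scale_scale)
  also have "\<dots> = scale (Q ^ (card I + card J))
      (if I \<inter> J = {} then scale ((- 1) ^ inversions I J * Q) (w (I \<union> J)) else 0)"
  proof (cases "I \<inter> J = {}")
    case True
    then have "card I + card J = card (I \<union> J)" by (simp add: card_Un_disjoint)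
    then have "scale (Q ^ (card I + card J)) (scale ((- 1) ^ inversions I J * Q) (w (I \<union> J))) =
        scale ((- 1) ^ inversions I J * Q) (scale (Q ^ card (I \<union> J)) (w (I \<union> J)))"
      by (simp add: scale_scale mult.commute)
    then show ?thesis using True by (simp add: row_wedge_wedge w_scale scale_scale mult_ac)
  qed (simp add: row_wedge_wedge)
  finally show "scale (Q ^ (card I + card J)) (wedge (w I) (w J)) = scale (Q ^ (card I + card J))
      (if I \<inter> J = {} then scale ((- 1) ^ inversions I J * Q) (w (I \<union> J)) else 0)" .
qed

definition E :: "'n cvec \<Rightarrow> complex" where
  "E = w UNIV UNIV"

lemma E_poly: "E \<in> polynomials"
  using w_poly by (simp add: E_def poly_form_def)

lemma w_top: "w UNIV = scale E (ext_basis UNIV)"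
proof
  fix K show "w UNIV K = scale E (ext_basis UNIV) K"
    using w_card[OF card_ne_top, of K] by (cases "K = UNIV") (auto simp: E_def ext_basis_def)
qed

lemma ext_det_A: "ext_det A = Q ^ (CARD('n) - 1) * E"
proof (rule poly_cancel_left[OF Q_polynomial _ _ Q_nonzero])
  show "ext_det A \<in> polynomials" by (rule polynomials_ext_det[OF A_poly])
  show "Q ^ (CARD('n) - 1) * E \<in> polynomials" by (intro polynomials_mult Q_power E_poly)
  have "Q ^ CARD('n) * E = Q * ext_det A"
    using fun_cong[OF w_scale[of UNIV], of UNIV] by (simp add: E_def ext_det_def)
  \<comment> \<open>The index type is nonempty, so the subtraction is exact.\<close>
  moreover have "Q ^ CARD('n) = Q * Q ^ (CARD('n) - 1)"
    by (metis One_nat_def Suc_pred power_Suc zero_less_card_finite)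
  ultimately show "Q * ext_det A = Q * (Q ^ (CARD('n) - 1) * E)" by (simp add: mult.assoc)
qed

text \<open>The full index set contains i0 for every H, so the coefficient in the eigenframe has the
  factor with \<open>coexponent H\<close>; returning to the standard frame only multiplies it by the
  determinant of an invertible constant matrix.\<close>

lemma top_form_divisible:
  assumes f: "chi_invariant (scale f (ext_basis UNIV))" shows "pdvd Q_dual f"
proof -
  have "f \<in> polynomials" using chi_invariant_poly[OF f] by (auto simp: poly_form_def ext_basis_def dest: spec[of _ UNIV])
  moreover have "pdvd (\<alpha> H ^ coexponent H) f" if H: "H \<in> arrangement" for H
  proof -
    obtain P P' :: "'n cmat" and i0 e where P: "P ** P' = mat 1" "P' ** P = mat 1"
      and div: "\<And>\<omega> I. chi_invariant \<omega> \<Longrightarrow>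
        pdvd (\<alpha> H ^ (if i0 \<in> I then coexponent H else exponent H)) (lam (const_mat P') \<omega> I)"
      using local_frame[OF H] by metis
    have "lam (const_mat P') (scale f (ext_basis UNIV)) UNIV = f * ext_det (const_mat P')"
      by (simp only: lam_top scale_apply) (simp add: ext_basis_def)
    then have "pdvd (\<alpha> H ^ coexponent H) (f * ext_det (const_mat P'))"
      using div[OF f, of UNIV] by simp
    then have "pdvd (\<alpha> H ^ coexponent H) (f * ext_det (const_mat P') * ext_det (const_mat P))"
      by (rule pdvd_mult_right) (rule polynomials_ext_det[OF polynomials_const_mat])
    moreover have "ext_det (const_mat P') * ext_det (const_mat P) = 1"
      by (simp add: const_mat_prod P(2) const_mat_one ext_det_diag flip: ext_det_mult)
    ultimately show ?thesis by (simp add: mult.assoc)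
  qed
  ultimately show ?thesis unfolding Q_dual_def by (rule arrangement_prod_pdvd)
qed

text \<open>By \<open>local_determinant\<close> some multiple of \<open>ext_det A\<close> has on a
  line through v exactly the sum of the local orders as its order. The power of
  \<open>\<alpha> H\<close> in \<open>Q ^ (n - 1) * Q_dual\<close> accounts for all of it, so a zero
  of r at v would be one too many.\<close>

lemma E_ratio_nonzero:
  assumes r: "r \<in> polynomials" "E = Q_dual * r" and v: "generic v"
  shows "r v \<noteq> 0"
proof
  assume rv: "r v = 0"
  let ?t = "[:0, 1:] :: complex poly"
  have Qd: "Q_dual \<in> polynomials" unfolding Q_dual_def by (rule arrangement_prod_poly) simp
  have E0: "E v = 0" by (simp add: r(2) rv)
  from v[unfolded generic_def] show False
  proof (elim disjE bexE conjE)
    assume triv: "\<forall>g\<in>G. g *v v = v \<longrightarrow> g = mat 1"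
    \<comment> \<open>For a trivial stabilizer the standard frame with factors 1 serves as local
      model. All orders are 0, and direction 0 shrinks the line to the point v.\<close>
    have "\<exists>X\<in>polynomials. \<exists>q. poly q 0 \<noteq> 0 \<and>
        pline X v 0 * pline (ext_det A) v 0 = ?t ^ (\<Sum>i\<in>(UNIV :: 'n set). 0) * q"
    proof (rule local_determinant[where F = "\<lambda>_. 1" and b = "\<lambda>_. 1"])
      show "mat 1 ** mat 1 = (mat 1 :: 'n cmat)" by simp
      show "pline 1 v 0 = ?t ^ 0 * [:1:]" by (rule pline_unique) simp
      fix g and i :: 'n assume "g \<in> G" "g *v v = v"
      then have "g = mat 1" using triv by blast
      then show "act_form g (scale 1 (row_form (const_mat (mat 1)) i)) =
          scale (\<lambda>v. \<theta> g) (scale 1 (row_form (const_mat (mat 1)) i))"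
        by (simp add: act_form_mat_one \<theta>_one fun_eq_iff)
    qed auto
    then obtain X q where q: "poly q 0 \<noteq> 0"
      "pline X v 0 * pline (ext_det A) v 0 = ?t ^ (\<Sum>i\<in>(UNIV :: 'n set). 0) * q" by blast
    have "poly (pline (ext_det A) v 0) 0 = ext_det A (v + 0 *s 0)"
      by (rule poly_pline[OF polynomials_ext_det[OF A_poly]])
    then have "poly (pline (ext_det A) v 0) 0 = 0" by (simp add: ext_det_A E0)
    moreover have "q = pline X v 0 * pline (ext_det A) v 0" using q(2) by simp
    ultimately show False using q(1) by simp
  next
    fix H assume H: "H \<in> arrangement" "v \<in> H" and stab: "\<forall>g\<in>G. g *v v = v \<longrightarrow> g \<in> pointwise_stabilizer G H"
    obtain P P' :: "'n cmat" and i0 e where P: "P ** P' = mat 1" and e: "\<alpha> H e \<noteq> 0"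
      and eig: "\<And>i g. g \<in> pointwise_stabilizer G H \<Longrightarrow>
        act_form g (scale (\<alpha> H ^ (if i = i0 then coexponent H else exponent H)) (row_form (const_mat P) i)) =
        scale (\<lambda>v. \<theta> g) (scale (\<alpha> H ^ (if i = i0 then coexponent H else exponent H)) (row_form (const_mat P) i))"
      using local_frame[OF H(1)] by metis
    let ?m = "\<lambda>i. if i = i0 then coexponent H else exponent H"
    have \<alpha>v: "\<alpha> H v = 0" using H \<alpha>_zero_iff by blast
    have "pline (\<alpha> H) v e = ?t * [:\<alpha> H e:]"
      by (rule pline_unique) (simp add: linear_form_add linear_form_scale \<alpha>_linear[OF H(1)] \<alpha>v)
    then have pl: "pline (\<alpha> H ^ k) v e = ?t ^ k * [:\<alpha> H e ^ k:]" for k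
      by (simp only: pline_power[OF \<alpha>_poly[OF H(1)]] power_mult_distrib poly_const_pow)
    have "\<exists>X\<in>polynomials. \<exists>q. poly q 0 \<noteq> 0 \<and>
        pline X v e * pline (ext_det A) v e = ?t ^ (\<Sum>i\<in>UNIV. ?m i) * q"
    proof (rule local_determinant[OF P, where F = "\<lambda>i. \<alpha> H ^ ?m i" and b = "\<lambda>i. \<alpha> H e ^ ?m i"])
      show "\<alpha> H ^ ?m i \<in> polynomials" for i by (intro polynomials_power \<alpha>_poly H(1))
      show "pline (\<alpha> H ^ ?m i) v e = ?t ^ ?m i * [:\<alpha> H e ^ ?m i:]" for i by (rule pl)
      show "\<alpha> H e ^ ?m i \<noteq> 0" for i using e by simp
      show "act_form g (scale (\<alpha> H ^ ?m i) (row_form (const_mat P) i)) =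
          scale (\<lambda>v. \<theta> g) (scale (\<alpha> H ^ ?m i) (row_form (const_mat P) i))"
        if "g \<in> G" "g *v v = v" for g i
        using stab that by (intro eig) blast
    qed
    then obtain X q where X: "X \<in> polynomials" "poly q 0 \<noteq> 0"
      "pline X v e * pline (ext_det A) v e = ?t ^ (\<Sum>i\<in>UNIV. ?m i) * q" by blast
    \<comment> \<open>All indices but i0 contribute the exponent. The two summands are the powers of
      \<open>\<alpha> H\<close> in \<open>Q ^ (n - 1)\<close> and in \<open>Q_dual\<close>.\<close>
    have m: "(\<Sum>i\<in>UNIV. ?m i) = exponent H * (CARD('n) - 1) + coexponent H"
    proof -
      have "(\<Sum>i\<in>UNIV. ?m i) = coexponent H + (\<Sum>i\<in>UNIV - {i0}. ?m i)" by (subst sum.remove[of _ i0]) auto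
      also have "(\<Sum>i\<in>UNIV - {i0}. ?m i) = (\<Sum>i\<in>UNIV - {i0}. exponent H)" by (rule sum.cong) auto
      finally show ?thesis by (simp add: mult.commute)
    qed
    define Z1 where "Z1 = (\<Prod>K\<in>arrangement - {H}. \<alpha> K ^ exponent K)"
    define Z2 where "Z2 = (\<Prod>K\<in>arrangement - {H}. \<alpha> K ^ coexponent K)"
    have Z: "Z1 \<in> polynomials" "Z2 \<in> polynomials" unfolding Z1_def Z2_def by (rule arrangement_prod_poly, blast)+
    have Q1: "Q = \<alpha> H ^ exponent H * Z1"
      unfolding Q_poly_def Z1_def by (rule prod.remove[OF finite_arrangement H(1)])
    have Q2: "Q_dual = \<alpha> H ^ coexponent H * Z2"
      unfolding Q_dual_def Z2_def by (rule prod.remove[OF finite_arrangement H(1)])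
    let ?Y = "Z1 ^ (CARD('n) - 1) * Z2 * r"
    have Y: "?Y \<in> polynomials" by (intro polynomials_mult polynomials_power Z r(1))
    have "ext_det A = \<alpha> H ^ (\<Sum>i\<in>UNIV. ?m i) * ?Y"
      unfolding ext_det_A r(2) Q2 m unfolding Q1 by (simp add: power_mult_distrib power_mult power_add mult_ac)
    then have "pline (ext_det A) v e = ?t ^ (\<Sum>i\<in>UNIV. ?m i) * ([:\<alpha> H e ^ (\<Sum>i\<in>UNIV. ?m i):] * pline ?Y v e)"
      using Y by (simp only: pline_mult polynomials_power \<alpha>_poly[OF H(1)] pl mult.assoc)
    with X(3) have "?t ^ (\<Sum>i\<in>UNIV. ?m i) * q =
        ?t ^ (\<Sum>i\<in>UNIV. ?m i) * (pline X v e * [:\<alpha> H e ^ (\<Sum>i\<in>UNIV. ?m i):] * pline ?Y v e)"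
      by (simp only: mult_ac)
    then have "q = pline X v e * [:\<alpha> H e ^ (\<Sum>i\<in>UNIV. ?m i):] * pline ?Y v e"
      by (subst (asm) mult_cancel_left) simp
    moreover have "poly (pline ?Y v e) 0 = ?Y (v + 0 *s e)" by (rule poly_pline[OF Y])
    then have "poly (pline ?Y v e) 0 = 0" by (simp add: rv)
    ultimately have "poly q 0 = 0" by simp
    with X(2) show False ..
  qed
qed

lemma E_eq: obtains c where "c \<noteq> 0" "E = (\<lambda>v. c) * Q_dual"
proof -
  have "chi_invariant (scale E (ext_basis UNIV))" using w_invariant[of UNIV] by (simp add: w_top)
  then obtain r where r: "r \<in> polynomials" "E = Q_dual * r"
    using top_form_divisible unfolding pdvd_def by blast
  have "\<exists>c. r = (\<lambda>v. c)"
  proof (rule ccontr)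
    assume "\<not> ?thesis"
    then obtain v where "r v = 0" "generic v" using generic_zero[OF r(1)] by blast
    with E_ratio_nonzero[OF r] show False by blast
  qed
  then obtain c where c: "r = (\<lambda>v. c)" ..
  \<comment> \<open>That the constant is nonzero follows from one generic point, taken among the
    zeros of a coordinate function.\<close>
  fix i :: 'n
  have "(\<lambda>v. v $ i) \<noteq> (\<lambda>v. a)" for a :: complex
  proof
    assume eq: "(\<lambda>v. v $ i) = (\<lambda>v. a)"
    have "axis i 1 $ i = a" "0 $ i = a" by (rule fun_cong[OF eq])+
    then show False by (simp add: axis_def)
  qed
  then obtain v :: "'n cvec" where "generic v" using generic_zero[OF polynomials.coord[of i]] by blast
  from E_ratio_nonzero[OF r this] have "c \<noteq> 0" by (simp add: c)
  then show ?thesis using that r(2) c by (simp add: mult.commute)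
qed

lemma E_nonzero: "E \<noteq> 0"
proof -
  obtain c where c: "c \<noteq> 0" "E = (\<lambda>v. c) * Q_dual" by (rule E_eq)
  have "Q_dual \<noteq> 0" unfolding Q_dual_def by (rule arrangement_prod_nonzero) simp
  then obtain v where "Q_dual v \<noteq> 0" by (auto simp: fun_eq_iff)
  then have "E v \<noteq> 0 v" using c by simp
  then show ?thesis by metis
qed

text \<open>E is a nonzero constant times \<open>Q_dual\<close>, so the quotient of f by E is a
  polynomial. The volume form contributes the same determinant to both transformation laws, so the
  quotient is invariant.\<close>

lemma top_form_multiple:
  assumes f: "chi_invariant (scale f (ext_basis UNIV))"
  obtains k where "k \<in> invariants G" "f = E * k"
proof -
  obtain c where c: "c \<noteq> 0" "E = (\<lambda>v. c) * Q_dual" by (rule E_eq)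
  obtain h where h: "h \<in> polynomials" "f = Q_dual * h" using top_form_divisible[OF f] unfolding pdvd_def by blast
  define k where "k = (\<lambda>v. inverse c) * h"
  have k: "k \<in> polynomials" unfolding k_def by (intro polynomials_mult polynomials.const h)
  have fk: "f = E * k" using c(1) by (simp add: c(2) h(2) k_def fun_eq_iff)
  have "act g k = k" if g: "g \<in> G" for g
  proof -
    have act: "act g f * ext_det (const_mat (matrix_inv g)) = (\<lambda>v. \<theta> g) * f"
      if "chi_invariant (scale f (ext_basis UNIV))" for f
    proof -
      have "act_form g (scale f (ext_basis UNIV)) = scale (\<lambda>v. \<theta> g) (scale f (ext_basis UNIV))"
        using that g unfolding chi_invariant_def by blast
      from fun_cong[OF this, of UNIV]
      have 1: "act_form g (scale f (ext_basis UNIV)) UNIV = (\<lambda>v. \<theta> g) * f" by (simp add: ext_basis_def)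
      have 2: "(\<lambda>I. act g (scale f (ext_basis UNIV) I)) = scale (act g f) (ext_basis UNIV)"
        by (auto simp: ext_basis_def act_mult fun_eq_iff)
      have "act_form g (scale f (ext_basis UNIV)) =
          scale (act g f * ext_det (const_mat (matrix_inv g))) (ext_basis UNIV)"
        unfolding act_form_lam 2 by (rule lam_top)
      from fun_cong[OF this, of UNIV] 1 show ?thesis by (simp add: ext_basis_def)
    qed
    have "chi_invariant (scale E (ext_basis UNIV))" using w_invariant[of UNIV] by (simp add: w_top)
    note actE = act[OF this]
    let ?a = "(\<lambda>v. \<theta> g) * E"
    have "?a * act g k = act g E * ext_det (const_mat (matrix_inv g)) * act g k" by (simp only: actE)
    also have "\<dots> = act g f * ext_det (const_mat (matrix_inv g))" by (simp only: fk act_mult mult_ac)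
    also have "\<dots> = ?a * k" by (simp only: act[OF f]) (simp only: fk mult.assoc)
    finally have eq: "?a * act g k = ?a * k" .
    obtain v where "E v \<noteq> 0" using E_nonzero by (auto simp: fun_eq_iff)
    then have "?a v \<noteq> 0 v" using \<theta>_nonzero[OF g] by simp
    then have "?a \<noteq> 0" by metis
    then show ?thesis
      by (intro poly_cancel_left[OF polynomials_mult[OF polynomials.const E_poly] polynomials_act[OF k] k _ eq])
  qed
  with k have "k \<in> invariants G" by (simp add: invariants_def)
  with fk that show ?thesis by blast
qed

section \<open>The exterior algebra structure\<close>

definition \<Phi> :: "('n set \<Rightarrow> 'n cvec \<Rightarrow> complex) \<Rightarrow> 'n form" where
  "\<Phi> c = (\<Sum>I\<in>UNIV. scale (c I) (w I))"

lemma \<Phi>_add: "\<Phi> (c + d) = \<Phi> c + \<Phi> d"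
  by (simp add: \<Phi>_def scale_add_left sum.distrib)

lemma \<Phi>_scale: "\<Phi> (scale f c) = scale f (\<Phi> c)"
  by (simp add: \<Phi>_def scale_sum_right scale_scale)

lemma \<Phi>_zero: "\<Phi> 0 = 0"
  by (simp add: \<Phi>_def)

lemma \<Phi>_sum: "\<Phi> (\<Sum>x\<in>X. f x) = (\<Sum>x\<in>X. \<Phi> (f x))"
  using sum_comp_morphism[of \<Phi> f X] by (simp add: \<Phi>_add \<Phi>_zero o_def)

lemma \<Phi>_basis: "\<Phi> (ext_basis I) = w I"
  by (simp add: \<Phi>_def ext_basis_def fun_eq_iff sum_fun_apply mult_delta_left)

lemma \<Phi>_invariant: "(\<And>I. c I \<in> invariants G) \<Longrightarrow> chi_invariant (\<Phi> c)"
  unfolding \<Phi>_def by (intro chi_invariant_sum chi_invariant_scale w_invariant)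

lemma \<Phi>_wedge: "scale Q (\<Phi> (wedge c d)) = wedge (\<Phi> c) (\<Phi> d)"
proof -
  have basis: "wedge (w I) (w J) = scale Q (\<Phi> (wedge (ext_basis I) (ext_basis J)))" for I J
    by (simp add: wedge_basis \<Phi>_scale \<Phi>_basis \<Phi>_zero w_wedge scale_scale mult.commute)
  have comm: "scale a (scale Q x) = scale Q (scale a x)" for a and x :: "'n form"
    by (simp add: scale_scale mult.commute)
  have "wedge (\<Phi> c) (\<Phi> d) = (\<Sum>I\<in>UNIV. \<Sum>J\<in>UNIV. scale Q (scale (c I * d J) (\<Phi> (wedge (ext_basis I) (ext_basis J)))))"
    unfolding \<Phi>_def[of c] \<Phi>_def[of d] wedge_sum_sum by (simp only: basis comm)
  also have "\<dots> = scale Q (\<Phi> (wedge c d))"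
    by (simp only: wedge_expand[of c d] \<Phi>_sum \<Phi>_scale scale_sum_right)
  finally show ?thesis by simp
qed

text \<open>For I \<noteq> J the sets I and - J either meet or fail to cover everything, so the
  pairing in top degree isolates the coefficient at J.\<close>

lemma \<Phi>_pairing: "wedge (\<Phi> c) (w (- J)) UNIV = (- 1) ^ inversions J (- J) * (Q * E * c J)"
proof -
  have "wedge (\<Phi> c) (w (- J)) UNIV = (\<Sum>I\<in>UNIV. c I * wedge (w I) (w (- J)) UNIV)"
    unfolding \<Phi>_def wedge_sum_left wedge_scale_left by (simp only: sum_fun_apply scale_apply)
  also have "\<dots> = (\<Sum>I\<in>UNIV. if I = J then (- 1) ^ inversions J (- J) * (Q * E * c J) else 0)"
  proof (rule sum.cong[OF HOL.refl])
    fix I :: "'n set"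
    show "c I * wedge (w I) (w (- J)) UNIV = (if I = J then (- 1) ^ inversions J (- J) * (Q * E * c J) else 0)"
    proof (cases "I = J")
      case True
      then show ?thesis by (simp add: w_wedge E_def mult_ac)
    next
      case False
      have "w (I \<union> - J) UNIV = 0" if "I \<inter> - J = {}"
      proof (rule w_card)
        have "I \<union> - J \<noteq> UNIV" using False that by blast
        then show "CARD('n) \<noteq> card (I \<union> - J)" using card_ne_top by metis
      qed
      then show ?thesis using False by (simp add: w_wedge)
    qed
  qed
  finally show ?thesis by simp
qed

text \<open>Where the determinant is nonzero, the products of the rows of A span all forms at that
  point, so \<eta> pairs to zero with every basis form there. Hence
  \<open>ext_det A * \<eta> J\<close> vanishes everywhere, and the first factor can be
  cancelled.\<close>

lemma pairing_nondegenerate: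
  assumes \<eta>: "poly_form \<eta>" and 0: "\<And>J. wedge \<eta> (w (- J)) UNIV = 0"
  shows "\<eta> = 0"
proof
  fix J
  have D: "ext_det A \<in> polynomials" by (rule polynomials_ext_det[OF A_poly])
  have row0: "wedge \<eta> (row_wedge A I) UNIV = 0" for I
  proof -
    have "Q * wedge \<eta> (row_wedge A I) UNIV = wedge \<eta> (scale Q (row_wedge A I)) UNIV"
      by (simp add: wedge_scale_right)
    also have "\<dots> = Q ^ card I * wedge \<eta> (w (- (- I))) UNIV"
      by (simp add: wedge_scale_right flip: w_scale)
    also have "\<dots> = 0" by (simp only: 0 mult_zero_right)
    finally have "Q * wedge \<eta> (row_wedge A I) UNIV = 0" .
    moreover have "wedge \<eta> (row_wedge A I) UNIV \<in> polynomials"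
      using poly_form_wedge[OF \<eta> poly_form_row_wedge[OF A_poly]] by (simp add: poly_form_def)
    ultimately show ?thesis using poly_domain[OF Q_polynomial] Q_nonzero by blast
  qed
  have "ext_det A * \<eta> J = 0"
  proof
    fix v
    let ?A = "\<lambda>i j. A i j v" and ?\<eta> = "\<lambda>I. \<eta> I v"
    show "(ext_det A * \<eta> J) v = 0 v"
    proof (cases "ext_det A v = 0")
      case False
      then have "ext_det ?A \<noteq> 0" by (simp add: ext_det_eval)
      then obtain B where "mat_prod B ?A = diag (\<lambda>_. 1)" by (rule ext_det_invertible)
      then have "ext_basis (- J) = lam ?A (lam B (ext_basis (- J)))" by (simp only: lam_lam lam_one)
      then have "wedge ?\<eta> (ext_basis (- J)) UNIV = wedge ?\<eta> (lam ?A (lam B (ext_basis (- J)))) UNIV"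
        by (rule arg_cong)
      also have "\<dots> = (\<Sum>I\<in>UNIV. lam B (ext_basis (- J)) I * wedge ?\<eta> (row_wedge ?A I) UNIV)"
        by (simp only: lam_def[of ?A] wedge_sum_right wedge_scale_right sum_fun_apply scale_apply)
      finally have "wedge ?\<eta> (ext_basis (- J)) UNIV =
          (\<Sum>I\<in>UNIV. lam B (ext_basis (- J)) I * wedge ?\<eta> (row_wedge ?A I) UNIV)" .
      moreover have "wedge ?\<eta> (row_wedge ?A I) UNIV = 0" for I
      proof -
        have "row_wedge ?A I = (\<lambda>K. row_wedge A I K v)"
          using row_wedge_hom[of "\<lambda>f. f v" A I] by auto
        then show ?thesis using row0[of I] wedge_eval[of \<eta> "row_wedge A I" UNIV v] by simp
      qed
      ultimately have "wedge ?\<eta> (ext_basis (- J)) UNIV = 0" by simp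
      then show ?thesis by (simp add: wedge_basis_compl)
    qed simp
  qed
  moreover have "ext_det A \<noteq> 0"
    using poly_domain[OF Q_power(1) E_poly] Q_power(2) E_nonzero unfolding ext_det_A by blast
  ultimately show "\<eta> J = 0 J"
    using poly_domain[OF D] \<eta> by (auto simp: poly_form_def)
qed

lemma QE: "Q * E \<in> polynomials" "Q * E \<noteq> 0"
  using polynomials_mult[OF Q_polynomial E_poly] poly_domain[OF Q_polynomial E_poly] Q_nonzero E_nonzero by blast+

lemma neg_one_power_square: "(- 1) ^ k * ((- 1) ^ k * f) = (f :: 'n cvec \<Rightarrow> complex)"
  by (simp flip: mult.assoc power_add mult_2)

text \<open>The pairing of \<eta> with \<open>w (- J)\<close> dictates the coefficient at J. It is
  invariant, because the top part of their twisted product is semi-invariant and so an invariant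
  multiple of E. The difference of \<eta> and the resulting combination pairs to zero with all
  \<open>w (- J)\<close>.\<close>

lemma \<Phi>_surj:
  assumes \<eta>: "chi_invariant \<eta>"
  obtains c where "\<And>I. c I \<in> invariants G" "\<eta> = \<Phi> c"
proof -
  have "\<exists>k\<in>invariants G. wedge \<eta> (w (- J)) UNIV = Q * (E * k)" for J
  proof -
    let ?\<nu> = "chi_wedge Q \<eta> (w (- J))"
    note \<nu> = chi_wedge_props[OF \<eta> w_invariant[of "- J"]]
    have "(\<lambda>I. if card I = CARD('n) then ?\<nu> I else 0) = scale (?\<nu> UNIV) (ext_basis UNIV)"
    proof
      fix I :: "'n set"
      show "(if card I = CARD('n) then ?\<nu> I else 0) = scale (?\<nu> UNIV) (ext_basis UNIV) I"
        using card_ne_top[of I] by (cases "I = UNIV") (simp_all add: ext_basis_def)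
    qed
    with chi_invariant_degree_part[OF \<nu>(1), of "CARD('n)"]
    have "chi_invariant (scale (?\<nu> UNIV) (ext_basis UNIV))" by simp
    then obtain k where "k \<in> invariants G" "?\<nu> UNIV = E * k" by (rule top_form_multiple)
    moreover have "wedge \<eta> (w (- J)) UNIV = Q * ?\<nu> UNIV" by (simp flip: \<nu>(2))
    ultimately show ?thesis by metis
  qed
  then obtain k where k: "\<And>J. k J \<in> invariants G" "\<And>J. wedge \<eta> (w (- J)) UNIV = Q * (E * k J)" by metis
  define c where "c J = (- 1) ^ inversions J (- J) * k J" for J
  have "(- 1) ^ n \<in> invariants G" for n
  proof -
    have "(- 1) ^ n = (\<lambda>v :: 'n cvec. (- 1) ^ n :: complex)" by (rule ext) (simp add: power_fun_apply)
    then show ?thesis by (simp only: invariants_const)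
  qed
  then have c: "c J \<in> invariants G" for J unfolding c_def by (intro invariants_mult k)
  have "\<eta> - \<Phi> c = 0"
  proof (rule pairing_nondegenerate)
    show "poly_form (\<eta> - \<Phi> c)"
      by (intro poly_form_diff chi_invariant_poly \<eta> \<Phi>_invariant c)
    fix J
    have "wedge \<eta> (w (- J)) = wedge (\<eta> - \<Phi> c) (w (- J)) + wedge (\<Phi> c) (w (- J))"
      by (simp flip: wedge_add_left)
    from fun_cong[OF this, of UNIV]
    have "wedge (\<eta> - \<Phi> c) (w (- J)) UNIV = Q * (E * k J) - (- 1) ^ inversions J (- J) * (Q * E * c J)"
      by (simp add: k(2) \<Phi>_pairing)
    also have "(- 1) ^ inversions J (- J) * (Q * E * c J) = (- 1) ^ inversions J (- J) * ((- 1) ^ inversions J (- J) * (Q * E * k J))"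
      by (simp only: c_def mult_ac)
    also have "\<dots> = Q * (E * k J)" by (simp only: neg_one_power_square mult.assoc)
    finally show "wedge (\<eta> - \<Phi> c) (w (- J)) UNIV = 0" by (simp only: diff_self)
  qed
  then show ?thesis using that[of c] c by simp
qed

lemma \<Phi>_inj:
  assumes "\<And>I. c I \<in> polynomials" "\<And>I. d I \<in> polynomials" "\<Phi> c = \<Phi> d"
  shows "c = d"
proof
  fix J
  have "(- 1) ^ inversions J (- J) * (Q * E * c J) = (- 1) ^ inversions J (- J) * (Q * E * d J)"
    by (simp only: assms(3) flip: \<Phi>_pairing)
  then have "Q * E * c J = Q * E * d J" by (metis neg_one_power_square)
  then show "c J = d J" by (rule poly_cancel_left[OF QE(1) assms(1,2) QE(2)])
qed

lemma \<Phi>_degree: "\<Phi> ` ext_power (invariants G) p = chi_forms G \<theta> p"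
proof (intro equalityI subsetI)
  fix \<eta> assume "\<eta> \<in> \<Phi> ` ext_power (invariants G) p"
  then obtain c where c: "\<And>I. c I \<in> invariants G" "\<And>I. card I \<noteq> p \<Longrightarrow> c I = 0" "\<eta> = \<Phi> c"
    by (auto simp: ext_power_def)
  have "scale (c I) (w I) \<in> chi_forms G \<theta> p" for I
    using chi_forms_scale[OF c(1) w_chi_forms, of I I] c(2)[of I] by (cases "card I = p") auto
  then show "\<eta> \<in> chi_forms G \<theta> p" unfolding c(3) \<Phi>_def by (rule chi_forms_sum)
next
  fix \<eta> assume \<eta>: "\<eta> \<in> chi_forms G \<theta> p"
  then have "chi_invariant \<eta>" by (simp add: chi_forms_iff)
  then obtain c where c: "\<And>I. c I \<in> invariants G" "\<eta> = \<Phi> c"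
    by (rule \<Phi>_surj) (rule that)
  \<comment> \<open>Each \<open>w I\<close> is concentrated in degree \<open>card I\<close>, so
    dropping the coefficients at sets of other sizes does not change the part of degree p, and
    \<eta> has no other part.\<close>
  define d where "d I = (if card I = p then c I else 0)" for I
  have "\<eta> = \<Phi> d"
  proof
    fix K
    show "\<eta> K = \<Phi> d K"
    proof (cases "card K = p")
      case True
      have "(\<Sum>I\<in>UNIV. c I * w I K) = (\<Sum>I\<in>UNIV. d I * w I K)"
        by (rule sum.cong[OF HOL.refl]) (use True w_card[of K] in \<open>auto simp: d_def\<close>)
      then show ?thesis by (simp add: c(2) \<Phi>_def sum_fun_apply)
    next
      case False
      have "(\<Sum>I\<in>UNIV. d I * w I K) = 0"
        by (rule sum.neutral) (use False w_card[of K] in \<open>auto simp: d_def\<close>)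
      then show ?thesis using \<eta> False by (simp add: chi_forms_iff \<Phi>_def sum_fun_apply)
    qed
  qed
  moreover have "d \<in> ext_power (invariants G) p" using c(1) by (simp add: ext_power_def d_def)
  ultimately show "\<eta> \<in> \<Phi> ` ext_power (invariants G) p" by blast
qed

lemma \<Phi>_ext_gen: "\<Phi> (ext_gen i) = \<omega> i"
proof -
  have "w {i} = chi_wedge Q (\<omega> i) (w {})" by (rule w_insert) simp
  also have "\<dots> = \<omega> i"
    by (rule chi_wedge_eqI)
      (simp_all add: chi_invariant_poly[OF chi_one_formD(1)[OF \<omega>_one_form]] w_empty degree0_scale wedge_scale_right)
  finally show ?thesis by (simp add: ext_gen_basis \<Phi>_basis)
qed

lemma ext_algebra_iso:
  "graded_algebra_iso (invariants G) (ext_algebra (invariants G)) (ext_power (invariants G))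
     (chi_algebra G \<theta> Q) (chi_forms G \<theta>) \<Phi>"
proof -
  let ?C = "{c :: 'n set \<Rightarrow> 'n cvec \<Rightarrow> complex. \<forall>I. c I \<in> invariants G}"
  have bij: "bij_betw \<Phi> ?C (all_chi_forms G \<theta>)"
  proof (rule bij_betw_imageI)
    show "inj_on \<Phi> ?C"
      by (rule inj_onI, rule \<Phi>_inj) (auto intro: invariants_poly)
    show "\<Phi> ` ?C = all_chi_forms G \<theta>"
    proof (intro equalityI subsetI)
      fix \<eta> assume "\<eta> \<in> \<Phi> ` ?C"
      then show "\<eta> \<in> all_chi_forms G \<theta>" using \<Phi>_invariant by (auto simp: all_chi_forms_iff)
    next
      fix \<eta> assume "\<eta> \<in> all_chi_forms G \<theta>"
      then have "chi_invariant \<eta>" by (simp add: all_chi_forms_iff)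
      then obtain c where "\<And>I. c I \<in> invariants G" "\<eta> = \<Phi> c"
    by (rule \<Phi>_surj) (rule that)
      then show "\<eta> \<in> \<Phi> ` ?C" by blast
    qed
  qed
  have "\<Phi> (wedge c d) = chi_wedge Q (\<Phi> c) (\<Phi> d)" if "c \<in> ?C" "d \<in> ?C" for c d
  proof -
    have "poly_form c" "poly_form d" using that invariants_poly by (auto simp: poly_form_def)
    then have "poly_form (\<Phi> (wedge c d))"
      unfolding \<Phi>_def using poly_form_wedge[of c d]
      by (intro poly_form_sum poly_form_scale w_poly) (auto simp: poly_form_def)
    then show ?thesis using chi_wedge_eqI[OF _ \<Phi>_wedge] by metis
  qed
  moreover have "\<Phi> (degree0 1) = degree0 Q" by (simp add: degree0_one \<Phi>_basis w_empty)
  ultimately have "\<Phi> \<in> ring_iso (ext_algebra (invariants G)) (chi_algebra G \<theta> Q)"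
    using bij bij_betwE[OF bij]
    by (auto simp: ring_iso_def ring_hom_def ext_algebra_def chi_algebra_def \<Phi>_add)
  then show ?thesis
    unfolding graded_algebra_iso_def using \<Phi>_degree
    by (simp add: ext_algebra_def chi_algebra_def \<Phi>_scale)
qed

lemma all_chi_forms_span:
  "all_chi_forms G \<theta> = module_span (invariants G) (range (chi_wedge_set Q \<omega>))"
proof (intro equalityI subsetI)
  fix \<eta> assume "\<eta> \<in> all_chi_forms G \<theta>"
  then have "chi_invariant \<eta>" by (simp add: all_chi_forms_iff)
  then obtain c where c: "\<And>I. c I \<in> invariants G" "\<eta> = \<Phi> c"
    by (rule \<Phi>_surj) (rule that)
  \<comment> \<open>\<open>module_span\<close> sums over a set of forms with one coefficient each,
    so different I must give different forms.\<close>
  have inj: "inj w"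
  proof (rule injI)
    fix I J assume "w I = w J"
    then have "\<Phi> (ext_basis I) = \<Phi> (ext_basis J)" by (simp only: \<Phi>_basis)
    then have "(ext_basis I :: 'n set \<Rightarrow> 'n cvec \<Rightarrow> complex) = ext_basis J"
      by (rule \<Phi>_inj[rotated 2]) (simp_all add: ext_basis_def)
    from fun_cong[OF this, of I] show "I = J" by (simp add: ext_basis_def split: if_splits)
  qed
  have "\<eta> = (\<Sum>x\<in>range w. scale (c (inv_into UNIV w x)) x)"
    by (simp add: c(2) \<Phi>_def sum.reindex[OF inj] inv_f_f[OF inj])
  moreover have "range w = range (chi_wedge_set Q \<omega>)" by (simp add: w_def image_def)
  ultimately show "\<eta> \<in> module_span (invariants G) (range (chi_wedge_set Q \<omega>))"
    unfolding module_span_def using c(1)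
    by (intro CollectI exI[of _ "range w"] exI[of _ "\<lambda>x. c (inv_into UNIV w x)"]) auto
next
  fix \<eta> assume "\<eta> \<in> module_span (invariants G) (range (chi_wedge_set Q \<omega>))"
  then obtain F r where F: "\<eta> = (\<Sum>x\<in>F. scale (r x) x)" "F \<subseteq> range w" "\<And>x. x \<in> F \<Longrightarrow> r x \<in> invariants G"
    unfolding module_span_def w_def[abs_def] by blast
  have "chi_invariant (scale (r x) x)" if "x \<in> F" for x
    using F(2,3) that w_invariant by (intro chi_invariant_scale) auto
  then show "\<eta> \<in> all_chi_forms G \<theta>" unfolding all_chi_forms_iff F(1) by (rule chi_invariant_sum)
qed

end

theorem corollary2:
  fixes G :: "('n::{finite,linorder} cmat) set"
    and \<theta> :: "'n cmat \<Rightarrow> complex"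
    and \<alpha> :: "('n cvec) set \<Rightarrow> 'n cvec \<Rightarrow> complex"
    and s :: "('n cvec) set \<Rightarrow> 'n cmat"
    and Q :: "'n cvec \<Rightarrow> complex"
  assumes "reflection_group G"
    and "multiplicative_character G \<theta>"
    and "\<And>H. H \<in> reflecting_hyperplanes G \<Longrightarrow> linear_form_with_kernel (\<alpha> H) H"
    and "\<And>H. H \<in> reflecting_hyperplanes G \<Longrightarrow>
           generate unitary_group {s H} = pointwise_stabilizer G H"
    and "Q = Q_poly G \<theta> s \<alpha>"
  shows "(\<forall>\<mu>\<in>all_chi_forms G \<theta>. \<forall>\<nu>\<in>all_chi_forms G \<theta>.
            chi_wedge Q \<mu> \<nu> \<in> all_chi_forms G \<theta> \<and> scale Q (chi_wedge Q \<mu> \<nu>) = wedge \<mu> \<nu>) \<and>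
         (\<exists>\<omega>. (\<forall>i. \<omega> i \<in> chi_forms G \<theta> 1) \<and>
            all_chi_forms G \<theta> = module_span (invariants G) (range (chi_wedge_set Q \<omega>)) \<and>
            (\<exists>\<Phi>. graded_algebra_iso (invariants G)
                   (ext_algebra (invariants G)) (ext_power (invariants G))
                   (chi_algebra G \<theta> Q) (chi_forms G \<theta>) \<Phi> \<and>
                 (\<forall>i. \<Phi> (ext_gen i) = \<omega> i)))"
proof -
  interpret R: reflection_data G \<theta> \<alpha> s
    by (intro reflection_data.intro reflection_setup.intro finite_unitary_group.intro
        reflection_setup_axioms.intro reflection_data_axioms.intro)
      (use assms(1-4)[unfolded reflection_group_def] in blast)+
  obtain \<omega> :: "'n \<Rightarrow> 'n form" where \<omega>: "\<And>i. \<omega> i \<in> chi_forms G \<theta> 1"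
    "\<And>u. u \<in> chi_forms G \<theta> 1 \<Longrightarrow> \<exists>r. (\<forall>i. r i \<in> invariants G) \<and> u = (\<Sum>i\<in>UNIV. scale (r i) (\<omega> i))"
  proof (rule R.chi_one_forms_generated)
    fix \<omega> :: "'n \<Rightarrow> 'n form" assume 1: "\<And>i. \<omega> i \<in> chi_forms G \<theta> 1"
      and 2: "\<And>u. u \<in> chi_forms G \<theta> 1 \<Longrightarrow> \<exists>r. (\<forall>i. r i \<in> invariants G) \<and> u = (\<Sum>i\<in>UNIV. scale (r i) (\<omega> i))"
    show thesis by (rule that[of \<omega>]) (rule 1, erule 2)
  qed
  interpret C: chi_generators G \<theta> \<alpha> s \<omega> by unfold_locales (fact \<omega>)+
  show ?thesis
    unfolding assms(5)
  proof (intro conjI exI[of _ \<omega>] exI[of _ C.\<Phi>] ballI allI)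
    fix \<mu> \<nu> assume "\<mu> \<in> all_chi_forms G \<theta>" "\<nu> \<in> all_chi_forms G \<theta>"
    then show "chi_wedge (Q_poly G \<theta> s \<alpha>) \<mu> \<nu> \<in> all_chi_forms G \<theta>"
      "scale (Q_poly G \<theta> s \<alpha>) (chi_wedge (Q_poly G \<theta> s \<alpha>) \<mu> \<nu>) = wedge \<mu> \<nu>"
      using R.chi_wedge_props by (simp_all add: R.all_chi_forms_iff)
  qed (fact \<omega>(1) C.all_chi_forms_span C.ext_algebra_iso C.\<Phi>_ext_gen)+
qed

end
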